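(* Let $\Gamma$ be one of the following groups: $\mathbb{Z}_m\,\mathrm{wr}\,\mathbb{Z}$ with $m$ a positive integer relatively prime to $6$; or $\mathbb{Z}_p\,\mathrm{wr}\,\mathbb{Z}^k$ with $p>3$ prime and $k\ge1$ arbitrary; or $\mathbb{Z}_3\,\mathrm{wr}\,\mathbb{Z}^{2d}$ with $d\ge1$. Then the twisted Burnside–Frobenius theorem holds for $\Gamma$: for every automorphism $\phi:\Gamma\to\Gamma$ with $R(\phi)<\infty$, $R(\phi)$ equals the number of equivalence classes $[\rho]$ of finite-dimensional irreducible unitary representations $\rho$ of $\Gamma$ that are fixed by the map $\widehat{\phi}:[\rho]\mapsto[\rho\circ\phi]$.
   Context: For an automorphism $\phi$ of a group $G$, $R(\phi)$ is the number of Reidemeister classes, i.e. classes of the relation $g\sim hg\phi(h^{-1})$, $h,g\in G$. For $n\ge1$ and $k\ge1$, the restricted wreath product $\mathbb{Z}_n\,\mathrm{wr}\,\mathbb{Z}^k$ is $\left(\bigoplus_{x\in\mathbb{Z}^k}A_x\right)\rtimes_\alpha\mathbb{Z}^k$ with $A_x\cong\mathbb{Z}_n$ generated by $\delta_x$, finitely supported direct sum, and $\alpha(y)(\delta_x)=\delta_{y+x}$. *)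

theory Defs
  imports "Jordan_Normal_Form.Matrix" "HOL-Algebra.Coset" "HOL-Computational_Algebra.Primes"
begin

text \<open>Elements of Z^k are integer lists of length k.  An element of the direct sum
 of copies A_x = Z_m (x in Z^k) is a finitely supported function on Z^k with values
 in {0..<m} (residues mod m), vanishing outside lists of length k.  The element
 (a, y) of the semidirect product multiplies as (a,y)(b,z) = (a + alpha(y) b, y + z),
 where (alpha(y) b)(x) = b(x - y), so that alpha(y) delta_x = delta_(y+x).\<close>

definition zk :: "nat \<Rightarrow> int list set" where
  "zk k = {v. length v = k}"

definition wr_carrier :: "nat \<Rightarrow> nat \<Rightarrow> ((int list \<Rightarrow> int) \<times> int list) set" where
  "wr_carrier m k = {(a, y). length y = k \<and> finite {x. a x \<noteq> 0}
      \<and> (\<forall>x. a x \<noteq> 0 \<longrightarrow> length x = k) \<and> (\<forall>x. 0 \<le> a x \<and> a x < int m)}"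

definition wr_mult :: "nat \<Rightarrow> nat \<Rightarrow> ((int list \<Rightarrow> int) \<times> int list)
     \<Rightarrow> ((int list \<Rightarrow> int) \<times> int list) \<Rightarrow> ((int list \<Rightarrow> int) \<times> int list)" where
  "wr_mult m k p q = (\<lambda>x. if length x = k
        then (fst p x + fst q (map2 (-) x (snd p))) mod int m else 0,
      map2 (+) (snd p) (snd q))"

definition wreath_Zm_Zk :: "nat \<Rightarrow> nat \<Rightarrow> ((int list \<Rightarrow> int) \<times> int list) monoid" where
  "wreath_Zm_Zk m k = \<lparr> carrier = wr_carrier m k, mult = wr_mult m k,
      one = (\<lambda>x. 0, replicate k 0) \<rparr>"

definition twisted_conj :: "('a, 'b) monoid_scheme \<Rightarrow> ('a \<Rightarrow> 'a) \<Rightarrow> ('a \<times> 'a) set" where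
  "twisted_conj G \<phi> = {(g, g'). g \<in> carrier G \<and> g' \<in> carrier G \<and>
      (\<exists>h \<in> carrier G. g' = h \<otimes>\<^bsub>G\<^esub> g \<otimes>\<^bsub>G\<^esub> \<phi> (inv\<^bsub>G\<^esub> h))}"

definition reidemeister_classes :: "('a, 'b) monoid_scheme \<Rightarrow> ('a \<Rightarrow> 'a) \<Rightarrow> 'a set set" where
  "reidemeister_classes G \<phi> = carrier G // twisted_conj G \<phi>"

definition adj_mat :: "complex mat \<Rightarrow> complex mat" where
  "adj_mat U = transpose_mat (map_mat cnj U)"

definition unitary_mat :: "nat \<Rightarrow> complex mat \<Rightarrow> bool" where
  "unitary_mat n U \<longleftrightarrow> U \<in> carrier_mat n n \<and> U * adj_mat U = 1\<^sub>m n \<and> adj_mat U * U = 1\<^sub>m n"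

definition unitary_rep :: "('a, 'b) monoid_scheme \<Rightarrow> nat \<Rightarrow> ('a \<Rightarrow> complex mat) \<Rightarrow> bool" where
  "unitary_rep G n \<rho> \<longleftrightarrow> (\<forall>g \<in> carrier G. unitary_mat n (\<rho> g)) \<and>
     (\<forall>g \<in> carrier G. \<forall>h \<in> carrier G. \<rho> (g \<otimes>\<^bsub>G\<^esub> h) = \<rho> g * \<rho> h)"

definition linear_subspace :: "nat \<Rightarrow> complex vec set \<Rightarrow> bool" where
  "linear_subspace n W \<longleftrightarrow> W \<subseteq> carrier_vec n \<and> 0\<^sub>v n \<in> W \<and>
     (\<forall>v \<in> W. \<forall>w \<in> W. v + w \<in> W) \<and> (\<forall>c. \<forall>v \<in> W. c \<cdot>\<^sub>v v \<in> W)"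

definition irreducible_unitary_rep :: "('a, 'b) monoid_scheme \<Rightarrow> nat \<Rightarrow> ('a \<Rightarrow> complex mat) \<Rightarrow> bool" where
  "irreducible_unitary_rep G n \<rho> \<longleftrightarrow> n \<ge> 1 \<and> unitary_rep G n \<rho> \<and>
     (\<forall>W. linear_subspace n W \<and> (\<forall>g \<in> carrier G. \<forall>w \<in> W. \<rho> g *\<^sub>v w \<in> W)
          \<longrightarrow> W = {0\<^sub>v n} \<or> W = carrier_vec n)"

text \<open>The set of all finite-dimensional irreducible unitary representations; the
 dimension is recovered as the size of the matrices.\<close>
definition irr_reps :: "('a, 'b) monoid_scheme \<Rightarrow> ('a \<Rightarrow> complex mat) set" where
  "irr_reps G = {\<rho>. \<exists>n. irreducible_unitary_rep G n \<rho>}"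

definition rep_equiv :: "('a, 'b) monoid_scheme \<Rightarrow> (('a \<Rightarrow> complex mat) \<times> ('a \<Rightarrow> complex mat)) set" where
  "rep_equiv G = {(\<rho>, \<sigma>). \<rho> \<in> irr_reps G \<and> \<sigma> \<in> irr_reps G \<and>
     (\<exists>n U. unitary_mat n U \<and> (\<forall>g \<in> carrier G. \<rho> g \<in> carrier_mat n n \<and>
          \<sigma> g = U * \<rho> g * adj_mat U))}"

definition unitary_dual :: "('a, 'b) monoid_scheme \<Rightarrow> ('a \<Rightarrow> complex mat) set set" where
  "unitary_dual G = irr_reps G // rep_equiv G"

definition fixed_dual_classes :: "('a, 'b) monoid_scheme \<Rightarrow> ('a \<Rightarrow> 'a) \<Rightarrow> ('a \<Rightarrow> complex mat) set set" where
  "fixed_dual_classes G \<phi> = {C \<in> unitary_dual G. \<exists>\<rho> \<in> C. rep_equiv G `` {\<rho> \<circ> \<phi>} = C}"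

end

theory Submission
  imports "Jordan_Normal_Form.Spectral_Radius" "HOL-Library.Function_Algebras"
    "HOL-Library.List_Lexorder" Defs
begin

text \<open>The number of \<open>\<phi>\<close>-fixed classes is compared with the dimension of the space of functions
  that are constant on Reidemeister classes.  If an irreducible \<open>\<rho>\<close> is equivalent to \<open>\<rho> \<circ> \<phi>\<close> via
  \<open>U\<close>, then \<open>g \<mapsto> tr (U \<rho>(g))\<close> is such a function, and by Frobenius-Schur these functions are
  linearly independent.  They span as soon as every Reidemeister class has only finitely many right
  translates: the indicator of a class is then a matrix coefficient of a permutation representation
  with finite image, and averaging followed by a decomposition into irreducibles writes it in terms
  of the functions above.

  For the wreath product, \<open>\<phi>\<close> restricts to the torsion subgroup \<open>\<Sigma>\<close> and induces \<open>M \<in> GL\<^sub>k(\<int>)\<close>.  Modulo a prime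
  \<open>p | m\<close>, the image of \<open>\<delta>\<^sub>0\<close> is a unit of \<open>F\<^sub>p[\<int>\<^sup>k]\<close>, hence a monomial, so \<open>\<alpha>(y)\<phi>\<close> acts
  on \<open>\<Sigma>/p\<Sigma>\<close> by \<open>\<delta>\<^sub>x \<mapsto> c \<delta>\<^sub>T\<^sub>x\<close> with \<open>T\<close> affine.  Dilations about the fixed point of \<open>T\<close> commute
  with \<open>T\<close>, and they would produce infinitely many classes unless \<open>1 - \<alpha>(y)\<phi>\<close> is onto.  Therefore
  the Reidemeister classes of \<open>\<phi>\<close> are the preimages of the cosets of \<open>(1 - M)\<int>\<^sup>k\<close>, a sublattice of
  finite index.\<close>

section \<open>Complex matrices and Schur's lemma\<close>

text \<open>Counting by exchange between two families of functions means that no finite quotient on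
  which \<phi> acts has to be constructed; finitely many translates of each class are enough. In the
  wreath product the obstacle is the conjugator: (a, y) and (a', y) might be conjugate through an
  element with nonzero component in Z^k. Since (1 - M)Z^k contains N Z^k for some N > 0, 1 - M is
  injective, so such a conjugator lies in the torsion subgroup, and the relation becomes a' - a = b
  - \<alpha>(y)\<phi>(b), linear in b with y fixed. This is why 1 - \<alpha>(y)\<phi> is studied for
  each y separately. The fixed point of T is in general only rational, of the form w/N; the
  dilations about it by 1 + jN preserve Z^k because the factor is congruent to 1 modulo N.
  Surjectivity modulo single primes is lifted to m one prime factor at a time, so m may have
  repeated factors.\<close>

text \<open>Here \<open>adj_mat\<close> is the conjugate transpose, not the adjugate \<open>Determinant.adj_mat\<close>.\<close>

lemma adj_mat_dim [simp]: "dim_row (adj_mat A) = dim_col A" "dim_col (adj_mat A) = dim_row A"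
  by (simp_all add: adj_mat_def)

lemma adj_mat_carrier [simp]: "A \<in> carrier_mat n m \<Longrightarrow> adj_mat A \<in> carrier_mat m n"
  by (auto intro!: carrier_matI)

lemma adj_mat_index [simp]:
  "i < dim_col A \<Longrightarrow> j < dim_row A \<Longrightarrow> adj_mat A $$ (i, j) = cnj (A $$ (j, i))"
  by (simp add: adj_mat_def)

lemma mat_assoc:
  fixes A B C :: "'a::semiring_0 mat"
  assumes "dim_col A = dim_row B" "dim_col B = dim_row C"
  shows "A * B * C = A * (B * C)"
  using assms by (intro assoc_mult_mat[of _ "dim_row A" "dim_col A" _ "dim_col B" _ "dim_col C"]) auto

lemma mat_vec_assoc:
  fixes A B :: "'a::comm_semiring_0 mat"
  assumes "dim_col A = dim_row B" "dim_col B = dim_vec v"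
  shows "A * B *\<^sub>v v = A *\<^sub>v (B *\<^sub>v v)"
  using assms by (intro assoc_mult_mat_vec[of _ "dim_row A" "dim_col A" _ "dim_col B"]) auto

lemma mat_mult_index:
  "i < dim_row A \<Longrightarrow> j < dim_col B \<Longrightarrow> dim_col A = dim_row B \<Longrightarrow>
     (A * B) $$ (i, j) = (\<Sum>k<dim_row B. A $$ (i, k) * B $$ (k, j))"
  by (auto simp: scalar_prod_def lessThan_atLeast0 intro!: sum.cong)

lemma mat_vec_index:
  "i < dim_row A \<Longrightarrow> dim_col A = dim_vec v \<Longrightarrow>
     (A *\<^sub>v v) $ i = (\<Sum>k<dim_vec v. A $$ (i, k) * v $ k)"
  by (auto simp: scalar_prod_def lessThan_atLeast0 intro!: sum.cong)

lemma adj_mat_mult: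
  assumes "dim_col A = dim_row B"
  shows "adj_mat (A * B) = adj_mat B * adj_mat A"
  by (rule eq_matI) (use assms in \<open>auto simp: mat_mult_index mult.commute simp del: index_mult_mat(1)\<close>)

lemma adj_mat_adj_mat [simp]: "adj_mat (adj_mat A) = A"
  by (rule eq_matI) auto

lemma adj_mat_one [simp]: "adj_mat (1\<^sub>m n) = 1\<^sub>m n"
  by (rule eq_matI) auto

lemma adj_mat_smult [simp]: "adj_mat (c \<cdot>\<^sub>m A) = cnj c \<cdot>\<^sub>m adj_mat A"
  by (rule eq_matI) auto

lemma mat_mult_smult_left: "dim_col A = dim_row B \<Longrightarrow> (c::'a::comm_semiring_0) \<cdot>\<^sub>m A * B = c \<cdot>\<^sub>m (A * B)"
  by (rule mult_smult_assoc_mat[of _ "dim_row A" "dim_col A" _ "dim_col B"]) auto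

lemma mat_mult_smult_right: "dim_col A = dim_row B \<Longrightarrow> A * ((c::'a::comm_semiring_0) \<cdot>\<^sub>m B) = c \<cdot>\<^sub>m (A * B)"
  by (rule mult_smult_distrib[of _ "dim_row A" "dim_col A" _ "dim_col B"]) auto

lemma mat_one_mult [simp]: "dim_row A = n \<Longrightarrow> 1\<^sub>m n * (A::'a::semiring_1 mat) = A"
  "dim_col A = n \<Longrightarrow> A * 1\<^sub>m n = A"
  by (auto intro: left_mult_one_mat[of _ _ "dim_col A"] right_mult_one_mat[of _ "dim_row A"])

definition mtr :: "complex mat \<Rightarrow> complex" where
  "mtr A = (\<Sum>i<dim_row A. A $$ (i, i))"

lemma mtr_comm:
  assumes "dim_row A = dim_col B" "dim_col A = dim_row B"
  shows "mtr (A * B) = mtr (B * A)"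
proof -
  have "mtr (A * B) = (\<Sum>i<dim_row A. \<Sum>k<dim_row B. A $$ (i, k) * B $$ (k, i))"
    using assms by (simp add: mtr_def mat_mult_index del: index_mult_mat(1))
  also have "\<dots> = (\<Sum>k<dim_row B. \<Sum>i<dim_row A. A $$ (i, k) * B $$ (k, i))"
    by (rule sum.swap)
  also have "\<dots> = mtr (B * A)"
    using assms by (simp add: mtr_def mat_mult_index mult.commute del: index_mult_mat(1))
  finally show ?thesis .
qed

lemma mtr_smult: "dim_row A = dim_col A \<Longrightarrow> mtr (c \<cdot>\<^sub>m A) = c * mtr A"
  by (simp add: mtr_def sum_distrib_left)

lemma mtr_add: "A \<in> carrier_mat n n \<Longrightarrow> B \<in> carrier_mat n n \<Longrightarrow> mtr (A + B) = mtr A + mtr B"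
  by (auto simp add: mtr_def sum.distrib)

lemma mtr_mult:
  assumes "A \<in> carrier_mat n m" "B \<in> carrier_mat m n"
  shows "mtr (A * B) = (\<Sum>i<n. \<Sum>k<m. A $$ (i, k) * B $$ (k, i))"
  using assms by (auto simp add: mtr_def mat_mult_index simp del: index_mult_mat(1))

lemma adj_mult_self_diag:
  assumes "j < dim_col A"
  shows "(adj_mat A * A) $$ (j, j) = of_real (\<Sum>i<dim_row A. (cmod (A $$ (i, j)))\<^sup>2)"
  using assms by (simp add: mat_mult_index complex_norm_square mult.commute del: index_mult_mat(1) of_real_power)

text \<open>The diagonal entries of \<open>adj_mat A * A\<close> are the squared norms of the
  columns of \<open>A\<close>.\<close>

lemma adj_mult_self_eq_zero:
  assumes "adj_mat A * A = 0\<^sub>m (dim_col A) (dim_col A)"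
  shows "A = 0\<^sub>m (dim_row A) (dim_col A)"
proof (rule eq_matI)
  fix i j assume ij: "i < dim_row (0\<^sub>m (dim_row A) (dim_col A))" "j < dim_col (0\<^sub>m (dim_row A) (dim_col A) :: complex mat)"
  have "of_real (\<Sum>i<dim_row A. (cmod (A $$ (i, j)))\<^sup>2) = (0::complex)"
    using ij assms adj_mult_self_diag[of j A] by simp
  hence "(\<Sum>i<dim_row A. (cmod (A $$ (i, j)))\<^sup>2) = 0"
    by (simp only: of_real_eq_0_iff)
  hence "\<forall>i<dim_row A. (cmod (A $$ (i, j)))\<^sup>2 = 0"
    by (subst (asm) sum_nonneg_eq_0_iff) auto
  thus "A $$ (i, j) = 0\<^sub>m (dim_row A) (dim_col A) $$ (i, j)" using ij by auto
qed auto

lemma mat_eq_by_vec: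
  fixes A B :: "'a::comm_ring_1 mat"
  assumes "A \<in> carrier_mat n m" "B \<in> carrier_mat n m"
    and "\<And>v. v \<in> carrier_vec m \<Longrightarrow> A *\<^sub>v v = B *\<^sub>v v"
  shows "A = B"
proof (rule eq_matI)
  fix i j assume ij: "i < dim_row B" "j < dim_col B"
  have "(A *\<^sub>v unit_vec m j) $ i = (B *\<^sub>v unit_vec m j) $ i"
    using assms(3)[of "unit_vec m j"] by simp
  moreover have "(A *\<^sub>v unit_vec m j) $ i = A $$ (i, j)" "(B *\<^sub>v unit_vec m j) $ i = B $$ (i, j)"
    using ij assms(1,2) by simp_all
  ultimately show "A $$ (i, j) = B $$ (i, j)" by simp
qed (use assms in auto)

context group
begin

lemma unitary_rep_dim:
  assumes "unitary_rep G n \<rho>" "g \<in> carrier G"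
  shows "\<rho> g \<in> carrier_mat n n" "dim_row (\<rho> g) = n" "dim_col (\<rho> g) = n"
  using assms by (auto simp: unitary_rep_def unitary_mat_def)

lemma unitary_rep_adj:
  assumes "unitary_rep G n \<rho>" "g \<in> carrier G"
  shows "\<rho> g * adj_mat (\<rho> g) = 1\<^sub>m n" "adj_mat (\<rho> g) * \<rho> g = 1\<^sub>m n"
  using assms by (auto simp: unitary_rep_def unitary_mat_def)

lemma unitary_rep_mult:
  assumes "unitary_rep G n \<rho>" "g \<in> carrier G" "h \<in> carrier G"
  shows "\<rho> (g \<otimes> h) = \<rho> g * \<rho> h"
  using assms by (auto simp: unitary_rep_def)

lemma unitary_rep_one:
  assumes "unitary_rep G n \<rho>"
  shows "\<rho> \<one> = 1\<^sub>m n"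
proof -
  note d = unitary_rep_dim[OF assms one_closed]
  have "\<rho> \<one> = \<rho> \<one> * (\<rho> \<one> * adj_mat (\<rho> \<one>))"
    by (simp add: unitary_rep_adj[OF assms] d)
  also have "\<dots> = (\<rho> \<one> * \<rho> \<one>) * adj_mat (\<rho> \<one>)"
    by (simp add: mat_assoc d)
  also have "\<dots> = 1\<^sub>m n"
    by (simp add: unitary_rep_mult[OF assms, symmetric] unitary_rep_adj[OF assms])
  finally show ?thesis .
qed

lemma unitary_rep_inv:
  assumes "unitary_rep G n \<rho>" "g \<in> carrier G"
  shows "\<rho> (inv g) = adj_mat (\<rho> g)"
proof -
  note d = unitary_rep_dim[OF assms] unitary_rep_dim[OF assms(1) inv_closed[OF assms(2)]]
  have "\<rho> (inv g) = \<rho> (inv g) * (\<rho> g * adj_mat (\<rho> g))"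
    by (simp add: unitary_rep_adj[OF assms] d)
  also have "\<dots> = (\<rho> (inv g) * \<rho> g) * adj_mat (\<rho> g)"
    by (simp add: mat_assoc d)
  also have "\<dots> = adj_mat (\<rho> g)"
    using assms(2) by (simp add: unitary_rep_mult[OF assms(1), symmetric] unitary_rep_one[OF assms(1)] d)
  finally show ?thesis .
qed

definition intertwines where
  "intertwines A n \<rho> m \<sigma> \<longleftrightarrow> A \<in> carrier_mat m n \<and> (\<forall>g\<in>carrier G. A * \<rho> g = \<sigma> g * A)"

text \<open>An eigenspace of \<open>B\<close> is invariant because \<open>B\<close> commutes with
  the representation; it is nonzero, so irreducibility makes it the whole space. An eigenvalue
  exists because \<open>n \<ge> 1\<close>.\<close>

lemma schur_scalar:
  assumes irr: "irreducible_unitary_rep G n \<rho>" and B: "intertwines B n \<rho> n \<rho>"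
  shows "\<exists>c. B = c \<cdot>\<^sub>m 1\<^sub>m n"
proof -
  have n: "n \<ge> 1" and rep: "unitary_rep G n \<rho>"
    and inv: "\<And>W. linear_subspace n W \<Longrightarrow> (\<forall>g \<in> carrier G. \<forall>w \<in> W. \<rho> g *\<^sub>v w \<in> W) \<Longrightarrow> W = {0\<^sub>v n} \<or> W = carrier_vec n"
    using irr by (auto simp: irreducible_unitary_rep_def)
  have Bc: "B \<in> carrier_mat n n" and Bi: "\<And>g. g \<in> carrier G \<Longrightarrow> B * \<rho> g = \<rho> g * B"
    using B by (auto simp: intertwines_def)
  obtain c where "c \<in> spectrum B"
    using spectrum_non_empty[OF Bc] n by auto
  then obtain v where v: "v \<in> carrier_vec n" "v \<noteq> 0\<^sub>v n" "B *\<^sub>v v = c \<cdot>\<^sub>v v"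
    using Bc by (auto simp: spectrum_def eigenvalue_def eigenvector_def)
  define W where "W = {v \<in> carrier_vec n. B *\<^sub>v v = c \<cdot>\<^sub>v v}"
  have "linear_subspace n W"
    unfolding linear_subspace_def W_def using Bc
    by (auto simp: mult_add_distrib_mat_vec[of _ n n] smult_add_distrib_vec[of _ n] mult_mat_vec[of _ n n] smult_smult_assoc mult.commute)
  moreover have "\<forall>g \<in> carrier G. \<forall>w \<in> W. \<rho> g *\<^sub>v w \<in> W"
  proof (intro ballI)
    fix g w assume g: "g \<in> carrier G" and w: "w \<in> W"
    note d = unitary_rep_dim[OF rep g]
    have wc: "w \<in> carrier_vec n" "B *\<^sub>v w = c \<cdot>\<^sub>v w" using w by (auto simp: W_def)
    have "B *\<^sub>v (\<rho> g *\<^sub>v w) = (B * \<rho> g) *\<^sub>v w"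
      using d wc Bc by (simp add: mat_vec_assoc)
    also have "\<dots> = \<rho> g *\<^sub>v (B *\<^sub>v w)"
      using d wc Bc by (simp add: Bi g mat_vec_assoc)
    also have "\<dots> = c \<cdot>\<^sub>v (\<rho> g *\<^sub>v w)"
      using d wc by (simp add: mult_mat_vec[of _ n n])
    finally show "\<rho> g *\<^sub>v w \<in> W" using d wc by (auto simp: W_def)
  qed
  ultimately have "W = {0\<^sub>v n} \<or> W = carrier_vec n" by (rule inv)
  with v have W: "W = carrier_vec n" by (auto simp: W_def)
  have "B = c \<cdot>\<^sub>m 1\<^sub>m n"
  proof (rule mat_eq_by_vec[of _ n n])
    fix v :: "complex vec" assume v: "v \<in> carrier_vec n"
    hence "B *\<^sub>v v = c \<cdot>\<^sub>v v" using W by (auto simp: W_def)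
    thus "B *\<^sub>v v = c \<cdot>\<^sub>m 1\<^sub>m n *\<^sub>v v" using v by (intro eq_vecI) (auto simp: scalar_prod_def if_distrib if_distribR sum.If_cases cong: if_cong)
  qed (use Bc in auto)
  thus ?thesis by blast
qed

lemma intertwines_adj:
  assumes A: "intertwines A n \<rho> m \<sigma>" and r: "unitary_rep G n \<rho>" and s: "unitary_rep G m \<sigma>"
  shows "intertwines (adj_mat A) m \<sigma> n \<rho>"
  unfolding intertwines_def
proof (intro conjI ballI)
  have Ac: "dim_row A = m" "dim_col A = n" using A by (auto simp: intertwines_def)
  show "adj_mat A \<in> carrier_mat n m" using A by (auto simp: intertwines_def)
  fix g assume g: "g \<in> carrier G"
  note d = unitary_rep_dim[OF r g] unitary_rep_dim[OF s g]
  have "adj_mat (A * \<rho> g) = adj_mat (\<sigma> g * A)" using A g by (simp add: intertwines_def)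
  hence eq: "adj_mat (\<rho> g) * adj_mat A = adj_mat A * adj_mat (\<sigma> g)"
    by (simp add: adj_mat_mult d Ac)
  have "adj_mat A * \<sigma> g = (\<rho> g * adj_mat (\<rho> g)) * adj_mat A * \<sigma> g"
    by (simp add: unitary_rep_adj[OF r g] Ac)
  also have "\<dots> = \<rho> g * (adj_mat (\<rho> g) * adj_mat A) * \<sigma> g"
    by (simp add: mat_assoc d Ac)
  also have "\<dots> = \<rho> g * adj_mat A * (adj_mat (\<sigma> g) * \<sigma> g)"
    unfolding eq by (simp add: mat_assoc d Ac)
  also have "\<dots> = \<rho> g * adj_mat A"
    by (simp add: unitary_rep_adj[OF s g] d Ac)
  finally show "adj_mat A * \<sigma> g = \<rho> g * adj_mat A" .
qed

lemma intertwines_mult: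
  assumes A: "intertwines A n \<rho> m \<sigma>" and B: "intertwines B m \<sigma> l \<tau>"
    and r: "unitary_rep G n \<rho>" and s: "unitary_rep G m \<sigma>" and t: "unitary_rep G l \<tau>"
  shows "intertwines (B * A) n \<rho> l \<tau>"
  unfolding intertwines_def
proof (intro conjI ballI)
  have Ac: "dim_row A = m" "dim_col A = n" "dim_row B = l" "dim_col B = m"
    using A B by (auto simp: intertwines_def)
  show "B * A \<in> carrier_mat l n" using Ac by (auto intro: carrier_matI)
  fix g assume g: "g \<in> carrier G"
  note d = unitary_rep_dim[OF r g] unitary_rep_dim[OF s g] unitary_rep_dim[OF t g]
  have "B * A * \<rho> g = B * (\<sigma> g * A)" using A g by (simp add: mat_assoc d Ac intertwines_def)
  also have "\<dots> = (B * \<sigma> g) * A" by (simp add: mat_assoc d Ac)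
  also have "\<dots> = \<tau> g * (B * A)" using B g by (simp add: mat_assoc d Ac intertwines_def)
  finally show "B * A * \<rho> g = \<tau> g * (B * A)" .
qed

text \<open>\<open>rep_equiv\<close> asks for a unitary matrix, whereas the arguments below only
  yield some nonzero intertwiner; this bridges the two. Both \<open>adj_mat A * A\<close> and
  \<open>A * adj_mat A\<close> are scalar by Schur's lemma, and the common scalar is a positive
  real, so \<open>A\<close> is a multiple of a unitary matrix.\<close>

lemma schur_unitary:
  assumes r: "irreducible_unitary_rep G n \<rho>" and s: "irreducible_unitary_rep G m \<sigma>"
    and A: "intertwines A n \<rho> m \<sigma>" and nz: "A \<noteq> 0\<^sub>m m n"
  shows "m = n \<and> (\<exists>c U. c \<noteq> 0 \<and> unitary_mat n U \<and> A = c \<cdot>\<^sub>m U)"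
proof -
  have rr: "unitary_rep G n \<rho>" "n \<ge> 1" and ss: "unitary_rep G m \<sigma>" "m \<ge> 1"
    using r s by (auto simp: irreducible_unitary_rep_def)
  have Ac: "A \<in> carrier_mat m n" and d: "dim_row A = m" "dim_col A = n" using A by (auto simp: intertwines_def)
  note A' = intertwines_adj[OF A rr(1) ss(1)]
  obtain c where c: "adj_mat A * A = c \<cdot>\<^sub>m 1\<^sub>m n"
    using schur_scalar[OF r intertwines_mult[OF A A' rr(1) ss(1) rr(1)]] by blast
  obtain c' where c': "A * adj_mat A = c' \<cdot>\<^sub>m 1\<^sub>m m"
    using schur_scalar[OF s intertwines_mult[OF A' A ss(1) rr(1) ss(1)]] by blast
  have c0: "c \<noteq> 0"
  proof
    assume "c = 0"
    hence "adj_mat A * A = 0\<^sub>m (dim_col A) (dim_col A)" unfolding c d by (intro eq_matI) auto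
    from adj_mult_self_eq_zero[OF this] nz d show False by simp
  qed
  have eq: "c \<cdot>\<^sub>m A = c' \<cdot>\<^sub>m A"
  proof -
    have "A * (adj_mat A * A) = (A * adj_mat A) * A" by (simp add: mat_assoc)
    thus ?thesis unfolding c c' by (simp add: mat_mult_smult_left mat_mult_smult_right d)
  qed
  have "c' = c"
  proof (rule ccontr)
    assume "c' \<noteq> c"
    have "A = 0\<^sub>m m n"
    proof (rule eq_matI)
      fix i j assume "i < dim_row (0\<^sub>m m n)" "j < dim_col (0\<^sub>m m n)"
      hence "(c \<cdot>\<^sub>m A) $$ (i,j) = (c' \<cdot>\<^sub>m A) $$ (i,j)" "i < m" "j < n" using eq by auto
      thus "A $$ (i,j) = 0\<^sub>m m n $$ (i,j)" using \<open>c' \<noteq> c\<close> d by simp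
    qed (use d in auto)
    with nz show False by simp
  qed
  \<comment> \<open>The common trace is \<open>n\<close> times the scalar on one side and
    \<open>m\<close> times it on the other.\<close>
  have "mtr (adj_mat A * A) = mtr (A * adj_mat A)" by (rule mtr_comm) auto
  hence "of_nat n * c = of_nat m * c" unfolding c c' \<open>c' = c\<close> by (simp add: mtr_def)
  hence mn: "m = n" using c0 by simp
  define t where "t = (\<Sum>i<m. (cmod (A $$ (i, 0)))\<^sup>2)"
  \<comment> \<open>\<open>c\<close> is the squared norm of the first column of \<open>A\<close>;
    hence its root \<open>q\<close> can be taken real and is its own conjugate.\<close>
  have "c = (adj_mat A * A) $$ (0,0)" unfolding c using rr by simp
  also have "\<dots> = of_real t" using rr by (subst adj_mult_self_diag) (simp_all add: d t_def)
  finally have ct: "c = of_real t" .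
  have "t \<ge> 0" unfolding t_def by (intro sum_nonneg) auto
  with ct c0 have t: "t > 0" by auto
  define q where "q = complex_of_real (sqrt t)"
  have q: "q \<noteq> 0" "cnj q = q" "q * q = c" using t
    by (auto simp: q_def ct simp flip: of_real_mult)
  define U where "U = inverse q \<cdot>\<^sub>m A"
  have Uc: "U \<in> carrier_mat n n" using Ac mn by (simp add: U_def)
  have 1: "adj_mat U * U = 1\<^sub>m n"
    using q by (intro eq_matI) (auto simp: U_def mat_mult_smult_left mat_mult_smult_right d c field_simps simp flip: q(3))
  have 2: "U * adj_mat U = 1\<^sub>m n"
    using mat_mult_left_right_inverse[OF _ Uc 1] Uc by auto
  have "A = q \<cdot>\<^sub>m U" using q by (intro eq_matI) (auto simp: U_def)
  with q 1 2 Uc mn show ?thesis by (auto simp: unitary_mat_def)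
qed

section \<open>Linear independence of matrix coefficients\<close>

lemma irreducibleD:
  assumes "irreducible_unitary_rep G n \<rho>"
  shows "unitary_rep G n \<rho>" "n \<ge> 1"
  using assms by (auto simp: irreducible_unitary_rep_def)

text \<open>The Frobenius-Schur theorem as a shortest-relation argument. An index pairs a
  representation with a row, and the vectors \<open>x\<close> will be columns of coefficient
  matrices. In a relation supported on \<open>s\<close>, one coordinate determines all others,
  because a relation vanishing at one index lives on a smaller set. The map from that coordinate to
  another one is then an intertwiner, so Schur's lemma makes it scalar or zero.\<close>

lemma columns_independent:
  fixes \<rho> :: "'i \<Rightarrow> 'a \<Rightarrow> complex mat" and n :: "'i \<Rightarrow> nat"
  assumes irr: "\<And>i. i \<in> I \<Longrightarrow> irreducible_unitary_rep G (n i) (\<rho> i)"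
    and ineq: "\<And>i j X. i \<in> I \<Longrightarrow> j \<in> I \<Longrightarrow> i \<noteq> j \<Longrightarrow>
      intertwines X (n i) (\<rho> i) (n j) (\<rho> j) \<Longrightarrow> X = 0\<^sub>m (n j) (n i)"
    and fin: "finite s" and sub: "s \<subseteq> Sigma I (\<lambda>i. {..<n i})"
    and xc: "\<And>\<alpha>. \<alpha> \<in> s \<Longrightarrow> x \<alpha> \<in> carrier_vec (n (fst \<alpha>))"
    and rel: "\<And>g. g \<in> carrier G \<Longrightarrow> (\<Sum>\<alpha>\<in>s. (\<rho> (fst \<alpha>) g *\<^sub>v x \<alpha>) $ snd \<alpha>) = 0"
  shows "\<forall>\<alpha>\<in>s. x \<alpha> = 0\<^sub>v (n (fst \<alpha>))"
  using fin sub xc rel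
proof (induction s arbitrary: x rule: finite_psubset_induct)
  case (psubset s)
  let ?r = "\<lambda>\<alpha>. \<rho> (fst \<alpha>)" and ?d = "\<lambda>\<alpha>. n (fst \<alpha>)"
  \<comment> \<open>All relations supported on \<open>s\<close>: a subrepresentation of the direct
    sum over \<open>s\<close>.\<close>
  define M where "M = {x. (\<forall>\<alpha>\<in>s. x \<alpha> \<in> carrier_vec (?d \<alpha>)) \<and>
     (\<forall>g\<in>carrier G. (\<Sum>\<alpha>\<in>s. (?r \<alpha> g *\<^sub>v x \<alpha>) $ snd \<alpha>) = 0)}"
  have inI: "fst \<alpha> \<in> I" and sn: "snd \<alpha> < ?d \<alpha>" if "\<alpha> \<in> s" for \<alpha>
    using psubset.prems(1) that by auto
  have rep: "unitary_rep G (?d \<alpha>) (?r \<alpha>)" if "\<alpha> \<in> s" for \<alpha>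
    by (rule irreducibleD(1)[OF irr[OF inI[OF that]]])
  note rd = unitary_rep_dim[OF rep]
  \<comment> \<open>Dropping an index where \<open>y\<close> vanishes leaves a relation on a proper
    subset, so the induction hypothesis applies. In other words, the projection of \<open>M\<close>
    to a single coordinate is injective.\<close>
  have step: "\<forall>\<beta>\<in>s. y \<beta> = 0\<^sub>v (?d \<beta>)"
    if y: "y \<in> M" and \<alpha>: "\<alpha> \<in> s" "y \<alpha> = 0\<^sub>v (?d \<alpha>)" for y \<alpha>
  proof -
    have "\<forall>\<beta>\<in>s - {\<alpha>}. y \<beta> = 0\<^sub>v (?d \<beta>)"
    proof (rule psubset.IH)
      show "s - {\<alpha>} \<subset> s" using \<alpha> by blast
      fix g assume g: "g \<in> carrier G"
      have "(\<Sum>\<beta>\<in>s. (?r \<beta> g *\<^sub>v y \<beta>) $ snd \<beta>) = 0" using y g by (auto simp: M_def)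
      moreover have "(?r \<alpha> g *\<^sub>v y \<alpha>) $ snd \<alpha> = 0"
        using \<alpha> rd[OF \<alpha>(1) g] sn[OF \<alpha>(1)] by simp
      ultimately show "(\<Sum>\<beta>\<in>s - {\<alpha>}. (?r \<beta> g *\<^sub>v y \<beta>) $ snd \<beta>) = 0"
        using psubset.hyps \<alpha> by (simp add: sum_diff1)
    qed (use psubset.prems y in \<open>auto simp: M_def\<close>)
    with \<alpha> show ?thesis by blast
  qed
  have M_trans: "(\<lambda>\<alpha>. ?r \<alpha> h *\<^sub>v y \<alpha>) \<in> M" if y: "y \<in> M" and h: "h \<in> carrier G" for y h
  proof -
    have "(\<Sum>\<alpha>\<in>s. (?r \<alpha> g *\<^sub>v (?r \<alpha> h *\<^sub>v y \<alpha>)) $ snd \<alpha>)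
        = (\<Sum>\<alpha>\<in>s. (?r \<alpha> (g \<otimes> h) *\<^sub>v y \<alpha>) $ snd \<alpha>)" if g: "g \<in> carrier G" for g
    proof (rule sum.cong[OF refl])
      fix \<alpha> assume a: "\<alpha> \<in> s"
      have "y \<alpha> \<in> carrier_vec (?d \<alpha>)" using y a by (auto simp: M_def)
      thus "(?r \<alpha> g *\<^sub>v (?r \<alpha> h *\<^sub>v y \<alpha>)) $ snd \<alpha> = (?r \<alpha> (g \<otimes> h) *\<^sub>v y \<alpha>) $ snd \<alpha>"
        using rd[OF a g] rd[OF a h] by (simp add: unitary_rep_mult[OF rep[OF a] g h] mat_vec_assoc)
    qed
    moreover have "?r \<alpha> h *\<^sub>v y \<alpha> \<in> carrier_vec (?d \<alpha>)" if "\<alpha> \<in> s" for \<alpha>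
      using rd[OF that h] by (intro carrier_vecI) simp
    ultimately show ?thesis using y h by (auto simp: M_def)
  qed
  have M_comb: "(\<lambda>\<alpha>. y \<alpha> - c \<cdot>\<^sub>v z \<alpha>) \<in> M" if y: "y \<in> M" and z: "z \<in> M" for y z c
  proof -
    have "(?r \<alpha> g *\<^sub>v (y \<alpha> - c \<cdot>\<^sub>v z \<alpha>)) $ snd \<alpha> = (?r \<alpha> g *\<^sub>v y \<alpha>) $ snd \<alpha> - c * (?r \<alpha> g *\<^sub>v z \<alpha>) $ snd \<alpha>"
      if a: "\<alpha> \<in> s" and g: "g \<in> carrier G" for g \<alpha>
      using rd[OF a g] y z a sn[OF a]
      by (subst mult_minus_distrib_mat_vec[of _ "?d \<alpha>" "?d \<alpha>"])
        (auto simp: M_def mult_mat_vec[of _ "?d \<alpha>" "?d \<alpha>"])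
    thus ?thesis using y z by (auto simp: M_def sum_subtractf simp flip: sum_distrib_left)
  qed
  have M_diff: "(\<lambda>\<alpha>. y \<alpha> - z \<alpha>) \<in> M" if "y \<in> M" "z \<in> M" for y z
    using M_comb[OF that, of 1] by simp
  show ?case
  proof (rule ccontr)
    assume "\<not> ?case"
    then obtain \<alpha> where \<alpha>: "\<alpha> \<in> s" and nz: "x \<alpha> \<noteq> 0\<^sub>v (?d \<alpha>)" by blast
    have xM: "x \<in> M" using psubset.prems by (auto simp: M_def)
    obtain i j where ij: "\<alpha> = (i, j)" by force
    define k where "k = n i"
    have iI: "i \<in> I" and jk: "j < k" using \<alpha> ij psubset.prems(1) by (auto simp: k_def)
    \<comment> \<open>The image of this projection is invariant and contains the nonzero vector
      \<open>x \<alpha>\<close>, hence is everything.\<close>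
    define W where "W = (\<lambda>y. y \<alpha>) ` M"
    have WI: "v \<in> W" if "y \<in> M" "v = y \<alpha>" for v y
      using that by (auto simp: W_def)
    have "linear_subspace k W"
      unfolding linear_subspace_def
    proof (intro conjI ballI allI)
      show "W \<subseteq> carrier_vec k" using \<alpha> by (auto simp: W_def M_def k_def ij)
      show "0\<^sub>v k \<in> W" using xM \<alpha> by (intro WI[OF M_diff[OF xM xM]]) (auto simp: M_def k_def ij)
      show "c \<cdot>\<^sub>v w \<in> W" if w: "w \<in> W" for c w
      proof -
        obtain y where y: "y \<in> M" "w = y \<alpha>" using w by (auto simp: W_def)
        show ?thesis by (rule WI[OF M_comb[OF y(1) y(1), of "1 - c"]]) (auto simp: y algebra_simps)
      qed
      show "v + w \<in> W" if vw: "v \<in> W" "w \<in> W" for v w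
      proof -
        obtain y z where yz: "y \<in> M" "z \<in> M" "v = y \<alpha>" "w = z \<alpha>" using vw by (auto simp: W_def)
        show ?thesis by (rule WI[OF M_comb[OF yz(1,2), of "-1"]]) (use yz \<alpha> in \<open>auto simp: M_def\<close>)
      qed
    qed
    moreover have "\<forall>g \<in> carrier G. \<forall>w \<in> W. \<rho> i g *\<^sub>v w \<in> W"
    proof (intro ballI)
      fix g w assume g: "g \<in> carrier G" and w: "w \<in> W"
      obtain y where y: "y \<in> M" "w = y \<alpha>" using w by (auto simp: W_def)
      show "\<rho> i g *\<^sub>v w \<in> W" by (rule WI[OF M_trans[OF y(1) g]]) (simp add: y ij)
    qed
    ultimately have "W = {0\<^sub>v k} \<or> W = carrier_vec k"
      using irr[OF iI] unfolding irreducible_unitary_rep_def k_def by blast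
    moreover have "x \<alpha> \<in> W" using xM by (auto simp: W_def)
    ultimately have W: "W = carrier_vec k" using nz by (auto simp: k_def ij)
    have "\<exists>y. y \<in> M \<and> y \<alpha> = unit_vec k l" for l
    proof -
      have "unit_vec k l \<in> W" using W by simp
      then obtain y where "y \<in> M" "unit_vec k l = y \<alpha>" unfolding W_def by blast
      thus ?thesis by auto
    qed
    then obtain b where b: "\<And>l. b l \<in> M" "\<And>l. b l \<alpha> = unit_vec k l" by metis
    \<comment> \<open>\<open>X \<beta>\<close> sends coordinate \<open>\<alpha>\<close> of a
      relation to its coordinate \<open>\<beta>\<close>; column \<open>l\<close> is read off the
      relation \<open>b l\<close>, whose coordinate at \<open>\<alpha>\<close> is the unit vector
      \<open>l\<close>.\<close>
    define X where "X = (\<lambda>\<beta>. mat (?d \<beta>) k (\<lambda>(r, l). b l \<beta> $ r))"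
    have Xd: "dim_row (X \<beta>) = ?d \<beta>" "dim_col (X \<beta>) = k" for \<beta> by (auto simp: X_def)
    have bX: "b l \<beta> = X \<beta> *\<^sub>v unit_vec k l" if "l < k" "\<beta> \<in> s" for l \<beta>
      using b(1)[of l] that by (intro eq_vecI) (auto simp: X_def M_def)
    have XM: "(\<lambda>\<beta>. X \<beta> *\<^sub>v u) \<in> M" if u: "u \<in> carrier_vec k" for u
    proof -
      have "(\<Sum>\<beta>\<in>s. (?r \<beta> g *\<^sub>v (X \<beta> *\<^sub>v u)) $ snd \<beta>) = 0" if g: "g \<in> carrier G" for g
      proof -
        have e: "(?r \<beta> g *\<^sub>v (X \<beta> *\<^sub>v u)) $ snd \<beta>
            = (\<Sum>l<k. u $ l * (?r \<beta> g *\<^sub>v b l \<beta>) $ snd \<beta>)" if be: "\<beta> \<in> s" for \<beta>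
        proof -
          have "(?r \<beta> g *\<^sub>v (X \<beta> *\<^sub>v u)) $ snd \<beta> = ((?r \<beta> g * X \<beta>) *\<^sub>v u) $ snd \<beta>"
            using rd[OF be g] u by (simp add: mat_vec_assoc Xd)
          also have "\<dots> = (\<Sum>l<k. (?r \<beta> g * X \<beta>) $$ (snd \<beta>, l) * u $ l)"
            using rd[OF be g] u sn[OF be] by (subst mat_vec_index) (auto simp: Xd)
          also have "\<dots> = (\<Sum>l<k. u $ l * (?r \<beta> g *\<^sub>v b l \<beta>) $ snd \<beta>)"
          proof (rule sum.cong[OF refl])
            fix l assume l: "l \<in> {..<k}"
            have "(?r \<beta> g * X \<beta>) $$ (snd \<beta>, l) = ((?r \<beta> g * X \<beta>) *\<^sub>v unit_vec k l) $ snd \<beta>"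
              using rd[OF be g] sn[OF be] l by (simp add: Xd)
            also have "\<dots> = (?r \<beta> g *\<^sub>v b l \<beta>) $ snd \<beta>"
              using rd[OF be g] l by (subst mat_vec_assoc) (auto simp: Xd bX be)
            finally show "(?r \<beta> g * X \<beta>) $$ (snd \<beta>, l) * u $ l = u $ l * (?r \<beta> g *\<^sub>v b l \<beta>) $ snd \<beta>"
              by simp
          qed
          finally show ?thesis .
        qed
        have "(\<Sum>\<beta>\<in>s. (?r \<beta> g *\<^sub>v (X \<beta> *\<^sub>v u)) $ snd \<beta>)
            = (\<Sum>\<beta>\<in>s. \<Sum>l<k. u $ l * (?r \<beta> g *\<^sub>v b l \<beta>) $ snd \<beta>)"
          by (rule sum.cong[OF refl e])
        also have "\<dots> = (\<Sum>l<k. u $ l * (\<Sum>\<beta>\<in>s. (?r \<beta> g *\<^sub>v b l \<beta>) $ snd \<beta>))"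
          by (subst sum.swap) (simp add: sum_distrib_left)
        also have "\<dots> = 0" using b(1) g by (auto simp: M_def)
        finally show ?thesis .
      qed
      moreover have "X \<beta> *\<^sub>v u \<in> carrier_vec (?d \<beta>)" for \<beta>
        by (intro carrier_vecI) (simp add: Xd)
      ultimately show ?thesis by (auto simp: M_def)
    qed
    have Xint: "intertwines (X \<beta>) k (\<rho> i) (?d \<beta>) (?r \<beta>)" if be: "\<beta> \<in> s" for \<beta>
      unfolding intertwines_def
    proof (intro conjI ballI)
      show "X \<beta> \<in> carrier_mat (?d \<beta>) k" by (auto simp: X_def)
      fix g assume g: "g \<in> carrier G"
      have ri: "\<rho> i g \<in> carrier_mat k k" using rd(1)[OF \<alpha> g] by (simp add: ij k_def)
      show "X \<beta> * \<rho> i g = ?r \<beta> g * X \<beta>"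
      proof (rule mat_eq_by_vec)
        show "X \<beta> * \<rho> i g \<in> carrier_mat (?d \<beta>) k" using ri by (auto simp: Xd intro!: carrier_matI)
        show "?r \<beta> g * X \<beta> \<in> carrier_mat (?d \<beta>) k" using rd[OF be g] by (auto simp: Xd intro!: carrier_matI)
        fix u :: "complex vec" assume u: "u \<in> carrier_vec k"
        \<comment> \<open>The difference of two relations with the same coordinate at
          \<open>\<alpha>\<close>, so \<open>step\<close> makes it vanish everywhere.\<close>
        define y where "y = (\<lambda>\<beta>. X \<beta> *\<^sub>v (\<rho> i g *\<^sub>v u) - ?r \<beta> g *\<^sub>v (X \<beta> *\<^sub>v u))"
        have yM: "y \<in> M" unfolding y_def using ri u
          by (intro M_diff XM M_trans g) auto
        have "X \<alpha> = 1\<^sub>m k" using b(2) by (intro eq_matI) (auto simp: X_def ij k_def unit_vec_def)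
        hence "y \<alpha> = 0\<^sub>v (?d \<alpha>)" using ri u by (auto simp: y_def ij k_def)
        from step[OF yM \<alpha> this] be have "y \<beta> = 0\<^sub>v (?d \<beta>)" by blast
        hence "X \<beta> *\<^sub>v (\<rho> i g *\<^sub>v u) = ?r \<beta> g *\<^sub>v (X \<beta> *\<^sub>v u)"
          unfolding y_def using rd[OF be g] by (auto simp: vec_eq_iff Xd)
        thus "X \<beta> * \<rho> i g *\<^sub>v u = ?r \<beta> g * X \<beta> *\<^sub>v u"
          using ri rd[OF be g] u by (auto simp: mat_vec_assoc Xd)
      qed
    qed
    have Xc: "\<exists>c. X \<beta> = c \<cdot>\<^sub>m 1\<^sub>m k" if be: "\<beta> \<in> s" "fst \<beta> = i" for \<beta>
      using schur_scalar[OF irr[OF iI]] Xint[OF be(1)] be(2) by (auto simp: k_def)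
    have X0: "X \<beta> = 0\<^sub>m (?d \<beta>) k" if be: "\<beta> \<in> s" "fst \<beta> \<noteq> i" for \<beta>
      using ineq[OF iI, of "fst \<beta>" "X \<beta>"] Xint[OF be(1)] be psubset.prems(1) by (auto simp: k_def)
    \<comment> \<open>At the identity, \<open>b j\<close> contributes only at
      \<open>\<alpha>\<close>: a different representation gives \<open>X \<beta> = 0\<close>, and
      the same one gives a multiple of the unit vector \<open>j\<close>, read in a row other than
      \<open>j\<close>. The sum is therefore 1, although \<open>b j\<close> is a relation.\<close>
    have term0: "(?r \<beta> \<one> *\<^sub>v b j \<beta>) $ snd \<beta> = (if \<beta> = \<alpha> then 1 else 0)" if be: "\<beta> \<in> s" for \<beta>
    proof -
      have bc: "b j \<beta> \<in> carrier_vec (?d \<beta>)" using b(1) be by (auto simp: M_def)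
      have e: "(?r \<beta> \<one> *\<^sub>v b j \<beta>) $ snd \<beta> = (X \<beta> *\<^sub>v unit_vec k j) $ snd \<beta>"
        using bc by (simp add: unitary_rep_one[OF rep[OF be]] bX[OF jk be, symmetric])
      show ?thesis
      proof (cases "\<beta> = \<alpha>")
        case True
        thus ?thesis unfolding e using bX[OF jk be] b(2)[of j] jk by (simp add: ij)
      next
        case False
        show ?thesis
        proof (cases "fst \<beta> = i")
          case True
          then obtain c where c: "X \<beta> = c \<cdot>\<^sub>m 1\<^sub>m k" using Xc be by blast
          have "snd \<beta> \<noteq> j" using True False by (auto simp: ij prod_eq_iff)
          thus ?thesis unfolding e c using sn[OF be] True False jk by (auto simp: k_def)
        next
          case ne: False
          thus ?thesis unfolding e X0[OF be ne] using sn[OF be] False jk by (auto simp: k_def)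
        qed
      qed
    qed
    have "(\<Sum>\<beta>\<in>s. (?r \<beta> \<one> *\<^sub>v b j \<beta>) $ snd \<beta>) = 0" using b(1)[of j] by (auto simp: M_def)
    moreover have "(\<Sum>\<beta>\<in>s. (?r \<beta> \<one> *\<^sub>v b j \<beta>) $ snd \<beta>) = 1"
      using psubset.hyps \<alpha> by (simp add: term0 sum.delta')
    ultimately show False by simp
  qed
qed

text \<open>The trace of \<open>A i * \<rho> i g\<close> is the sum over \<open>j\<close> of entry
  \<open>j\<close> of \<open>\<rho> i g\<close> applied to column \<open>j\<close> of
  \<open>A i\<close>, so the columns form a relation as in
  \<open>columns_independent\<close>.\<close>

lemma matrix_coefficients_independent:
  fixes \<rho> :: "'i \<Rightarrow> 'a \<Rightarrow> complex mat" and n :: "'i \<Rightarrow> nat"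
  assumes irr: "\<And>i. i \<in> I \<Longrightarrow> irreducible_unitary_rep G (n i) (\<rho> i)"
    and ineq: "\<And>i j X. i \<in> I \<Longrightarrow> j \<in> I \<Longrightarrow> i \<noteq> j \<Longrightarrow>
      intertwines X (n i) (\<rho> i) (n j) (\<rho> j) \<Longrightarrow> X = 0\<^sub>m (n j) (n i)"
    and fin: "finite I"
    and A: "\<And>i. i \<in> I \<Longrightarrow> A i \<in> carrier_mat (n i) (n i)"
    and rel: "\<And>g. g \<in> carrier G \<Longrightarrow> (\<Sum>i\<in>I. mtr (A i * \<rho> i g)) = 0"
    and i: "i \<in> I"
  shows "A i = 0\<^sub>m (n i) (n i)"
proof -
  define s where "s = Sigma I (\<lambda>i. {..<n i})"
  have "\<forall>\<alpha>\<in>s. col (A (fst \<alpha>)) (snd \<alpha>) = 0\<^sub>v (n (fst \<alpha>))"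
  proof (rule columns_independent[OF irr ineq])
    show "finite s" using fin by (auto simp: s_def)
    show "s \<subseteq> Sigma I (\<lambda>i. {..<n i})" by (simp add: s_def)
    show "col (A (fst \<alpha>)) (snd \<alpha>) \<in> carrier_vec (n (fst \<alpha>))" if "\<alpha> \<in> s" for \<alpha>
      using that A[of "fst \<alpha>"] by (auto simp: s_def intro!: carrier_vecI)
    fix g assume g: "g \<in> carrier G"
    have "(\<Sum>\<alpha>\<in>s. (\<rho> (fst \<alpha>) g *\<^sub>v col (A (fst \<alpha>)) (snd \<alpha>)) $ snd \<alpha>)
      = (\<Sum>i\<in>I. \<Sum>j<n i. (\<rho> i g *\<^sub>v col (A i) j) $ j)"
      unfolding s_def using fin by (subst sum.Sigma) (auto intro!: sum.cong)
    also have "\<dots> = (\<Sum>i\<in>I. mtr (A i * \<rho> i g))"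
    proof (rule sum.cong[OF refl])
      fix i assume i: "i \<in> I"
      note d = unitary_rep_dim[OF irreducibleD(1)[OF irr[OF i]] g] A[OF i]
      have "mtr (A i * \<rho> i g) = mtr (\<rho> i g * A i)" using d by (intro mtr_comm) auto
      also have "\<dots> = (\<Sum>j<n i. (\<rho> i g *\<^sub>v col (A i) j) $ j)"
        using d by (auto simp: mtr_def intro!: sum.cong)
      finally show "(\<Sum>j<n i. (\<rho> i g *\<^sub>v col (A i) j) $ j) = mtr (A i * \<rho> i g)" ..
    qed
    finally show "(\<Sum>\<alpha>\<in>s. (\<rho> (fst \<alpha>) g *\<^sub>v col (A (fst \<alpha>)) (snd \<alpha>)) $ snd \<alpha>) = 0"
      using rel[OF g] by simp
  qed
  hence c: "\<And>j. j < n i \<Longrightarrow> col (A i) j = 0\<^sub>v (n i)" using i by (auto simp: s_def)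
  show ?thesis
  proof (rule eq_matI)
    fix r j assume rj: "r < dim_row (0\<^sub>m (n i) (n i) :: complex mat)" "j < dim_col (0\<^sub>m (n i) (n i) :: complex mat)"
    hence "A i $$ (r, j) = col (A i) j $ r" using A[OF i] by auto
    thus "A i $$ (r, j) = 0\<^sub>m (n i) (n i) $$ (r, j)" using c rj by simp
  qed (use A[OF i] in auto)
qed

end

section \<open>Orthogonal projections and complete reducibility\<close>

lemma one_mat_vec [simp]: "dim_vec v = n \<Longrightarrow> 1\<^sub>m n *\<^sub>v (v::'a::semiring_1 vec) = v"
  by (auto intro: one_mult_mat_vec carrier_vecI)

lemma zero_mat_vec [simp]: "dim_vec v = m \<Longrightarrow> 0\<^sub>m k m *\<^sub>v (v::'a::semiring_0 vec) = 0\<^sub>v k"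
  by (auto intro!: eq_vecI simp: scalar_prod_def)

text \<open>If \<open>n < r\<close>, pad \<open>Q\<close> with zero rows to a square isometry
  \<open>P\<close>. For square matrices a left inverse is a right inverse, but
  \<open>P * adj_mat P\<close> vanishes at a padded row.\<close>

lemma isometry_dim_le:
  assumes Q: "Q \<in> carrier_mat n r" "adj_mat Q * Q = 1\<^sub>m r"
  shows "r \<le> n"
proof (rule ccontr)
  assume "\<not> r \<le> n"
  hence r: "n < r" by simp
  define P where "P = mat r r (\<lambda>(i, j). if i < n then Q $$ (i, j) else 0)"
  have P: "P \<in> carrier_mat r r" by (simp add: P_def)
  have "adj_mat P * P = adj_mat Q * Q"
  proof (rule eq_matI)
    fix i j assume ij: "i < dim_row (adj_mat Q * Q)" "j < dim_col (adj_mat Q * Q)"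
    hence ij': "i < r" "j < r" using Q by auto
    have "(adj_mat P * P) $$ (i, j) = (\<Sum>k<r. cnj (P $$ (k, i)) * P $$ (k, j))"
      using ij' P by (simp add: mat_mult_index del: index_mult_mat(1))
    also have "\<dots> = (\<Sum>k<r. if k < n then cnj (Q $$ (k, i)) * Q $$ (k, j) else 0)"
      using ij' by (intro sum.cong) (auto simp: P_def)
    also have "\<dots> = (\<Sum>k<n. cnj (Q $$ (k, i)) * Q $$ (k, j))"
      using r by (intro sum.mono_neutral_cong_right) auto
    also have "\<dots> = (adj_mat Q * Q) $$ (i, j)"
      using ij' Q(1) by (simp add: mat_mult_index del: index_mult_mat(1))
    finally show "(adj_mat P * P) $$ (i, j) = (adj_mat Q * Q) $$ (i, j)" .
  qed (use P Q in auto)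
  hence "adj_mat P * P = 1\<^sub>m r" using Q by simp
  hence "P * adj_mat P = 1\<^sub>m r" using mat_mult_left_right_inverse[OF _ P] P by auto
  hence "(P * adj_mat P) $$ (n, n) = 1" using r by simp
  moreover have "(P * adj_mat P) $$ (n, n) = 0"
    using r P by (simp add: mat_mult_index P_def del: index_mult_mat(1))
  ultimately show False by simp
qed

lemma linear_subspace_diff:
  assumes "linear_subspace n W" "v \<in> W" "w \<in> W"
  shows "v - w \<in> W"
proof -
  have "v - w = v + (-1) \<cdot>\<^sub>v w" using assms by (auto simp: linear_subspace_def intro!: eq_vecI)
  thus ?thesis using assms by (auto simp: linear_subspace_def)
qed

text \<open>\<open>Q * adj_mat Q\<close> is the orthogonal projection onto \<open>W\<close>;
  factoring it through an isometry allows representations to be compressed to matrices of size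
  \<open>r\<close>. Take an isometry into \<open>W\<close> with as many columns as possible: a
  Gram-Schmidt step would enlarge it if it missed a vector of \<open>W\<close>.\<close>

lemma orthonormal_frame_exists:
  assumes W: "linear_subspace n W"
  obtains r Q where "r \<le> n" "Q \<in> carrier_mat n r" "adj_mat Q * Q = 1\<^sub>m r"
    "\<And>v. v \<in> carrier_vec n \<Longrightarrow> Q *\<^sub>v (adj_mat Q *\<^sub>v v) \<in> W"
    "\<And>v. v \<in> W \<Longrightarrow> Q *\<^sub>v (adj_mat Q *\<^sub>v v) = v"
proof -
  define P where "P = (\<lambda>r. \<exists>Q. Q \<in> carrier_mat n r \<and> adj_mat Q * Q = 1\<^sub>m r \<and> (\<forall>u\<in>carrier_vec r. Q *\<^sub>v u \<in> W))"
  have Wc: "W \<subseteq> carrier_vec n" using W by (simp add: linear_subspace_def)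
  have "0\<^sub>m n 0 *\<^sub>v u = 0\<^sub>v n" if "u \<in> carrier_vec 0" for u :: "complex vec"
    using that by (intro eq_vecI) (auto simp: scalar_prod_def)
  \<comment> \<open>The matrix without columns starts the search for the maximal \<open>r\<close>,
    which \<open>isometry_dim_le\<close> bounds.\<close>
  hence "P 0" using W unfolding P_def
    by (intro exI[of _ "0\<^sub>m n 0"]) (auto simp: linear_subspace_def)
  moreover have bound: "\<And>r. P r \<Longrightarrow> r \<le> n" by (auto simp: P_def intro: isometry_dim_le)
  ultimately have "\<exists>r. P r \<and> (\<forall>r'. P r' \<longrightarrow> r' \<le> r)"
    using Nat.ex_has_greatest_nat[of P 0 n] by blast
  then obtain r where r: "P r" "\<And>r'. P r' \<Longrightarrow> r' \<le> r" by blast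
  then obtain Q where Q: "Q \<in> carrier_mat n r" "adj_mat Q * Q = 1\<^sub>m r" "\<And>u. u \<in> carrier_vec r \<Longrightarrow> Q *\<^sub>v u \<in> W"
    unfolding P_def by blast
  note Qd = carrier_matD[OF Q(1)]
  have 1: "Q *\<^sub>v (adj_mat Q *\<^sub>v v) \<in> W" if "v \<in> carrier_vec n" for v
    using that Qd by (intro Q(3)) (auto intro: carrier_vecI)
  have 2: "Q *\<^sub>v (adj_mat Q *\<^sub>v v) = v" if v: "v \<in> W" for v
  proof (rule ccontr)
    assume ne: "Q *\<^sub>v (adj_mat Q *\<^sub>v v) \<noteq> v"
    have vc: "v \<in> carrier_vec n" using v Wc by auto
    \<comment> \<open>The component of \<open>v\<close> orthogonal to the columns of
      \<open>Q\<close>; normalised to \<open>e\<close>, it becomes a further column and contradicts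
      maximality.\<close>
    define w where "w = v - Q *\<^sub>v (adj_mat Q *\<^sub>v v)"
    have wW: "w \<in> W" unfolding w_def by (rule linear_subspace_diff[OF W v 1[OF vc]])
    hence wc: "w \<in> carrier_vec n" using Wc by auto
    have "adj_mat Q *\<^sub>v w = adj_mat Q *\<^sub>v v - adj_mat Q *\<^sub>v (Q *\<^sub>v (adj_mat Q *\<^sub>v v))"
      unfolding w_def using vc Qd by (intro mult_minus_distrib_mat_vec[of _ r n]) (auto intro!: carrier_vecI carrier_matI)
    also have "adj_mat Q *\<^sub>v (Q *\<^sub>v (adj_mat Q *\<^sub>v v)) = (adj_mat Q * Q) *\<^sub>v (adj_mat Q *\<^sub>v v)"
      using Qd by (subst mat_vec_assoc) auto
    also have "\<dots> = adj_mat Q *\<^sub>v v"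
      unfolding Q(2) using Qd by simp
    finally have Qw: "adj_mat Q *\<^sub>v w = 0\<^sub>v r" using Qd by (auto intro!: eq_vecI)
    define t where "t = (\<Sum>i<n. (cmod (w $ i))\<^sup>2)"
    have "w \<noteq> 0\<^sub>v n" using ne vc Qd by (auto simp: w_def vec_eq_iff)
    then obtain i where i: "i < n" "w $ i \<noteq> 0" using wc by (auto simp: vec_eq_iff)
    have "t > 0" unfolding t_def using i by (intro sum_pos2[of _ i]) auto
    define q where "q = complex_of_real (1 / sqrt t)"
    define e where "e = q \<cdot>\<^sub>v w"
    have eW: "e \<in> W" using wW W by (auto simp: e_def linear_subspace_def)
    have ec: "e \<in> carrier_vec n" using wc by (simp add: e_def)
    have Qe: "(\<Sum>k<n. cnj (Q $$ (k, i)) * e $ k) = 0" if i: "i < r" for i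
    proof -
      have "(\<Sum>k<n. cnj (Q $$ (k, i)) * e $ k) = q * (\<Sum>k<n. cnj (Q $$ (k, i)) * w $ k)"
        using wc by (simp add: e_def sum_distrib_left mult_ac)
      also have "(\<Sum>k<n. cnj (Q $$ (k, i)) * w $ k) = (adj_mat Q *\<^sub>v w) $ i"
        using i Qd wc by (subst mat_vec_index) auto
      finally show ?thesis using i Qw by simp
    qed
    have eQ: "(\<Sum>k<n. cnj (e $ k) * Q $$ (k, i)) = 0" if i: "i < r" for i
    proof -
      have "(\<Sum>k<n. cnj (e $ k) * Q $$ (k, i)) = cnj (\<Sum>k<n. cnj (Q $$ (k, i)) * e $ k)"
        by (simp add: mult.commute)
      thus ?thesis using Qe[OF i] by simp
    qed
    have ee: "(\<Sum>k<n. cnj (e $ k) * e $ k) = 1"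
    proof -
      have "(\<Sum>k<n. cnj (e $ k) * e $ k) = (\<Sum>k<n. of_real (1 / t * (cmod (w $ k))\<^sup>2))"
      proof (rule sum.cong[OF refl])
        fix k assume "k \<in> {..<n}"
        hence "cnj (e $ k) * e $ k = (cnj q * q) * (w $ k * cnj (w $ k))"
          using wc by (simp add: e_def)
        also have "\<dots> = of_real (1 / sqrt t * (1 / sqrt t)) * of_real ((cmod (w $ k))\<^sup>2)"
          unfolding complex_norm_square q_def by (simp only: complex_cnj_complex_of_real of_real_mult)
        also have "1 / sqrt t * (1 / sqrt t) = 1 / t" using \<open>t > 0\<close> by simp
        finally show "cnj (e $ k) * e $ k = of_real (1 / t * (cmod (w $ k))\<^sup>2)"
          by (simp only: of_real_mult)
      qed
      also have "\<dots> = of_real (1 / t * t)"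
        by (simp only: t_def sum_distrib_left of_real_sum)
      finally show ?thesis using \<open>t > 0\<close> by simp
    qed
    define Q' where "Q' = mat n (Suc r) (\<lambda>(i, j). if j < r then Q $$ (i, j) else e $ i)"
    have "P (Suc r)" unfolding P_def
    proof (intro exI[of _ Q'] conjI ballI)
      show Q'c: "Q' \<in> carrier_mat n (Suc r)" by (simp add: Q'_def)
      show "adj_mat Q' * Q' = 1\<^sub>m (Suc r)"
      proof (rule eq_matI)
        fix i j assume "i < dim_row (1\<^sub>m (Suc r) :: complex mat)" "j < dim_col (1\<^sub>m (Suc r) :: complex mat)"
        hence ij: "i < Suc r" "j < Suc r" by auto
        have "(adj_mat Q' * Q') $$ (i, j) = (\<Sum>k<n. cnj (Q' $$ (k, i)) * Q' $$ (k, j))"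
          using ij Q'c by (simp add: mat_mult_index del: index_mult_mat(1))
        also have "\<dots> = (\<Sum>k<n. cnj (if i < r then Q $$ (k, i) else e $ k) * (if j < r then Q $$ (k, j) else e $ k))"
          using ij by (intro sum.cong) (auto simp: Q'_def)
        also have "\<dots> = (if i = j then 1 else 0)"
        proof (cases "i < r")
          case i: True
          show ?thesis
          proof (cases "j < r")
            case True
            have "(\<Sum>k<n. cnj (Q $$ (k, i)) * Q $$ (k, j)) = (adj_mat Q * Q) $$ (i, j)"
              using i True Qd by (simp add: mat_mult_index del: index_mult_mat(1))
            thus ?thesis using i True Q(2) by simp
          next
            case False
            thus ?thesis using i Qe by simp
          qed
        next
          case False
          thus ?thesis using eQ ee ij by (cases "j < r") (auto simp: less_Suc_eq)
        qed
        finally show "(adj_mat Q' * Q') $$ (i, j) = 1\<^sub>m (Suc r) $$ (i, j)" using ij by simp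
      qed (simp_all add: Q'_def)
      fix u :: "complex vec" assume u: "u \<in> carrier_vec (Suc r)"
      have "Q' *\<^sub>v u = Q *\<^sub>v (vec r (($) u)) + (u $ r) \<cdot>\<^sub>v e"
      proof (rule eq_vecI)
        fix i assume "i < dim_vec (Q *\<^sub>v vec r (($) u) + u $ r \<cdot>\<^sub>v e)"
        hence i: "i < n" using ec by simp
        have "(Q' *\<^sub>v u) $ i = (\<Sum>k<Suc r. Q' $$ (i, k) * u $ k)"
          using i u by (subst mat_vec_index) (auto simp: Q'_def)
        also have "\<dots> = (\<Sum>k<r. Q $$ (i, k) * u $ k) + e $ i * u $ r"
          using i by (simp add: Q'_def)
        also have "(\<Sum>k<r. Q $$ (i, k) * u $ k) = (Q *\<^sub>v vec r (($) u)) $ i"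
          using i Qd by (subst mat_vec_index) auto
        finally show "(Q' *\<^sub>v u) $ i = (Q *\<^sub>v vec r (($) u) + u $ r \<cdot>\<^sub>v e) $ i"
          using i ec Qd by simp
      qed (use ec in \<open>simp add: Q'_def\<close>)
      moreover have "Q *\<^sub>v (vec r (($) u)) \<in> W" by (rule Q(3)) simp
      ultimately show "Q' *\<^sub>v u \<in> W" using eW W by (auto simp: linear_subspace_def)
    qed
    from r(2)[OF this] show False by simp
  qed
  show ?thesis using that[OF bound[OF r(1)] Q(1,2) 1 2] by blast
qed

context group
begin

text \<open>For the projection \<open>E\<close>, invariance gives
  \<open>E * (\<rho> g * E) = \<rho> g * E\<close>. The adjoint of this identity at
  \<open>inv g\<close> is \<open>E * \<rho> g * E = E * \<rho> g\<close>.\<close>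

lemma invariant_projection_commutes:
  assumes r: "unitary_rep G n \<rho>" and inv: "\<And>g w. g \<in> carrier G \<Longrightarrow> w \<in> W \<Longrightarrow> \<rho> g *\<^sub>v w \<in> W"
    and Q: "Q \<in> carrier_mat n r"
    and QW: "\<And>v. v \<in> carrier_vec n \<Longrightarrow> Q *\<^sub>v (adj_mat Q *\<^sub>v v) \<in> W"
    and WQ: "\<And>v. v \<in> W \<Longrightarrow> Q *\<^sub>v (adj_mat Q *\<^sub>v v) = v"
    and g: "g \<in> carrier G"
  shows "Q * adj_mat Q * \<rho> g = \<rho> g * (Q * adj_mat Q)"
proof -
  define E where "E = Q * adj_mat Q"
  have d: "dim_row E = n" "dim_col E = n" "dim_row Q = n" "dim_col Q = r" using Q by (auto simp: E_def)
  have adj: "adj_mat E = E" by (simp add: E_def adj_mat_mult)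
  have 1: "E * (\<rho> g * E) = \<rho> g * E" if g: "g \<in> carrier G" for g
  proof (rule mat_eq_by_vec[of _ n n])
    note rd = unitary_rep_dim[OF r g]
    fix v :: "complex vec" assume v: "v \<in> carrier_vec n"
    have Ev: "E *\<^sub>v x = Q *\<^sub>v (adj_mat Q *\<^sub>v x)" if "x \<in> carrier_vec n" for x
      using that d by (simp add: E_def mat_vec_assoc)
    have s: "\<rho> g *\<^sub>v (E *\<^sub>v v) \<in> W" using inv[OF g QW[OF v]] by (simp add: Ev v)
    have "E *\<^sub>v (\<rho> g *\<^sub>v (E *\<^sub>v v)) = \<rho> g *\<^sub>v (E *\<^sub>v v)"
      using WQ[OF s] by (subst Ev) (use rd in \<open>auto intro!: carrier_vecI\<close>)
    thus "E * (\<rho> g * E) *\<^sub>v v = \<rho> g * E *\<^sub>v v"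
      using v d rd by (simp add: mat_vec_assoc)
  qed (use d unitary_rep_dim[OF r g] in \<open>auto intro!: carrier_matI\<close>)
  note rd = unitary_rep_dim[OF r g]
  have "adj_mat (E * (\<rho> (inv g) * E)) = adj_mat (\<rho> (inv g) * E)" using 1[of "inv g"] g by simp
  hence "E * \<rho> g * E = E * \<rho> g"
    by (simp add: unitary_rep_inv[OF r g] adj_mat_mult d rd adj)
  hence "E * \<rho> g = \<rho> g * E" using 1[OF g] by (simp add: mat_assoc d rd)
  thus ?thesis by (simp add: E_def)
qed

text \<open>\<open>A\<close> need not preserve the range of \<open>Q\<close>: its compression still
  intertwines because the projection commutes with \<open>\<rho> g\<close> and with
  \<open>\<rho> (\<phi> g)\<close> alike. The trace identity returns to the original space, where
  the coefficients of complementary pieces can be added.\<close>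

lemma subrep:
  assumes r: "unitary_rep G n \<rho>" and Q: "Q \<in> carrier_mat n r" "adj_mat Q * Q = 1\<^sub>m r"
    and com: "\<And>g. g \<in> carrier G \<Longrightarrow> Q * adj_mat Q * \<rho> g = \<rho> g * (Q * adj_mat Q)"
    and \<phi>: "\<And>g. g \<in> carrier G \<Longrightarrow> \<phi> g \<in> carrier G"
    and A: "intertwines A n \<rho> n (\<rho> \<circ> \<phi>)"
  defines "\<tau> \<equiv> \<lambda>g. adj_mat Q * \<rho> g * Q"
  shows "unitary_rep G r \<tau>"
    and "intertwines (adj_mat Q * A * Q) r \<tau> r (\<tau> \<circ> \<phi>)"
    and "\<And>g. g \<in> carrier G \<Longrightarrow> mtr (adj_mat Q * A * Q * \<tau> g) = mtr (A * (Q * adj_mat Q * \<rho> g))"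
proof -
  note d = carrier_matD[OF Q(1)]
  have Ad: "dim_row A = n" "dim_col A = n" using A by (auto simp: intertwines_def)
  note rd = unitary_rep_dim[OF r]
  \<comment> \<open>Cancellation and commutation rules for products associated to the right, each
    with an arbitrary trailing factor \<open>X\<close>.\<close>
  have c1: "adj_mat Q * (Q * X) = X" if "dim_row X = r" for X
    using that Q(2) by (simp add: mat_assoc[symmetric] d)
  have c2: "Q * (adj_mat Q * (\<rho> g * X)) = \<rho> g * (Q * (adj_mat Q * X))"
    if "g \<in> carrier G" "dim_row X = n" for g X
    using arg_cong[OF com[OF that(1)], of "\<lambda>Y. Y * X"] that rd[OF that(1)] by (simp add: mat_assoc d)
  have c4: "adj_mat Q * (\<rho> g * (Q * (adj_mat Q * X))) = adj_mat Q * (\<rho> g * X)"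
    if "g \<in> carrier G" "dim_row X = n" for g X
    using that by (simp add: c2[symmetric] c1 rd d)
  have c3: "Q * (adj_mat Q * (adj_mat (\<rho> g) * X)) = adj_mat (\<rho> g) * (Q * (adj_mat Q * X))"
    if "g \<in> carrier G" "dim_row X = n" for g X
    using c2[of "inv g" X] that by (simp add: unitary_rep_inv[OF r])
  have u1: "\<rho> g * (adj_mat (\<rho> g) * X) = X" "adj_mat (\<rho> g) * (\<rho> g * X) = X"
    if "g \<in> carrier G" "dim_row X = n" for g X
    using that rd[OF that(1)] unitary_rep_adj[OF r that(1)] by (simp_all add: mat_assoc[symmetric])
  have Ai: "A * (\<rho> g * X) = \<rho> (\<phi> g) * (A * X)" if "g \<in> carrier G" "dim_row X = n" for g X
    using A that rd[OF that(1)] rd[OF \<phi>[OF that(1)]] by (simp add: mat_assoc[symmetric] Ad intertwines_def)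
  show "unitary_rep G r \<tau>"
    unfolding unitary_rep_def unitary_mat_def
  proof (intro conjI ballI)
    fix g h assume g: "g \<in> carrier G" and h: "h \<in> carrier G"
    show "\<tau> (g \<otimes> h) = \<tau> g * \<tau> h"
      by (simp add: \<tau>_def unitary_rep_mult[OF r g h] mat_assoc d rd[OF g] rd[OF h] c1 c2 h Q(2))
  next
    fix g assume g: "g \<in> carrier G"
    show "\<tau> g \<in> carrier_mat r r" by (auto simp: \<tau>_def d intro!: carrier_matI)
    show "\<tau> g * adj_mat (\<tau> g) = 1\<^sub>m r"
      by (simp add: \<tau>_def mat_assoc d rd[OF g] adj_mat_mult c1 c3 u1 g Q(2))
    show "adj_mat (\<tau> g) * \<tau> g = 1\<^sub>m r"
      by (simp add: \<tau>_def mat_assoc d rd[OF g] adj_mat_mult c1 c2 u1 g Q(2))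
  qed
  show "intertwines (adj_mat Q * A * Q) r \<tau> r (\<tau> \<circ> \<phi>)"
    unfolding intertwines_def
  proof (intro conjI ballI)
    show "adj_mat Q * A * Q \<in> carrier_mat r r" by (auto simp: d intro!: carrier_matI)
    fix g assume g: "g \<in> carrier G"
    show "adj_mat Q * A * Q * \<tau> g = (\<tau> \<circ> \<phi>) g * (adj_mat Q * A * Q)"
      by (simp add: \<tau>_def mat_assoc d Ad rd[OF g] rd[OF \<phi>[OF g]] c1 c2 c4 Ai g \<phi> Q(2))
  qed
  fix g assume g: "g \<in> carrier G"
  have "mtr (adj_mat Q * A * Q * \<tau> g) = mtr (adj_mat Q * (A * (Q * \<tau> g)))"
    by (simp add: \<tau>_def mat_assoc d Ad rd[OF g])
  also have "\<dots> = mtr (A * (Q * \<tau> g) * adj_mat Q)"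
    by (rule mtr_comm) (simp_all add: \<tau>_def d Ad)
  also have "A * (Q * \<tau> g) * adj_mat Q = A * (Q * adj_mat Q * \<rho> g)"
    using com[OF g] by (simp add: \<tau>_def mat_assoc d Ad rd[OF g] c1 c2 g)
  finally show "mtr (adj_mat Q * A * Q * \<tau> g) = mtr (A * (Q * adj_mat Q * \<rho> g))" .
qed

text \<open>With value 0 outside the carrier, coefficients that agree on the group are equal as
  functions on the whole type, where the spans are formed.\<close>

abbreviation (input) coefficient where
  "coefficient A \<rho> \<equiv> \<lambda>g. if g \<in> carrier G then mtr (A * \<rho> g) else 0"

text \<open>Complete reducibility at the level of coefficients, by induction on the dimension. Since
  \<open>\<sigma> g\<close> is block diagonal for an invariant subspace and its complement, the
  off-diagonal blocks of \<open>A\<close> do not enter the trace, and the coefficient is the sum of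
  those of the two compressions.\<close>

lemma twisted_coefficient_decomposition:
  assumes \<phi>: "\<And>g. g \<in> carrier G \<Longrightarrow> \<phi> g \<in> carrier G"
    and zero: "(\<lambda>g. 0) \<in> S" and add: "\<And>f f'. f \<in> S \<Longrightarrow> f' \<in> S \<Longrightarrow> (\<lambda>g. f g + f' g) \<in> S"
    and base: "\<And>n \<rho> B. irreducible_unitary_rep G n \<rho> \<Longrightarrow> intertwines B n \<rho> n (\<rho> \<circ> \<phi>) \<Longrightarrow>
        coefficient B \<rho> \<in> S"
    and "unitary_rep G n \<sigma>" "intertwines A n \<sigma> n (\<sigma> \<circ> \<phi>)"
  shows "coefficient A \<sigma> \<in> S"
  using assms(5,6)
proof (induction n arbitrary: \<sigma> A rule: less_induct)
  case (less n)
  note r = less.prems(1) and A = less.prems(2)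
  have Ad: "dim_row A = n" "dim_col A = n" using A by (auto simp: intertwines_def)
  \<comment> \<open>Irreducible representations have positive dimension, so dimension 0 is a case of
    its own; its coefficient is an empty sum.\<close>
  consider "n = 0" | "irreducible_unitary_rep G n \<sigma>" | "n \<ge> 1" "\<not> irreducible_unitary_rep G n \<sigma>"
    by linarith
  thus ?case
  proof cases
    case 1
    thus ?thesis using zero Ad by (simp add: mtr_def cong: if_cong)
  next
    case 2
    thus ?thesis using base A by blast
  next
    case 3
    then obtain W where W: "linear_subspace n W" and inv: "\<And>g w. g \<in> carrier G \<Longrightarrow> w \<in> W \<Longrightarrow> \<sigma> g *\<^sub>v w \<in> W"
      and ne: "W \<noteq> {0\<^sub>v n}" "W \<noteq> carrier_vec n"
      using r by (auto simp: irreducible_unitary_rep_def)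
    have Wc: "W \<subseteq> carrier_vec n" "0\<^sub>v n \<in> W" using W by (auto simp: linear_subspace_def)
    obtain k Q where Q: "k \<le> n" "Q \<in> carrier_mat n k" "adj_mat Q * Q = 1\<^sub>m k"
      and QW: "\<And>v. v \<in> carrier_vec n \<Longrightarrow> Q *\<^sub>v (adj_mat Q *\<^sub>v v) \<in> W"
      and WQ: "\<And>v. v \<in> W \<Longrightarrow> Q *\<^sub>v (adj_mat Q *\<^sub>v v) = v"
      by (rule orthonormal_frame_exists[OF W]) blast
    note Qd = carrier_matD[OF Q(2)]
    \<comment> \<open>The orthogonal complement of \<open>W\<close>, as the kernel of
      \<open>adj_mat Q\<close>.\<close>
    define W' where "W' = {v \<in> carrier_vec n. adj_mat Q *\<^sub>v v = 0\<^sub>v k}"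
    have Qa: "adj_mat Q \<in> carrier_mat k n" using Q by simp
    have Q0: "adj_mat Q *\<^sub>v 0\<^sub>v n = 0\<^sub>v k" using Qd by (intro eq_vecI) (auto simp: scalar_prod_def)
    have W': "linear_subspace n W'"
      unfolding linear_subspace_def W'_def using Qa Q0
      by (auto simp: mult_add_distrib_mat_vec[of _ k n] mult_mat_vec[of _ k n])
    obtain k' Q' where Q': "k' \<le> n" "Q' \<in> carrier_mat n k'" "adj_mat Q' * Q' = 1\<^sub>m k'"
      and QW': "\<And>v. v \<in> carrier_vec n \<Longrightarrow> Q' *\<^sub>v (adj_mat Q' *\<^sub>v v) \<in> W'"
      and WQ': "\<And>v. v \<in> W' \<Longrightarrow> Q' *\<^sub>v (adj_mat Q' *\<^sub>v v) = v"
      by (rule orthonormal_frame_exists[OF W']) blast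
    note Qd' = carrier_matD[OF Q'(2)]
    define E E' where "E = Q * adj_mat Q" and "E' = Q' * adj_mat Q'"
    have Ec: "E \<in> carrier_mat n n" "E' \<in> carrier_mat n n" by (auto simp: E_def E'_def Qd Qd' intro!: carrier_matI)
    note Ed = carrier_matD[OF Ec(1)] carrier_matD[OF Ec(2)]
    have Ev: "E *\<^sub>v v = Q *\<^sub>v (adj_mat Q *\<^sub>v v)" "E' *\<^sub>v v = Q' *\<^sub>v (adj_mat Q' *\<^sub>v v)" if "v \<in> carrier_vec n" for v
      using that by (auto simp: E_def E'_def Qd Qd' mat_vec_assoc)
    have "adj_mat Q * E' = 0\<^sub>m k n"
    proof (rule mat_eq_by_vec[of _ k n])
      fix v :: "complex vec" assume v: "v \<in> carrier_vec n"
      have "adj_mat Q *\<^sub>v (E' *\<^sub>v v) = 0\<^sub>v k" using QW'[OF v] by (simp add: W'_def Ev v)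
      thus "adj_mat Q * E' *\<^sub>v v = 0\<^sub>m k n *\<^sub>v v" using v Ed Qd by (simp add: mat_vec_assoc)
    qed (auto simp: Qd Ed intro!: carrier_matI)
    \<comment> \<open>The product in this order vanishes by the choice of \<open>W'\<close>;
      self-adjointness of both projections then gives the other order.\<close>
    hence "E * E' = Q * 0\<^sub>m k n" by (simp add: E_def mat_assoc Qd Ed)
    hence "adj_mat (E * E') = adj_mat (0\<^sub>m n n)" using Q(2) by simp
    moreover have "adj_mat (0\<^sub>m n n) = 0\<^sub>m n n" by (intro eq_matI) auto
    moreover have "adj_mat E = E" "adj_mat E' = E'" by (simp_all add: E_def E'_def adj_mat_mult)
    ultimately have E'E: "E' * E = 0\<^sub>m n n" by (simp add: adj_mat_mult Ed)
    have sum1: "E + E' = 1\<^sub>m n"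
    proof (rule mat_eq_by_vec[of _ n n])
      fix v :: "complex vec" assume v: "v \<in> carrier_vec n"
      have Evc: "E *\<^sub>v v \<in> carrier_vec n" using Ed by (intro carrier_vecI) simp
      have "adj_mat Q *\<^sub>v (v - E *\<^sub>v v) = adj_mat Q *\<^sub>v v - adj_mat Q *\<^sub>v (E *\<^sub>v v)"
        using v Evc Qa by (intro mult_minus_distrib_mat_vec)
      also have "adj_mat Q *\<^sub>v (E *\<^sub>v v) = (adj_mat Q * Q) *\<^sub>v (adj_mat Q *\<^sub>v v)"
        using v by (simp add: Ev mat_vec_assoc Qd)
      also have "adj_mat Q *\<^sub>v v - (adj_mat Q * Q) *\<^sub>v (adj_mat Q *\<^sub>v v) = 0\<^sub>v k"
        unfolding Q(3) using Qd by (intro eq_vecI) auto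
      finally have "v - E *\<^sub>v v \<in> W'" using v Evc by (auto simp: W'_def)
      hence "E' *\<^sub>v (v - E *\<^sub>v v) = v - E *\<^sub>v v" using WQ' v Evc by (simp add: Ev(2))
      moreover have "E' *\<^sub>v (v - E *\<^sub>v v) = E' *\<^sub>v v - E' *\<^sub>v (E *\<^sub>v v)"
        using v Evc Ec by (intro mult_minus_distrib_mat_vec)
      moreover have "E' *\<^sub>v (E *\<^sub>v v) = 0\<^sub>v n"
        using v Ed E'E by (simp add: mat_vec_assoc[symmetric])
      ultimately have *: "E' *\<^sub>v v - 0\<^sub>v n = v - E *\<^sub>v v" by simp
      have "(E + E') *\<^sub>v v = E *\<^sub>v v + E' *\<^sub>v v" using Ec v by (rule add_mult_distrib_mat_vec)
      also have "\<dots> = v"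
      proof (rule eq_vecI)
        fix i assume i: "i < dim_vec v"
        have "(E' *\<^sub>v v - 0\<^sub>v n) $ i = (v - E *\<^sub>v v) $ i" by (simp only: *)
        thus "(E *\<^sub>v v + E' *\<^sub>v v) $ i = v $ i" using i v Ed by simp
      qed (use v Ed in auto)
      finally show "(E + E') *\<^sub>v v = 1\<^sub>m n *\<^sub>v v" using v by simp
    qed (use Ec in auto)
    have com: "Q * adj_mat Q * \<sigma> g = \<sigma> g * (Q * adj_mat Q)" if "g \<in> carrier G" for g
      by (rule invariant_projection_commutes[OF r inv Q(2) QW WQ that])
    have com': "Q' * adj_mat Q' * \<sigma> g = \<sigma> g * (Q' * adj_mat Q')" if g: "g \<in> carrier G" for g
    proof -
      note rd = unitary_rep_dim[OF r g]
      have e: "E' = 1\<^sub>m n - E"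
      proof (rule eq_matI)
        fix i j assume ij: "i < dim_row (1\<^sub>m n - E)" "j < dim_col (1\<^sub>m n - E)"
        have "(E + E') $$ (i, j) = 1\<^sub>m n $$ (i, j)" by (simp only: sum1)
        thus "E' $$ (i, j) = (1\<^sub>m n - E) $$ (i, j)" using ij Ed by (simp add: algebra_simps)
      qed (use Ed in auto)
      have "E' * \<sigma> g = \<sigma> g - E * \<sigma> g"
        unfolding e using rd Ec by (simp add: minus_mult_distrib_mat[of _ n n])
      moreover have "\<sigma> g * E' = \<sigma> g - \<sigma> g * E"
        unfolding e using rd Ec by (simp add: mult_minus_distrib_mat[of _ n n _ n])
      ultimately show ?thesis using com[OF g] by (simp add: E_def E'_def)
    qed
    \<comment> \<open>\<open>W\<close> is neither everything nor zero, so both pieces have smaller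
      dimension and the induction hypothesis applies to each.\<close>
    have "k \<noteq> n"
    proof
      assume kn: "k = n"
      have "E = 1\<^sub>m n" unfolding E_def using mat_mult_left_right_inverse[OF _ _ Q(3)] Q(2) kn by auto
      hence "v \<in> W" if "v \<in> carrier_vec n" for v using QW[OF that] Ev(1)[OF that] that by simp
      thus False using ne Wc by blast
    qed
    hence k: "k < n" using Q(1) by simp
    have "k' \<noteq> n"
    proof
      assume kn: "k' = n"
      have "E' = 1\<^sub>m n" unfolding E'_def using mat_mult_left_right_inverse[OF _ _ Q'(3)] Q'(2) kn by auto
      hence "E = 0\<^sub>m n n" using E'E Ed by simp
      hence "v = 0\<^sub>v n" if "v \<in> W" for v using WQ[OF that] Ev(1)[of v] that Wc by auto
      thus False using ne Wc by blast
    qed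
    hence k': "k' < n" using Q'(1) by simp
    let ?A = "\<lambda>Q. adj_mat Q * A * Q" and ?\<sigma> = "\<lambda>Q g. adj_mat Q * \<sigma> g * Q"
    note sub = subrep[OF r Q(2,3) com \<phi> A] and sub' = subrep[OF r Q'(2,3) com' \<phi> A]
    have "(\<lambda>g. coefficient (?A Q) (?\<sigma> Q) g
       + coefficient (?A Q') (?\<sigma> Q') g) \<in> S"
      by (intro add less.IH[OF k] less.IH[OF k'] sub(1,2) sub'(1,2))
    also have "(\<lambda>g. coefficient (?A Q) (?\<sigma> Q) g
       + coefficient (?A Q') (?\<sigma> Q') g)
       = coefficient A \<sigma>"
    proof (rule ext)
      fix g
      show "coefficient (?A Q) (?\<sigma> Q) g
       + coefficient (?A Q') (?\<sigma> Q') g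
       = coefficient A \<sigma> g"
      proof (cases "g \<in> carrier G")
        case g: True
        note rd = unitary_rep_dim[OF r g]
        have Ac: "A \<in> carrier_mat n n" using Ad by auto
        have "mtr (A * (E * \<sigma> g)) + mtr (A * (E' * \<sigma> g)) = mtr (A * (E * \<sigma> g) + A * (E' * \<sigma> g))"
          using Ac Ec rd by (subst mtr_add[of _ n]) (auto intro!: carrier_matI)
        also have "A * (E * \<sigma> g) + A * (E' * \<sigma> g) = A * ((E + E') * \<sigma> g)"
          using Ac Ec rd(1) by (simp add: add_mult_distrib_mat[of _ n n] mult_add_distrib_mat[of _ n n _ n])
        finally show ?thesis using g sub(3)[of g] sub'(3)[of g] rd by (simp add: sum1 E_def[symmetric] E'_def[symmetric])
      qed simp
    qed
    finally show ?thesis .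
  qed
qed

end

section \<open>Averaging and permutation representations\<close>

text \<open>Matrices of all sizes share one type and so have no common zero; hence the explicit size
  \<open>n\<close>.\<close>

definition mat_sum :: "nat \<Rightarrow> ('p \<Rightarrow> complex mat) \<Rightarrow> 'p set \<Rightarrow> complex mat" where
  "mat_sum n T S = mat n n (\<lambda>ij. \<Sum>p\<in>S. T p $$ ij)"

lemma mat_sum_dim [simp]: "dim_row (mat_sum n T S) = n" "dim_col (mat_sum n T S) = n"
  by (simp_all add: mat_sum_def)

lemma mat_sum_mult_right:
  assumes "X \<in> carrier_mat n n" "\<And>p. p \<in> S \<Longrightarrow> T p \<in> carrier_mat n n"
  shows "mat_sum n T S * X = mat_sum n (\<lambda>p. T p * X) S"
proof (rule eq_matI)
  fix i j assume "i < dim_row (mat_sum n (\<lambda>p. T p * X) S)" "j < dim_col (mat_sum n (\<lambda>p. T p * X) S)"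
  hence ij: "i < n" "j < n" by auto
  have "(mat_sum n T S * X) $$ (i, j) = (\<Sum>k<n. \<Sum>p\<in>S. T p $$ (i, k) * X $$ (k, j))"
    using ij assms(1) by (simp add: mat_mult_index mat_sum_def sum_distrib_right del: index_mult_mat(1))
  also have "\<dots> = (\<Sum>p\<in>S. \<Sum>k<n. T p $$ (i, k) * X $$ (k, j))" by (rule sum.swap)
  also have "\<dots> = (\<Sum>p\<in>S. (T p * X) $$ (i, j))"
  proof (rule sum.cong[OF refl])
    fix p assume "p \<in> S"
    from assms(2)[OF this] show "(\<Sum>k<n. T p $$ (i, k) * X $$ (k, j)) = (T p * X) $$ (i, j)"
      using ij assms(1) by (simp add: mat_mult_index del: index_mult_mat(1))
  qed
  finally show "(mat_sum n T S * X) $$ (i, j) = mat_sum n (\<lambda>p. T p * X) S $$ (i, j)"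
    using ij by (simp add: mat_sum_def)
qed (use assms in auto)

lemma mat_sum_mult_left:
  assumes "X \<in> carrier_mat n n" "\<And>p. p \<in> S \<Longrightarrow> T p \<in> carrier_mat n n"
  shows "X * mat_sum n T S = mat_sum n (\<lambda>p. X * T p) S"
proof (rule eq_matI)
  fix i j assume "i < dim_row (mat_sum n (\<lambda>p. X * T p) S)" "j < dim_col (mat_sum n (\<lambda>p. X * T p) S)"
  hence ij: "i < n" "j < n" by auto
  have "(X * mat_sum n T S) $$ (i, j) = (\<Sum>k<n. \<Sum>p\<in>S. X $$ (i, k) * T p $$ (k, j))"
    using ij assms(1) by (simp add: mat_mult_index mat_sum_def sum_distrib_left del: index_mult_mat(1))
  also have "\<dots> = (\<Sum>p\<in>S. \<Sum>k<n. X $$ (i, k) * T p $$ (k, j))" by (rule sum.swap)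
  also have "\<dots> = (\<Sum>p\<in>S. (X * T p) $$ (i, j))"
  proof (rule sum.cong[OF refl])
    fix p assume "p \<in> S"
    from assms(2)[OF this] show "(\<Sum>k<n. X $$ (i, k) * T p $$ (k, j)) = (X * T p) $$ (i, j)"
      using ij assms(1) by (simp add: mat_mult_index del: index_mult_mat(1))
  qed
  finally show "(X * mat_sum n T S) $$ (i, j) = mat_sum n (\<lambda>p. X * T p) S $$ (i, j)"
    using ij by (simp add: mat_sum_def)
qed (use assms in auto)

lemma mtr_mat_sum:
  assumes "\<And>p. p \<in> S \<Longrightarrow> T p \<in> carrier_mat n n"
  shows "mtr (mat_sum n T S) = (\<Sum>p\<in>S. mtr (T p))"
proof -
  have "mtr (mat_sum n T S) = (\<Sum>p\<in>S. \<Sum>i<n. T p $$ (i, i))"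
    by (simp add: mtr_def mat_sum_def sum.swap[of _ S])
  also have "\<dots> = (\<Sum>p\<in>S. mtr (T p))"
    using assms by (intro sum.cong) (auto simp: mtr_def dest!: carrier_matD(1))
  finally show ?thesis .
qed

lemma mat_sum_cong: "(\<And>p. p \<in> S \<Longrightarrow> T p = T' p) \<Longrightarrow> mat_sum n T S = mat_sum n T' S"
  by (simp add: mat_sum_def cong: sum.cong)

lemma mat_sum_reindex:
  "bij_betw f S S \<Longrightarrow> mat_sum n (\<lambda>p. T (f p)) S = mat_sum n T S"
  by (simp add: mat_sum_def sum.reindex_bij_betw[of f S S "\<lambda>p. T p $$ _"])

context group
begin

lemma endo_inv: "\<phi> \<in> hom G G \<Longrightarrow> h \<in> carrier G \<Longrightarrow> \<phi> (inv h) = inv (\<phi> h)"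
  using group_hom.hom_inv[of G G \<phi> h] by (simp add: group_hom_def group_hom_axioms_def)

text \<open>Averaging \<open>adj_mat (\<rho> (\<phi> h)) * A\<^sub>0 * \<rho> h\<close> over
  \<open>h\<close> forces the twisted intertwining relation. Every term has the same coefficient
  function as \<open>A\<^sub>0\<close>, because that function is constant on twisted conjugacy
  classes.\<close>

lemma twisted_average:
  assumes r: "unitary_rep G n \<rho>" and fin: "finite (\<rho> ` carrier G)" and \<phi>: "\<phi> \<in> hom G G"
    and A0: "A\<^sub>0 \<in> carrier_mat n n"
    and tw: "\<And>g h. g \<in> carrier G \<Longrightarrow> h \<in> carrier G \<Longrightarrow>
      mtr (A\<^sub>0 * \<rho> (h \<otimes> g \<otimes> \<phi> (inv h))) = mtr (A\<^sub>0 * \<rho> g)"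
  obtains A where "intertwines A n \<rho> n (\<rho> \<circ> \<phi>)" "\<And>g. g \<in> carrier G \<Longrightarrow> mtr (A * \<rho> g) = mtr (A\<^sub>0 * \<rho> g)"
proof -
  have \<phi>c: "\<And>g. g \<in> carrier G \<Longrightarrow> \<phi> g \<in> carrier G" and \<phi>m: "\<And>g h. g \<in> carrier G \<Longrightarrow> h \<in> carrier G \<Longrightarrow> \<phi> (g \<otimes> h) = \<phi> g \<otimes> \<phi> h"
    using \<phi> by (auto simp: hom_def)
  note \<phi>i = endo_inv[OF \<phi>]
  note rd = unitary_rep_dim[OF r] and rm = unitary_rep_mult[OF r] and ra = unitary_rep_adj[OF r]
  have Ad: "dim_row A\<^sub>0 = n" "dim_col A\<^sub>0 = n" using A0 by auto
  \<comment> \<open>The group may be infinite but \<open>\<rho>\<close> has finite image, so the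
    average runs over the finitely many distinct pairs. Pairs are used because
    \<open>\<rho> h\<close> need not determine \<open>\<rho> (\<phi> h)\<close>.\<close>
  define S where "S = (\<lambda>h. (\<rho> h, \<rho> (\<phi> h))) ` carrier G"
  have "S \<subseteq> (\<rho> ` carrier G) \<times> (\<rho> ` carrier G)" by (auto simp: S_def \<phi>c)
  hence finS: "finite S" using fin by (meson finite_SigmaI finite_subset)
  have "S \<noteq> {}" by (auto simp: S_def)
  define T where "T = (\<lambda>(x, y). adj_mat y * A\<^sub>0 * (x :: complex mat))"
  have Tc: "T p \<in> carrier_mat n n" if "p \<in> S" for p
    using that by (auto simp: S_def T_def rd \<phi>c Ad intro!: carrier_matI)
  define A where "A = inverse (of_nat (card S)) \<cdot>\<^sub>m mat_sum n T S"
  show ?thesis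
  proof (rule that)
    show "intertwines A n \<rho> n (\<rho> \<circ> \<phi>)"
      unfolding intertwines_def
    proof (intro conjI ballI)
      show "A \<in> carrier_mat n n" by (auto simp: A_def intro!: carrier_matI)
      fix h assume h: "h \<in> carrier G"
      \<comment> \<open>Right translation by \<open>h\<close> permutes the pairs; this reindexing
        carries \<open>\<rho> h\<close> across the sum.\<close>
      define f where "f = (\<lambda>(x, y). (x * \<rho> h, y * \<rho> (\<phi> h)))"
      have "f ` S = S"
      proof (intro equalityI subsetI)
        fix p assume "p \<in> f ` S"
        then obtain k where k: "k \<in> carrier G" "p = f (\<rho> k, \<rho> (\<phi> k))" by (auto simp: S_def)
        show "p \<in> S" unfolding S_def
          by (rule image_eqI[of _ _ "k \<otimes> h"]) (auto simp: f_def k h rm \<phi>c \<phi>m)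
      next
        fix p assume "p \<in> S"
        then obtain k where k: "k \<in> carrier G" "p = (\<rho> k, \<rho> (\<phi> k))" by (auto simp: S_def)
        have "p = f (\<rho> (k \<otimes> inv h), \<rho> (\<phi> (k \<otimes> inv h)))"
          using h k by (simp add: f_def rm[symmetric] \<phi>m[symmetric] \<phi>c m_assoc)
        thus "p \<in> f ` S" using h k by (auto simp: S_def)
      qed
      hence bij: "bij_betw f S S"
        using finS by (simp add: bij_betw_def eq_card_imp_inj_on)
      have "mat_sum n T S * \<rho> h = mat_sum n (\<lambda>p. T p * \<rho> h) S"
        using Tc rd(1)[OF h] by (intro mat_sum_mult_right) auto
      also have "\<dots> = mat_sum n (\<lambda>p. \<rho> (\<phi> h) * T (f p)) S"
      proof (rule mat_sum_cong)
        fix p assume "p \<in> S"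
        then obtain k where k: "k \<in> carrier G" "p = (\<rho> k, \<rho> (\<phi> k))" by (auto simp: S_def)
        have "\<rho> (\<phi> h) * (adj_mat (\<rho> (\<phi> h)) * X) = X" if "dim_row X = n" for X
          using that by (simp add: mat_assoc[symmetric] rd h \<phi>c ra)
        thus "T p * \<rho> h = \<rho> (\<phi> h) * T (f p)"
          by (simp add: T_def f_def k mat_assoc rd h \<phi>c Ad adj_mat_mult)
      qed
      also have "\<dots> = \<rho> (\<phi> h) * mat_sum n (\<lambda>p. T (f p)) S"
      proof (rule mat_sum_mult_left[symmetric])
        fix p assume "p \<in> S"
        hence "f p \<in> S" using \<open>f ` S = S\<close> by blast
        thus "T (f p) \<in> carrier_mat n n" by (rule Tc)
      qed (use rd(1) \<phi>c h in auto)
      also have "mat_sum n (\<lambda>p. T (f p)) S = mat_sum n T S" by (rule mat_sum_reindex[OF bij])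
      finally show "A * \<rho> h = (\<rho> \<circ> \<phi>) h * A"
        using rd[OF h] rd[OF \<phi>c[OF h]] by (simp add: A_def mat_mult_smult_left mat_mult_smult_right)
    qed
    fix g assume g: "g \<in> carrier G"
    have "mtr (A * \<rho> g) = inverse (of_nat (card S)) * mtr (mat_sum n T S * \<rho> g)"
      using rd[OF g] by (simp add: A_def mat_mult_smult_left mtr_smult)
    also have "mat_sum n T S * \<rho> g = mat_sum n (\<lambda>p. T p * \<rho> g) S"
      using Tc rd(1)[OF g] by (intro mat_sum_mult_right) auto
    also have "mtr \<dots> = (\<Sum>p\<in>S. mtr (T p * \<rho> g))"
      using Tc rd(1)[OF g] by (intro mtr_mat_sum mult_carrier_mat) auto
    also have "\<dots> = (\<Sum>p\<in>S. mtr (A\<^sub>0 * \<rho> g))"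
    proof (rule sum.cong[OF refl])
      fix p assume "p \<in> S"
      then obtain k where k: "k \<in> carrier G" "p = (\<rho> k, \<rho> (\<phi> k))" by (auto simp: S_def)
      have "mtr (T p * \<rho> g) = mtr (adj_mat (\<rho> (\<phi> k)) * (A\<^sub>0 * \<rho> k * \<rho> g))"
        by (simp add: T_def k mat_assoc rd g \<phi>c Ad)
      \<comment> \<open>Cyclicity of the trace collects the factors into the value at the twisted
        conjugate of \<open>g\<close> by \<open>k\<close>.\<close>
      also have "\<dots> = mtr (A\<^sub>0 * \<rho> k * \<rho> g * adj_mat (\<rho> (\<phi> k)))"
        by (rule mtr_comm) (simp_all add: rd k g \<phi>c Ad)
      also have "A\<^sub>0 * \<rho> k * \<rho> g * adj_mat (\<rho> (\<phi> k)) = A\<^sub>0 * \<rho> (k \<otimes> g \<otimes> \<phi> (inv k))"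
        using k g by (simp add: mat_assoc rd \<phi>c Ad rm \<phi>i unitary_rep_inv[OF r])
      finally show "mtr (T p * \<rho> g) = mtr (A\<^sub>0 * \<rho> g)" using tw[OF g k(1)] by simp
    qed
    finally show "mtr (A * \<rho> g) = mtr (A\<^sub>0 * \<rho> g)" using \<open>S \<noteq> {}\<close> finS by simp
  qed
qed

text \<open>The right translate of \<open>D\<close> by \<open>inv k\<close>; the inverse makes
  \<open>translate\<close> a left action.\<close>

definition translate :: "'a \<Rightarrow> 'a set \<Rightarrow> 'a set" where
  "translate k D = {g \<in> carrier G. g \<otimes> k \<in> D}"

lemma translate_translate:
  "k \<in> carrier G \<Longrightarrow> l \<in> carrier G \<Longrightarrow> translate k (translate l D) = translate (k \<otimes> l) D"
  by (auto simp: translate_def m_assoc)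

lemma translate_one: "D \<subseteq> carrier G \<Longrightarrow> translate \<one> D = D"
  by (auto simp: translate_def)

text \<open>The group permutes the finitely many translates of \<open>C\<close>, and
  \<open>g \<in> C\<close> holds exactly when \<open>\<one> \<in> translate g C\<close>. Membership
  is thus read from a permutation matrix: follow the point \<open>C\<close>, then test whether its
  image contains the identity.\<close>

lemma indicator_is_coefficient:
  assumes C: "C \<subseteq> carrier G" and fin: "finite ((\<lambda>h. translate h C) ` carrier G)"
  obtains n \<rho> A where "unitary_rep G n \<rho>" "finite (\<rho> ` carrier G)" "A \<in> carrier_mat n n"
    "\<And>g. g \<in> carrier G \<Longrightarrow> mtr (A * \<rho> g) = (if g \<in> C then 1 else 0)"
proof -
  define X where "X = (\<lambda>h. translate h C) ` carrier G"
  define n where "n = card X"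
  have finX: "finite X" using fin by (simp add: X_def)
  obtain e where e: "bij_betw e {..<n} X"
    using ex_bij_betw_nat_finite[OF finX] by (auto simp: n_def lessThan_atLeast0)
  have eX: "e a \<in> X" if "a < n" for a using e that by (auto simp: bij_betw_def)
  have e_inj: "e a = e b \<longleftrightarrow> a = b" if "a < n" "b < n" for a b
    using e that by (auto simp: bij_betw_def inj_on_def)
  have trX: "translate k D \<in> X" if "k \<in> carrier G" "D \<in> X" for k D
    using that by (auto simp: X_def translate_translate)
  have tr1: "translate \<one> D = D" if "D \<in> X" for D
    using that by (intro translate_one) (auto simp: X_def translate_def)
  define \<rho> where "\<rho> = (\<lambda>k. mat n n (\<lambda>(a, b). if e a = translate k (e b) then 1 else 0 :: complex))"
  have \<rho>d: "\<rho> k \<in> carrier_mat n n" "dim_row (\<rho> k) = n" "dim_col (\<rho> k) = n" for k by (auto simp: \<rho>_def)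
  have mult: "\<rho> (k \<otimes> l) = \<rho> k * \<rho> l" if k: "k \<in> carrier G" and l: "l \<in> carrier G" for k l
  proof (rule eq_matI)
    fix a b assume "a < dim_row (\<rho> k * \<rho> l)" "b < dim_col (\<rho> k * \<rho> l)"
    hence ab: "a < n" "b < n" by (auto simp: \<rho>d)
    obtain c where c: "c < n" "e c = translate l (e b)"
      using trX[OF l eX[OF ab(2)]] e by (auto simp: bij_betw_def)
    have "(\<rho> k * \<rho> l) $$ (a, b) = (\<Sum>c'<n. (if e a = translate k (e c') then 1 else 0) * (if e c' = translate l (e b) then 1 else 0))"
      using ab by (simp add: mat_mult_index \<rho>d del: index_mult_mat(1)) (simp add: \<rho>_def)
    also have "\<dots> = (\<Sum>c'<n. if c' = c then (if e a = translate k (e c) then 1 else 0) else 0)"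
      using c by (intro sum.cong) (auto simp: c(2)[symmetric] e_inj)
    also have "\<dots> = (if e a = translate (k \<otimes> l) (e b) then 1 else 0)"
      using c k l by (simp add: translate_translate)
    finally show "\<rho> (k \<otimes> l) $$ (a, b) = (\<rho> k * \<rho> l) $$ (a, b)" using ab by (simp add: \<rho>_def)
  qed (auto simp: \<rho>d)
  have one: "\<rho> \<one> = 1\<^sub>m n"
    by (rule eq_matI) (auto simp: \<rho>_def e_inj tr1 eX)
  have adj: "adj_mat (\<rho> k) = \<rho> (inv k)" if k: "k \<in> carrier G" for k
  proof (rule eq_matI)
    fix a b assume "a < dim_row (\<rho> (inv k))" "b < dim_col (\<rho> (inv k))"
    hence ab: "a < n" "b < n" by (auto simp: \<rho>d)
    have "e b = translate k (e a) \<longleftrightarrow> e a = translate (inv k) (e b)"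
    proof
      assume "e b = translate k (e a)"
      hence "translate (inv k) (e b) = translate (inv k \<otimes> k) (e a)" using k by (simp add: translate_translate)
      thus "e a = translate (inv k) (e b)" using k tr1[OF eX[OF ab(1)]] by simp
    next
      assume "e a = translate (inv k) (e b)"
      hence "translate k (e a) = translate (k \<otimes> inv k) (e b)" using k by (simp add: translate_translate)
      thus "e b = translate k (e a)" using k tr1[OF eX[OF ab(2)]] by simp
    qed
    thus "adj_mat (\<rho> k) $$ (a, b) = \<rho> (inv k) $$ (a, b)"
      using ab by (simp add: \<rho>d) (simp add: \<rho>_def)
  qed (auto simp: \<rho>d)
  have rep: "unitary_rep G n \<rho>"
    unfolding unitary_rep_def unitary_mat_def
    using \<rho>d mult by (auto simp: adj mult[symmetric] one)
  \<comment> \<open>\<open>\<rho> k\<close> depends only on the self-map that \<open>k\<close>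
    induces on the finite set \<open>X\<close>.\<close>
  have "\<rho> ` carrier G \<subseteq> (\<lambda>F. mat n n (\<lambda>(a, b). if e a = F (e b) then 1 else 0)) ` (X \<rightarrow>\<^sub>E X)"
  proof (rule image_subsetI)
    fix k assume k: "k \<in> carrier G"
    have "restrict (translate k) X \<in> X \<rightarrow>\<^sub>E X" using trX[OF k] by auto
    moreover have "\<rho> k = mat n n (\<lambda>(a, b). if e a = restrict (translate k) X (e b) then 1 else 0)"
      by (rule eq_matI) (auto simp: \<rho>_def eX)
    ultimately show "\<rho> k \<in> (\<lambda>F. mat n n (\<lambda>(a, b). if e a = F (e b) then 1 else 0)) ` (X \<rightarrow>\<^sub>E X)"
      by blast
  qed
  hence finim: "finite (\<rho> ` carrier G)"
    by (rule finite_subset) (intro finite_imageI finite_PiE finX)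
  have "C \<in> X" using translate_one[OF C] by (force simp: X_def)
  then obtain c where c: "c < n" "e c = C" using e by (auto simp: bij_betw_def)
  \<comment> \<open>Row \<open>c\<close> tests for containing the identity and the other rows
    vanish, so the trace sees only column \<open>c\<close> of \<open>\<rho> g\<close>, which marks
    the image of \<open>C\<close>.\<close>
  define A where "A = mat n n (\<lambda>(b, a). if b = c \<and> \<one> \<in> e a then 1 else 0 :: complex)"
  have Ac: "A \<in> carrier_mat n n" by (simp add: A_def)
  have "mtr (A * \<rho> g) = (if g \<in> C then 1 else 0)" if g: "g \<in> carrier G" for g
  proof -
    obtain d where d: "d < n" "e d = translate g C"
      using trX[OF g \<open>C \<in> X\<close>] e by (auto simp: bij_betw_def)
    have "mtr (A * \<rho> g) = (\<Sum>b<n. \<Sum>a<n. A $$ (b, a) * \<rho> g $$ (a, b))"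
      by (rule mtr_mult[OF Ac \<rho>d(1)])
    also have "\<dots> = (\<Sum>b<n. if b = c then (\<Sum>a<n. A $$ (b, a) * \<rho> g $$ (a, b)) else 0)"
      by (intro sum.cong) (auto simp: A_def)
    also have "\<dots> = (\<Sum>a<n. A $$ (c, a) * \<rho> g $$ (a, c))" using c by simp
    also have "\<dots> = (\<Sum>a<n. if a = d then (if \<one> \<in> e d then 1 else 0) else 0)"
      using c d by (intro sum.cong) (auto simp: A_def \<rho>_def d(2)[symmetric] e_inj)
    also have "\<dots> = (if g \<in> C then 1 else 0)" using d g by (simp add: translate_def)
    finally show ?thesis .
  qed
  from that[OF rep finim Ac this] show ?thesis .
qed

section \<open>Counting fixed classes\<close>

lemma intertwines_id: "unitary_rep G n \<rho> \<Longrightarrow> intertwines (1\<^sub>m n) n \<rho> n \<rho>"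
  by (auto simp: intertwines_def unitary_rep_dim)

lemma intertwines_smult:
  assumes X: "intertwines X n \<rho> m \<sigma>" and r: "unitary_rep G n \<rho>" and s: "unitary_rep G m \<sigma>"
  shows "intertwines (c \<cdot>\<^sub>m X) n \<rho> m \<sigma>"
  using X unitary_rep_dim[OF r] unitary_rep_dim[OF s]
  by (auto simp: intertwines_def mat_mult_smult_left mat_mult_smult_right)

lemma unitary_mat_nonzero: "unitary_mat n U \<Longrightarrow> n \<ge> 1 \<Longrightarrow> U \<noteq> 0\<^sub>m n n"
proof
  assume U: "unitary_mat n U" "n \<ge> 1" "U = 0\<^sub>m n n"
  have "(1\<^sub>m n :: complex mat) = U * adj_mat U" using U(1) by (simp add: unitary_mat_def)
  also have "\<dots> = 0\<^sub>m n n" by (simp add: U(3))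
  finally have "(1\<^sub>m n :: complex mat) $$ (0, 0) = 0\<^sub>m n n $$ (0, 0)" by simp
  thus False using U(2) by simp
qed

lemma unitary_mat_adj: "unitary_mat n U \<Longrightarrow> unitary_mat n (adj_mat U)"
  by (simp add: unitary_mat_def)

lemma unitary_mat_mult:
  assumes U: "unitary_mat n U" and V: "unitary_mat n V"
  shows "unitary_mat n (U * V)"
proof -
  have d: "dim_row U = n" "dim_col U = n" "dim_row V = n" "dim_col V = n"
    and e: "U * adj_mat U = 1\<^sub>m n" "adj_mat U * U = 1\<^sub>m n" "V * adj_mat V = 1\<^sub>m n" "adj_mat V * V = 1\<^sub>m n"
    using U V by (auto simp: unitary_mat_def)
  have "V * (adj_mat V * X) = X" "adj_mat U * (U * X) = X" if "dim_row X = n" for X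
    using that by (simp_all add: mat_assoc[symmetric] d e)
  thus ?thesis by (auto simp: unitary_mat_def d adj_mat_mult mat_assoc e intro!: carrier_matI)
qed

text \<open>Conjugation by a unitary matrix and intertwining by it are the same relation. The
  dimension, over which \<open>rep_equiv\<close> only quantifies, is pinned down at the identity
  element.\<close>

lemma rep_equiv_iff:
  assumes \<rho>: "irreducible_unitary_rep G n \<rho>" and \<sigma>: "irreducible_unitary_rep G m \<sigma>"
  shows "(\<rho>, \<sigma>) \<in> rep_equiv G \<longleftrightarrow> m = n \<and> (\<exists>U. unitary_mat n U \<and> intertwines U n \<rho> n \<sigma>)"
proof
  note r = irreducibleD[OF \<rho>] and s = irreducibleD[OF \<sigma>]
  {
    assume "(\<rho>, \<sigma>) \<in> rep_equiv G"
    then obtain k U where U: "unitary_mat k U" "\<And>g. g \<in> carrier G \<Longrightarrow> \<rho> g \<in> carrier_mat k k"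
      "\<And>g. g \<in> carrier G \<Longrightarrow> \<sigma> g = U * \<rho> g * adj_mat U"
      unfolding rep_equiv_def by blast
    have k: "k = n" using U(2)[OF one_closed] unitary_rep_dim[OF r(1) one_closed] by auto
    have Uc: "dim_row U = n" "dim_col U = n" and UU: "adj_mat U * U = 1\<^sub>m n"
      using U(1) by (auto simp: unitary_mat_def k)
    have "m = n" using U(3)[OF one_closed] unitary_rep_dim[OF s(1) one_closed] Uc by auto
    moreover have "intertwines U n \<rho> n \<sigma>"
      unfolding intertwines_def
      using Uc U(3) UU unitary_rep_dim[OF r(1)] by (auto simp: mat_assoc intro!: carrier_matI)
    ultimately show "m = n \<and> (\<exists>U. unitary_mat n U \<and> intertwines U n \<rho> n \<sigma>)"
      using U(1) k by blast
  }
  assume "m = n \<and> (\<exists>U. unitary_mat n U \<and> intertwines U n \<rho> n \<sigma>)"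
  then obtain U where mn: "m = n" and U: "unitary_mat n U" "intertwines U n \<rho> n \<sigma>" by blast
  have Uc: "dim_row U = n" "dim_col U = n" and UU: "U * adj_mat U = 1\<^sub>m n"
    using U(1) by (auto simp: unitary_mat_def)
  have "\<sigma> g = U * \<rho> g * adj_mat U" if g: "g \<in> carrier G" for g
  proof -
    note d = unitary_rep_dim[OF s(1) g, unfolded mn]
    have "U * \<rho> g * adj_mat U = \<sigma> g * (U * adj_mat U)"
      using U(2) g by (simp add: intertwines_def mat_assoc d Uc)
    thus ?thesis by (simp add: UU d)
  qed
  thus "(\<rho>, \<sigma>) \<in> rep_equiv G"
    using \<rho> \<sigma> U(1) unitary_rep_dim[OF r(1)] unfolding rep_equiv_def irr_reps_def by blast
qed

lemma intertwined_imp_rep_equiv: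
  assumes \<rho>: "irreducible_unitary_rep G n \<rho>" and \<sigma>: "irreducible_unitary_rep G m \<sigma>"
    and X: "intertwines X n \<rho> m \<sigma>" "X \<noteq> 0\<^sub>m m n"
  shows "(\<rho>, \<sigma>) \<in> rep_equiv G"
proof -
  obtain c U where cU: "m = n" "c \<noteq> 0" "unitary_mat n U" "X = c \<cdot>\<^sub>m U"
    using schur_unitary[OF \<rho> \<sigma> X] by blast
  have "intertwines (inverse c \<cdot>\<^sub>m X) n \<rho> n \<sigma>"
    using intertwines_smult[OF X(1)] irreducibleD(1)[OF \<rho>] irreducibleD(1)[OF \<sigma>] cU(1) by blast
  moreover have "inverse c \<cdot>\<^sub>m X = U" using cU(2) by (auto simp: cU(4) intro!: eq_matI)
  ultimately show ?thesis using cU rep_equiv_iff[OF \<rho> \<sigma>] by blast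
qed

lemma equiv_rep_equiv: "equiv (irr_reps G) (rep_equiv G)"
proof (rule equivI)
  show "rep_equiv G \<subseteq> irr_reps G \<times> irr_reps G" by (auto simp: rep_equiv_def)
  show "refl_on (irr_reps G) (rep_equiv G)"
  proof (rule refl_onI)
    fix \<rho> assume "\<rho> \<in> irr_reps G"
    then obtain n where n: "irreducible_unitary_rep G n \<rho>" by (auto simp: irr_reps_def)
    have "unitary_mat n (1\<^sub>m n)" by (simp add: unitary_mat_def)
    thus "(\<rho>, \<rho>) \<in> rep_equiv G"
      using rep_equiv_iff[OF n n] intertwines_id[OF irreducibleD(1)[OF n]] by blast
  qed
  show "sym (rep_equiv G)"
  proof (rule symI)
    fix \<rho> \<sigma> assume rs: "(\<rho>, \<sigma>) \<in> rep_equiv G"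
    then obtain n m where n: "irreducible_unitary_rep G n \<rho>" and m: "irreducible_unitary_rep G m \<sigma>"
      by (auto simp: rep_equiv_def irr_reps_def)
    from rs obtain U where mn: "m = n" and U: "unitary_mat n U" "intertwines U n \<rho> n \<sigma>"
      using rep_equiv_iff[OF n m] by blast
    have "intertwines (adj_mat U) n \<sigma> n \<rho>"
      using intertwines_adj[OF U(2)] irreducibleD(1)[OF n] irreducibleD(1)[OF m] mn by blast
    thus "(\<sigma>, \<rho>) \<in> rep_equiv G"
      using rep_equiv_iff[OF m n] mn unitary_mat_adj[OF U(1)] by blast
  qed
  show "trans (rep_equiv G)"
  proof (rule transI)
    fix \<rho> \<sigma> \<tau> assume rs: "(\<rho>, \<sigma>) \<in> rep_equiv G" and st: "(\<sigma>, \<tau>) \<in> rep_equiv G"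
    then obtain n m l where n: "irreducible_unitary_rep G n \<rho>" and m: "irreducible_unitary_rep G m \<sigma>"
      and l: "irreducible_unitary_rep G l \<tau>"
      by (auto simp: rep_equiv_def irr_reps_def)
    obtain U where mn: "m = n" and U: "unitary_mat n U" "intertwines U n \<rho> n \<sigma>"
      using rs rep_equiv_iff[OF n m] by blast
    obtain V where ml: "l = n" and V: "unitary_mat n V" "intertwines V n \<sigma> n \<tau>"
      using st rep_equiv_iff[OF m l] mn by blast
    have "intertwines (V * U) n \<rho> n \<tau>"
      using intertwines_mult[OF U(2) V(2)] irreducibleD(1)[OF n]
        irreducibleD(1)[OF m] irreducibleD(1)[OF l] mn ml by blast
    thus "(\<rho>, \<tau>) \<in> rep_equiv G"
      using rep_equiv_iff[OF n l] ml unitary_mat_mult[OF V(1) U(1)] by blast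
  qed
qed

text \<open>\<open>\<phi>\<close> is onto, so \<open>\<rho> \<circ> \<phi>\<close> and
  \<open>\<rho>\<close> have the same invariant subspaces.\<close>

lemma irreducible_twist:
  assumes \<rho>: "irreducible_unitary_rep G n \<rho>" and \<phi>: "\<phi> \<in> iso G G"
  shows "irreducible_unitary_rep G n (\<rho> \<circ> \<phi>)"
proof -
  have hom: "\<phi> \<in> hom G G" and surj: "\<phi> ` carrier G = carrier G"
    using \<phi> by (auto simp: iso_def bij_betw_def)
  have \<phi>c: "\<And>g. g \<in> carrier G \<Longrightarrow> \<phi> g \<in> carrier G" using surj by blast
  note r = irreducibleD[OF \<rho>]
  have "unitary_rep G n (\<rho> \<circ> \<phi>)"
    using r(1) \<phi>c hom by (auto simp: unitary_rep_def hom_def)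
  moreover have "W = {0\<^sub>v n} \<or> W = carrier_vec n"
    if W: "linear_subspace n W" and inv: "\<forall>g\<in>carrier G. \<forall>w\<in>W. (\<rho> \<circ> \<phi>) g *\<^sub>v w \<in> W" for W
  proof -
    have "\<forall>g\<in>carrier G. \<forall>w\<in>W. \<rho> g *\<^sub>v w \<in> W"
    proof (intro ballI)
      fix g w assume g: "g \<in> carrier G" and w: "w \<in> W"
      obtain h where "h \<in> carrier G" "g = \<phi> h" using g surj by blast
      thus "\<rho> g *\<^sub>v w \<in> W" using inv w by auto
    qed
    thus ?thesis using \<rho> W by (auto simp: irreducible_unitary_rep_def)
  qed
  ultimately show ?thesis using r(2) by (auto simp: irreducible_unitary_rep_def)
qed

lemma fixed_dual_classesD:
  assumes \<phi>: "\<phi> \<in> iso G G" and C: "C \<in> fixed_dual_classes G \<phi>"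
  shows "\<exists>n \<rho> U. \<rho> \<in> C \<and> irreducible_unitary_rep G n \<rho> \<and> unitary_mat n U \<and> intertwines U n \<rho> n (\<rho> \<circ> \<phi>)"
proof -
  obtain \<rho> where Cq: "C \<in> irr_reps G // rep_equiv G" and \<rho>C: "\<rho> \<in> C" and eq: "rep_equiv G `` {\<rho> \<circ> \<phi>} = C"
    using C by (auto simp: fixed_dual_classes_def unitary_dual_def)
  have "\<rho> \<in> irr_reps G" using \<rho>C Cq in_quotient_imp_subset[OF equiv_rep_equiv] by blast
  then obtain n where n: "irreducible_unitary_rep G n \<rho>" by (auto simp: irr_reps_def)
  have "(\<rho> \<circ> \<phi>, \<rho>) \<in> rep_equiv G" using \<rho>C eq by blast
  hence "(\<rho>, \<rho> \<circ> \<phi>) \<in> rep_equiv G" using equiv_rep_equiv by (auto simp: equiv_def dest: symD)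
  thus ?thesis using rep_equiv_iff[OF n irreducible_twist[OF n \<phi>]] \<rho>C n by blast
qed

text \<open>Any nonzero twisted intertwiner, unitary or not, makes the class fixed; this serves the
  constituents that appear in a decomposition.\<close>

lemma fixed_dual_classesI:
  assumes \<phi>: "\<phi> \<in> iso G G" and \<rho>: "irreducible_unitary_rep G n \<rho>"
    and B: "intertwines B n \<rho> n (\<rho> \<circ> \<phi>)" "B \<noteq> 0\<^sub>m n n"
  shows "rep_equiv G `` {\<rho>} \<in> fixed_dual_classes G \<phi>"
proof -
  have \<rho>i: "\<rho> \<in> irr_reps G" using \<rho> by (auto simp: irr_reps_def)
  have "(\<rho>, \<rho> \<circ> \<phi>) \<in> rep_equiv G"
    by (rule intertwined_imp_rep_equiv[OF \<rho> irreducible_twist[OF \<rho> \<phi>] B])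
  hence "rep_equiv G `` {\<rho>} = rep_equiv G `` {\<rho> \<circ> \<phi>}" by (rule equiv_class_eq[OF equiv_rep_equiv])
  moreover have "\<rho> \<in> rep_equiv G `` {\<rho>}" by (rule equiv_class_self[OF equiv_rep_equiv \<rho>i])
  moreover have "rep_equiv G `` {\<rho>} \<in> irr_reps G // rep_equiv G" using \<rho>i by (rule quotientI)
  ultimately show ?thesis unfolding fixed_dual_classes_def unitary_dual_def by blast
qed

text \<open>Free of inverses, this form turns conjugacy in the wreath product into equations between
  components.\<close>

lemma twisted_conj_iff:
  assumes \<phi>: "\<phi> \<in> hom G G"
  shows "(g, g') \<in> twisted_conj G \<phi> \<longleftrightarrow>
    g \<in> carrier G \<and> g' \<in> carrier G \<and> (\<exists>h\<in>carrier G. g' \<otimes> \<phi> h = h \<otimes> g)"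
proof -
  have \<phi>c: "\<And>g. g \<in> carrier G \<Longrightarrow> \<phi> g \<in> carrier G" using \<phi> by (auto simp: hom_def)
  note \<phi>i = endo_inv[OF \<phi>]
  have "g' = h \<otimes> g \<otimes> \<phi> (inv h) \<longleftrightarrow> g' \<otimes> \<phi> h = h \<otimes> g"
    if "g \<in> carrier G" "g' \<in> carrier G" "h \<in> carrier G" for h
    using that \<phi>c by (metis \<phi>i inv_solve_right m_closed)
  thus ?thesis by (auto simp: twisted_conj_def)
qed

lemma equiv_twisted_conj:
  assumes \<phi>: "\<phi> \<in> hom G G"
  shows "equiv (carrier G) (twisted_conj G \<phi>)"
proof (rule equivI)
  note iff = twisted_conj_iff[OF \<phi>]
  have \<phi>c: "\<And>g. g \<in> carrier G \<Longrightarrow> \<phi> g \<in> carrier G"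
    and \<phi>m: "\<And>g h. g \<in> carrier G \<Longrightarrow> h \<in> carrier G \<Longrightarrow> \<phi> (g \<otimes> h) = \<phi> g \<otimes> \<phi> h"
    using \<phi> by (auto simp: hom_def)
  have \<phi>1: "\<phi> \<one> = \<one>" using hom_one[OF \<phi>] is_group by simp
  note \<phi>i = endo_inv[OF \<phi>]
  show "twisted_conj G \<phi> \<subseteq> carrier G \<times> carrier G" by (auto simp: twisted_conj_def)
  show "refl_on (carrier G) (twisted_conj G \<phi>)"
    by (rule refl_onI) (auto simp: iff \<phi>1 intro!: bexI[of _ \<one>])
  show "sym (twisted_conj G \<phi>)"
  proof (rule symI)
    fix g g' assume "(g, g') \<in> twisted_conj G \<phi>"
    then obtain h where h: "g \<in> carrier G" "g' \<in> carrier G" "h \<in> carrier G" "g' \<otimes> \<phi> h = h \<otimes> g" by (auto simp: iff)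
    have "g \<otimes> \<phi> (inv h) = inv h \<otimes> (h \<otimes> g) \<otimes> inv (\<phi> h)"
      using h \<phi>c by (simp add: \<phi>i m_assoc[symmetric])
    also have "\<dots> = inv h \<otimes> g'" using h \<phi>c by (simp add: h(4)[symmetric] m_assoc)
    finally show "(g', g) \<in> twisted_conj G \<phi>" using h by (auto simp: iff intro!: bexI[of _ "inv h"])
  qed
  show "trans (twisted_conj G \<phi>)"
  proof (rule transI)
    fix x y z assume "(x, y) \<in> twisted_conj G \<phi>" "(y, z) \<in> twisted_conj G \<phi>"
    then obtain h k where h: "x \<in> carrier G" "y \<in> carrier G" "h \<in> carrier G" "y \<otimes> \<phi> h = h \<otimes> x"
      and k: "z \<in> carrier G" "k \<in> carrier G" "z \<otimes> \<phi> k = k \<otimes> y" by (auto simp: iff)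
    have "z \<otimes> \<phi> (k \<otimes> h) = k \<otimes> y \<otimes> \<phi> h" using h k \<phi>c by (simp add: \<phi>m m_assoc[symmetric])
    also have "\<dots> = k \<otimes> h \<otimes> x" using h k \<phi>c by (simp add: m_assoc)
    finally show "(x, z) \<in> twisted_conj G \<phi>" using h k by (auto simp: iff intro!: bexI[of _ "k \<otimes> h"])
  qed
qed

lemma sum_fun_apply: "(\<Sum>i\<in>I. F i) x = (\<Sum>i\<in>I. F i x :: complex)"
  by (induction I rule: infinite_finite_induct) auto

text \<open>The functions \<open>f C\<close> of the fixed classes and the indicators of the
  Reidemeister classes are each independent and each lie in the span of the other family. Two
  exchange arguments equate the cardinalities; the first also yields finiteness of the set of fixed
  classes, which is not known beforehand.\<close>

lemma twisted_burnside_frobenius: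
  assumes \<phi>: "\<phi> \<in> iso G G" and fin: "finite (reidemeister_classes G \<phi>)"
    and tr: "\<And>C. C \<in> reidemeister_classes G \<phi> \<Longrightarrow> finite ((\<lambda>h. translate h C) ` carrier G)"
  shows "finite (fixed_dual_classes G \<phi>) \<and> card (fixed_dual_classes G \<phi>) = card (reidemeister_classes G \<phi>)"
proof -
  define F where "F = fixed_dual_classes G \<phi>"
  define R where "R = reidemeister_classes G \<phi>"
  have hom: "\<phi> \<in> hom G G" using \<phi> by (auto simp: iso_def)
  hence \<phi>c: "\<And>g. g \<in> carrier G \<Longrightarrow> \<phi> g \<in> carrier G" by (auto simp: hom_def)
  note tw_equiv = equiv_twisted_conj[OF hom]
  have Rsub: "D \<subseteq> carrier G" "D \<noteq> {}" if "D \<in> R" for D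
    using that in_quotient_imp_subset[OF tw_equiv] in_quotient_imp_non_empty[OF tw_equiv]
    by (auto simp: R_def reidemeister_classes_def)
  have Rclass: "(g, g') \<in> twisted_conj G \<phi>" if "D \<in> R" "g \<in> D" "g' \<in> D" for D g g'
    using quotient_eq_iff[OF tw_equiv, of D D g g'] that by (auto simp: R_def reidemeister_classes_def)
  have Rclosed: "g' \<in> D" if "D \<in> R" "g \<in> D" "(g, g') \<in> twisted_conj G \<phi>" for D g g'
    using in_quotient_imp_closed[OF tw_equiv _ that(2,3)] that(1) by (simp add: R_def reidemeister_classes_def)
  have Rdisj: "D = D'" if "D \<in> R" "D' \<in> R" "g \<in> D" "g \<in> D'" for D D' g
    using quotient_disj[OF tw_equiv, of D D'] that by (auto simp: R_def reidemeister_classes_def)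
  have Rcover: "\<exists>D\<in>R. g \<in> D" if "g \<in> carrier G" for g
    using Union_quotient[OF tw_equiv] that by (auto simp: R_def reidemeister_classes_def)

  have "\<forall>C\<in>F. \<exists>n \<rho> U. \<rho> \<in> C \<and> irreducible_unitary_rep G n \<rho> \<and> unitary_mat n U \<and> intertwines U n \<rho> n (\<rho> \<circ> \<phi>)"
    using fixed_dual_classesD[OF \<phi>] by (auto simp: F_def)
  then obtain n \<rho> U where rep: "\<And>C. C \<in> F \<Longrightarrow> \<rho> C \<in> C"
    and irr: "\<And>C. C \<in> F \<Longrightarrow> irreducible_unitary_rep G (n C) (\<rho> C)"
    and U: "\<And>C. C \<in> F \<Longrightarrow> unitary_mat (n C) (U C)"
    and Ui: "\<And>C. C \<in> F \<Longrightarrow> intertwines (U C) (n C) (\<rho> C) (n C) (\<rho> C \<circ> \<phi>)"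
    by metis
  have Uc: "U C \<in> carrier_mat (n C) (n C)" if "C \<in> F" for C using U[OF that] by (simp add: unitary_mat_def)
  note rr = irreducibleD(1)[OF irr]
  define f where "f = (\<lambda>C g. if g \<in> carrier G then mtr (U C * \<rho> C g) else 0)"
  define ind where "ind = (\<lambda>(D :: 'a set) g. if g \<in> D then 1 else 0 :: complex)"

  have indep: "a C = 0"
    if I: "finite I" "I \<subseteq> F" and rel: "\<And>g. g \<in> carrier G \<Longrightarrow> (\<Sum>C\<in>I. a C * f C g) = 0" and C: "C \<in> I" for I a C
  proof -
    have "a C \<cdot>\<^sub>m U C = 0\<^sub>m (n C) (n C)"
    proof (rule matrix_coefficients_independent[of I n \<rho> "\<lambda>C. a C \<cdot>\<^sub>m U C"])
      show "irreducible_unitary_rep G (n C) (\<rho> C)" if "C \<in> I" for C using irr that I by blast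
      show "X = 0\<^sub>m (n D) (n C)"
        if "C \<in> I" "D \<in> I" "C \<noteq> D" "intertwines X (n C) (\<rho> C) (n D) (\<rho> D)" for C D X
      proof (rule ccontr)
        assume "X \<noteq> 0\<^sub>m (n D) (n C)"
        hence *: "(\<rho> C, \<rho> D) \<in> rep_equiv G"
          using intertwined_imp_rep_equiv[OF irr irr that(4)] that I by blast
        have "C \<in> irr_reps G // rep_equiv G" "D \<in> irr_reps G // rep_equiv G"
          using that I by (auto simp: F_def fixed_dual_classes_def unitary_dual_def)
        hence "C = D" using * rep[of C] rep[of D] that I quotient_eq_iff[OF equiv_rep_equiv] by blast
        with that show False by simp
      qed
      show "finite I" "C \<in> I" by fact+
      show "a C \<cdot>\<^sub>m U C \<in> carrier_mat (n C) (n C)" if "C \<in> I" for C using Uc that I by auto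
      show "(\<Sum>C\<in>I. mtr (a C \<cdot>\<^sub>m U C * \<rho> C g)) = 0" if g: "g \<in> carrier G" for g
      proof -
        have "(\<Sum>C\<in>I. mtr (a C \<cdot>\<^sub>m U C * \<rho> C g)) = (\<Sum>C\<in>I. a C * f C g)"
        proof (rule sum.cong[OF refl])
          fix C assume "C \<in> I"
          hence C: "C \<in> F" using I by blast
          show "mtr (a C \<cdot>\<^sub>m U C * \<rho> C g) = a C * f C g"
            using Uc[OF C] unitary_rep_dim[OF rr[OF C] g] g by (simp add: f_def mat_mult_smult_left mtr_smult)
        qed
        thus ?thesis using rel[OF g] by simp
      qed
    qed
    moreover have CF: "C \<in> F" using C I by blast
    ultimately show "a C = 0"
      using unitary_mat_nonzero[OF U[OF CF] irreducibleD(2)[OF irr[OF CF]]] Uc[OF CF]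
      by (auto simp: mat_eq_iff)
  qed
  \<comment> \<open>Independence of the image of \<open>f\<close> counts the classes only if
    \<open>f\<close> is injective; two equal functions would satisfy a relation with coefficients 1
    and -1.\<close>
  have inj_f: "inj_on f F"
  proof (rule inj_onI, rule ccontr)
    fix C D assume CD: "C \<in> F" "D \<in> F" "f C = f D" "C \<noteq> D"
    have "(\<lambda>B. if B = C then 1 else - 1 :: complex) C = 0"
      by (rule indep[of "{C, D}"]) (use CD in auto)
    thus False by simp
  qed

  interpret V: vector_space "\<lambda>(c::complex) (f::'a \<Rightarrow> complex) x. c * f x"
    by unfold_locales (auto simp: fun_eq_iff algebra_simps)
  have "V.independent (f ` F)"
    unfolding V.independent_explicit_module
  proof (intro allI impI)
    fix t :: "('a \<Rightarrow> complex) set" and u v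
    assume t: "finite t" "t \<subseteq> f ` F" "(\<Sum>v\<in>t. (\<lambda>x. u v * v x)) = 0" "v \<in> t"
    obtain I where I: "I \<subseteq> F" "inj_on f I" "t = f ` I" using t(2) by (auto simp: subset_image_inj)
    then obtain C where C: "C \<in> I" "v = f C" using t(4) by blast
    have "u (f C) = 0"
    proof (rule indep[of I])
      show "finite I" using t(1) I finite_image_iff by blast
      fix g assume "g \<in> carrier G"
      have "(\<Sum>v\<in>t. (\<lambda>x. u v * v x)) g = 0" by (simp add: t(3))
      thus "(\<Sum>C\<in>I. u (f C) * f C g) = 0" by (simp add: sum_fun_apply I(3) sum.reindex[OF I(2)])
    qed (use I C in auto)
    thus "u v = 0" by (simp add: C)
  qed
  moreover have f_span: "f C \<in> V.span (ind ` R)" if C: "C \<in> F" for C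
  proof -
    note d = unitary_rep_dim[OF rr[OF C]] and m = unitary_rep_mult[OF rr[OF C]] and ad = unitary_rep_adj[OF rr[OF C]]
    have Ud: "dim_row (U C) = n C" "dim_col (U C) = n C" using Uc[OF C] by auto
    \<comment> \<open>The intertwining relation replaces \<open>U C * \<rho> C h\<close> by
      \<open>\<rho> C (\<phi> h) * U C\<close>, and cyclicity of the trace cancels
      \<open>\<rho> C (\<phi> h)\<close> against its adjoint.\<close>
    have const: "f C g = f C g'" if gg': "(g, g') \<in> twisted_conj G \<phi>" for g g'
    proof -
      obtain h where h: "g \<in> carrier G" "g' \<in> carrier G" "h \<in> carrier G" "g' \<otimes> \<phi> h = h \<otimes> g"
        using gg' by (auto simp: twisted_conj_iff[OF hom])
      have c: "adj_mat (\<rho> C (\<phi> h)) * (\<rho> C (\<phi> h) * X) = X" if "dim_row X = n C" for X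
        using that h \<phi>c by (simp add: mat_assoc[symmetric] d ad)
      have i: "U C * (\<rho> C h * X) = \<rho> C (\<phi> h) * (U C * X)" if "dim_row X = n C" for X
        using Ui[OF C] that h \<phi>c by (simp add: mat_assoc[symmetric] d Ud intertwines_def)
      have "mtr (U C * \<rho> C g') = mtr (U C * (\<rho> C g' * \<rho> C (\<phi> h)) * adj_mat (\<rho> C (\<phi> h)))"
        using h \<phi>c by (simp add: mat_assoc d Ud ad)
      also have "\<rho> C g' * \<rho> C (\<phi> h) = \<rho> C h * \<rho> C g" using h \<phi>c by (simp add: m[symmetric])
      also have "mtr (U C * (\<rho> C h * \<rho> C g) * adj_mat (\<rho> C (\<phi> h))) = mtr (adj_mat (\<rho> C (\<phi> h)) * (U C * (\<rho> C h * \<rho> C g)))"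
        using h \<phi>c by (intro mtr_comm) (auto simp: d Ud)
      also have "\<dots> = mtr (U C * \<rho> C g)" using h \<phi>c by (simp add: i c d Ud)
      finally show ?thesis using h by (simp add: f_def)
    qed
    define p where "p = (\<lambda>D :: 'a set. SOME g. g \<in> D)"
    have p: "p D \<in> D" if "D \<in> R" for D unfolding p_def using Rsub(2)[OF that] by (auto intro: someI)
    have "f C = (\<Sum>D\<in>R. (\<lambda>x. f C (p D) * ind D x))"
    proof (rule ext)
      fix g
      show "f C g = (\<Sum>D\<in>R. (\<lambda>x. f C (p D) * ind D x)) g"
      proof (cases "g \<in> carrier G")
        case True
        then obtain D where D: "D \<in> R" "g \<in> D" using Rcover by blast
        have "(\<Sum>D'\<in>R. f C (p D') * ind D' g) = (\<Sum>D'\<in>R. if D' = D then f C (p D) else 0)"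
          using D Rdisj by (intro sum.cong) (auto simp: ind_def)
        also have "\<dots> = f C (p D)" using D fin by (simp add: R_def)
        also have "\<dots> = f C g" using const Rclass D p by blast
        finally show ?thesis by (simp add: sum_fun_apply)
      next
        case False
        hence "ind D g = 0" if "D \<in> R" for D using Rsub(1)[OF that] by (auto simp: ind_def)
        thus ?thesis using False by (simp add: sum_fun_apply f_def)
      qed
    qed
    moreover have "(\<Sum>D\<in>R. (\<lambda>x. f C (p D) * ind D x)) \<in> V.span (ind ` R)"
      by (intro V.span_sum V.span_scale V.span_base imageI)
    ultimately show ?thesis by simp
  qed
  ultimately have 1: "finite (f ` F)" "card (f ` F) \<le> card (ind ` R)"
    using V.independent_span_bound[of "ind ` R" "f ` F"] fin by (auto simp: R_def)

  have inj_ind: "inj_on ind R"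
  proof (rule inj_onI)
    fix D D' assume D: "D \<in> R" "D' \<in> R" "ind D = ind D'"
    obtain g where "g \<in> D" using Rsub(2)[OF D(1)] by blast
    moreover have "ind D g = ind D' g" using D(3) by simp
    ultimately show "D = D'" using Rdisj[OF D(1,2)] by (auto simp: ind_def split: if_splits)
  qed
  have "V.independent (ind ` R)"
    unfolding V.independent_explicit_module
  proof (intro allI impI)
    fix t :: "('a \<Rightarrow> complex) set" and u v
    assume t: "finite t" "t \<subseteq> ind ` R" "(\<Sum>v\<in>t. (\<lambda>x. u v * v x)) = 0" "v \<in> t"
    obtain D where D: "D \<in> R" "v = ind D" using t(2,4) by blast
    obtain g where g: "g \<in> D" using Rsub(2)[OF D(1)] by blast
    have "(\<Sum>w\<in>t. u w * w g) = (\<Sum>w\<in>t. if w = v then u v else 0)"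
    proof (rule sum.cong[OF refl])
      fix w assume "w \<in> t"
      then obtain D' where D': "D' \<in> R" "w = ind D'" using t(2) by blast
      show "u w * w g = (if w = v then u v else 0)"
      proof (cases "D' = D")
        case True
        thus ?thesis using D D' g by (simp add: ind_def)
      next
        case False
        hence "g \<notin> D'" using Rdisj[OF D(1) D'(1) g] by blast
        hence "w g = 0" "v g = 1" using D D' g by (simp_all add: ind_def)
        thus ?thesis by auto
      qed
    qed
    moreover have "(\<Sum>w\<in>t. u w * w g) = 0"
      using arg_cong[OF t(3), of "\<lambda>F. F g"] by (simp add: sum_fun_apply)
    ultimately show "u v = 0" using t(1,4) by simp
  qed
  note ind_indep = this
  have ind_span: "ind D \<in> V.span (f ` F)" if D: "D \<in> R" for D
  proof -
    obtain d \<sigma> A\<^sub>0 where \<sigma>: "unitary_rep G d \<sigma>" "finite (\<sigma> ` carrier G)" "A\<^sub>0 \<in> carrier_mat d d"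
      and A0: "\<And>g. g \<in> carrier G \<Longrightarrow> mtr (A\<^sub>0 * \<sigma> g) = (if g \<in> D then 1 else 0)"
      using indicator_is_coefficient[OF Rsub(1)[OF D]] tr D by (auto simp: R_def)
    have tw: "mtr (A\<^sub>0 * \<sigma> (h \<otimes> g \<otimes> \<phi> (inv h))) = mtr (A\<^sub>0 * \<sigma> g)"
      if g: "g \<in> carrier G" and h: "h \<in> carrier G" for g h
    proof -
      have c: "h \<otimes> g \<otimes> \<phi> (inv h) \<in> carrier G" using g h \<phi>c by simp
      have "(g, h \<otimes> g \<otimes> \<phi> (inv h)) \<in> twisted_conj G \<phi>" using g h c by (auto simp: twisted_conj_def)
      moreover from this have "(h \<otimes> g \<otimes> \<phi> (inv h), g) \<in> twisted_conj G \<phi>"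
        using tw_equiv by (auto simp: equiv_def dest: symD)
      ultimately have "h \<otimes> g \<otimes> \<phi> (inv h) \<in> D \<longleftrightarrow> g \<in> D" using Rclosed[OF D] by blast
      thus ?thesis using A0 g c by simp
    qed
    obtain A where A: "intertwines A d \<sigma> d (\<sigma> \<circ> \<phi>)" "\<And>g. g \<in> carrier G \<Longrightarrow> mtr (A * \<sigma> g) = mtr (A\<^sub>0 * \<sigma> g)"
      using twisted_average[OF \<sigma>(1,2) hom \<sigma>(3) tw] by blast
    have "coefficient A \<sigma> \<in> V.span (f ` F)"
    proof (rule twisted_coefficient_decomposition[OF \<phi>c _ _ _ \<sigma>(1) A(1)])
      show "(\<lambda>g. 0) \<in> V.span (f ` F)" using V.span_zero by (simp add: zero_fun_def)
      show "(\<lambda>g. h g + h' g) \<in> V.span (f ` F)" if "h \<in> V.span (f ` F)" "h' \<in> V.span (f ` F)" for h h'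
        using V.span_add[OF that] by (simp add: plus_fun_def)
      fix k \<tau> B assume \<tau>: "irreducible_unitary_rep G k \<tau>" and B: "intertwines B k \<tau> k (\<tau> \<circ> \<phi>)"
      have Bd: "dim_row B = k" "dim_col B = k" using B by (auto simp: intertwines_def)
      note t = irreducibleD(1)[OF \<tau>]
      note td = unitary_rep_dim[OF t]
      show "coefficient B \<tau> \<in> V.span (f ` F)"
      proof (cases "B = 0\<^sub>m k k")
        case True
        have "coefficient B \<tau> = (\<lambda>g. 0)"
          using td by (auto simp: fun_eq_iff True mtr_def)
        thus ?thesis using V.span_zero by (simp add: zero_fun_def)
      next
        case False
        \<comment> \<open>\<open>\<tau>\<close> lies in a fixed class \<open>C\<close> but need not
          be its chosen representative \<open>\<rho> C\<close>. Transported along the equivalence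
          \<open>W\<close>, \<open>B\<close> becomes a twisted intertwiner of
          \<open>\<rho> C\<close>, and by Schur's lemma this is a multiple of
          \<open>U C\<close>.\<close>
        define C where "C = rep_equiv G `` {\<tau>}"
        have C: "C \<in> F" unfolding C_def F_def by (rule fixed_dual_classesI[OF \<phi> \<tau> B False])
        have "(\<tau>, \<rho> C) \<in> rep_equiv G" using rep[OF C] by (auto simp: C_def)
        then obtain W where kn: "n C = k" and W: "unitary_mat k W" "intertwines W k \<tau> k (\<rho> C)"
          using rep_equiv_iff[OF \<tau> irr[OF C]] by blast
        have Wd: "dim_row W = k" "dim_col W = k" and WW: "adj_mat W * W = 1\<^sub>m k"
          using W(1) by (auto simp: unitary_mat_def)
        have rC: "unitary_rep G k (\<rho> C)" using rr[OF C] kn by simp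
        note cd = unitary_rep_dim[OF rC]
        have UC: "unitary_mat k (U C)" "intertwines (U C) k (\<rho> C) k (\<rho> C \<circ> \<phi>)" using U[OF C] Ui[OF C] kn by auto
        have UCd: "dim_row (U C) = k" "dim_col (U C) = k" and UU: "U C * adj_mat (U C) = 1\<^sub>m k"
          using UC(1) by (auto simp: unitary_mat_def)
        note t\<phi> = irreducibleD(1)[OF irreducible_twist[OF \<tau> \<phi>]]
        have r\<phi>: "unitary_rep G k (\<rho> C \<circ> \<phi>)" using irreducibleD(1)[OF irreducible_twist[OF irr[OF C] \<phi>]] kn by simp
        define X where "X = W * (B * adj_mat W)"
        have Xd: "dim_row X = k" "dim_col X = k" by (auto simp: X_def Wd)
        have W\<phi>: "intertwines W k (\<tau> \<circ> \<phi>) k (\<rho> C \<circ> \<phi>)" using W(2) \<phi>c by (auto simp: intertwines_def)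
        have X: "intertwines X k (\<rho> C) k (\<rho> C \<circ> \<phi>)"
          unfolding X_def
          by (intro intertwines_mult[OF intertwines_mult[OF intertwines_adj[OF W(2) t rC] B rC t t\<phi>] W\<phi> rC t\<phi> r\<phi>])
        have "intertwines (adj_mat (U C) * X) k (\<rho> C) k (\<rho> C)"
          by (rule intertwines_mult[OF X intertwines_adj[OF UC(2) rC r\<phi>] rC r\<phi> rC])
        then obtain c where c: "adj_mat (U C) * X = c \<cdot>\<^sub>m 1\<^sub>m k"
          using schur_scalar irr[OF C] kn by blast
        have "X = (U C * adj_mat (U C)) * X" by (simp add: UU Xd)
        also have "\<dots> = c \<cdot>\<^sub>m U C" by (simp add: mat_assoc UCd Xd c mat_mult_smult_right)
        finally have Xc: "X = c \<cdot>\<^sub>m U C" .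
        have "coefficient B \<tau> = (\<lambda>g. c * f C g)"
        proof (rule ext)
          fix g
          show "coefficient B \<tau> g = c * f C g"
          proof (cases "g \<in> carrier G")
            case g: True
            have "mtr (B * \<tau> g) = mtr (B * (adj_mat W * (W * \<tau> g)))"
              by (simp add: mat_assoc[symmetric] Bd Wd td[OF g] WW)
            also have "W * \<tau> g = \<rho> C g * W" using W(2) g by (simp add: intertwines_def)
            also have "mtr (B * (adj_mat W * (\<rho> C g * W))) = mtr ((B * (adj_mat W * \<rho> C g)) * W)"
              by (simp add: mat_assoc Bd Wd cd[OF g])
            also have "\<dots> = mtr (W * (B * (adj_mat W * \<rho> C g)))"
              by (rule mtr_comm) (simp_all add: Bd Wd cd[OF g])
            also have "W * (B * (adj_mat W * \<rho> C g)) = X * \<rho> C g"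
              by (simp add: X_def mat_assoc Bd Wd cd[OF g])
            also have "mtr \<dots> = c * f C g"
              using g by (simp add: Xc f_def mat_mult_smult_left UCd cd[OF g] mtr_smult)
            finally show ?thesis using g by simp
          qed (simp add: f_def)
        qed
        moreover have "(\<lambda>g. c * f C g) \<in> V.span (f ` F)"
          using C by (intro V.span_scale V.span_base imageI)
        ultimately show ?thesis by simp
      qed
    qed
    also have "coefficient A \<sigma> = ind D"
      using A(2) A0 Rsub(1)[OF D] by (auto simp: fun_eq_iff ind_def)
    finally show ?thesis .
  qed
  have 2: "card (ind ` R) \<le> card (f ` F)"
    using V.independent_span_bound[OF 1(1) ind_indep image_subsetI[OF ind_span]] by blast
  have "finite F" using 1(1) inj_f by (rule finite_imageD)
  moreover have "card F = card R"
    using 1 2 card_image[OF inj_f] card_image[OF inj_ind] by simp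
  ultimately show ?thesis by (simp add: F_def R_def)
qed

end

section \<open>Automorphisms of the wreath product\<close>

definition vadd :: "int list \<Rightarrow> int list \<Rightarrow> int list" (infixl "+\<^sub>l" 65) where
  "x +\<^sub>l y = map2 (+) x y"
definition vsub :: "int list \<Rightarrow> int list \<Rightarrow> int list" (infixl "-\<^sub>l" 65) where
  "x -\<^sub>l y = map2 (-) x y"
definition vscale :: "int \<Rightarrow> int list \<Rightarrow> int list" (infixr "*\<^sub>l" 75) where
  "c *\<^sub>l x = map ((*) c) x"
abbreviation (input) vzero :: "nat \<Rightarrow> int list" where
  "vzero k \<equiv> replicate k 0"

lemma vec_length [simp]:
  "length (x +\<^sub>l y) = min (length x) (length y)"
  "length (x -\<^sub>l y) = min (length x) (length y)"
  "length (c *\<^sub>l x) = length x"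
  by (simp_all add: vadd_def vsub_def vscale_def)

lemma vec_nth [simp]:
  "i < length x \<Longrightarrow> i < length y \<Longrightarrow> (x +\<^sub>l y) ! i = x ! i + y ! i"
  "i < length x \<Longrightarrow> i < length y \<Longrightarrow> (x -\<^sub>l y) ! i = x ! i - y ! i"
  "i < length x \<Longrightarrow> (c *\<^sub>l x) ! i = c * x ! i"
  by (simp_all add: vadd_def vsub_def vscale_def)

lemma vec_eqI: "length x = k \<Longrightarrow> length y = k \<Longrightarrow> (\<And>i. i < k \<Longrightarrow> x ! i = y ! i) \<Longrightarrow> x = (y :: int list)"
  by (rule nth_equalityI) auto

lemma vadd_commute: "x +\<^sub>l y = y +\<^sub>l x"
  by (rule nth_equalityI) auto

lemma vec_assoc: "x +\<^sub>l (y +\<^sub>l z) = x +\<^sub>l y +\<^sub>l z" "x -\<^sub>l (y +\<^sub>l z) = x -\<^sub>l y -\<^sub>l z"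
  by (rule nth_equalityI; auto)+

lemma vzero_simps [simp]:
  "length x = k \<Longrightarrow> vzero k +\<^sub>l x = x" "length x = k \<Longrightarrow> x +\<^sub>l vzero k = x"
  "length x = k \<Longrightarrow> x -\<^sub>l vzero k = x" "x -\<^sub>l x = vzero (length x)"
  by (rule nth_equalityI; auto)+

lemma vec_cancel [simp]:
  "length x = length y \<Longrightarrow> x +\<^sub>l y -\<^sub>l y = x" "length x = length y \<Longrightarrow> x -\<^sub>l y +\<^sub>l y = x"
  "length x = length y \<Longrightarrow> x +\<^sub>l y -\<^sub>l x = y"
  by (rule nth_equalityI; auto)+

text \<open>The base group, with each residue represented by its least nonnegative value; its
  equations appear below as divisibility of differences by \<open>m\<close>.\<close>

definition fsupp :: "nat \<Rightarrow> nat \<Rightarrow> (int list \<Rightarrow> int) set" where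
  "fsupp m k = {a. finite {x. a x \<noteq> 0} \<and> (\<forall>x. a x \<noteq> 0 \<longrightarrow> length x = k) \<and> (\<forall>x. 0 \<le> a x \<and> a x < int m)}"

abbreviation (input) wr :: "nat \<Rightarrow> nat \<Rightarrow> ((int list \<Rightarrow> int) \<times> int list) monoid" where
  "wr \<equiv> wreath_Zm_Zk"

lemma wr_carrier_iff: "(a, y) \<in> carrier (wr m k) \<longleftrightarrow> a \<in> fsupp m k \<and> length y = k"
  by (auto simp: wreath_Zm_Zk_def wr_carrier_def fsupp_def)

lemma wr_one: "\<one>\<^bsub>wr m k\<^esub> = ((\<lambda>x. 0), vzero k)"
  by (simp add: wreath_Zm_Zk_def)

lemma wr_mult_eq: "(a, y) \<otimes>\<^bsub>wr m k\<^esub> (b, z) =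
    ((\<lambda>x. if length x = k then (a x + b (x -\<^sub>l y)) mod int m else 0), y +\<^sub>l z)"
  by (simp add: wreath_Zm_Zk_def wr_mult_def vadd_def vsub_def fun_eq_iff)

text \<open>Returns a function to the canonical form demanded by \<open>fsupp\<close>.\<close>

abbreviation (input) reduce :: "nat \<Rightarrow> nat \<Rightarrow> (int list \<Rightarrow> int) \<Rightarrow> int list \<Rightarrow> int" where
  "reduce m k f \<equiv> \<lambda>x. if length x = k then f x mod int m else 0"

lemma fsupp_zero [simp]: "m > 0 \<Longrightarrow> (\<lambda>x. 0) \<in> fsupp m k"
  by (simp add: fsupp_def)

lemma fsuppI:
  assumes "m > 0" "finite {x. length x = k \<and> f x \<noteq> 0}"
  shows "reduce m k f \<in> fsupp m k"
proof -
  have "{x. (if length x = k then f x mod int m else 0) \<noteq> 0} \<subseteq> {x. length x = k \<and> f x \<noteq> 0}"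
    by (auto split: if_splits)
  thus ?thesis using assms by (auto simp: fsupp_def finite_subset split: if_splits)
qed

lemma fsuppD:
  assumes "a \<in> fsupp m k"
  shows "finite {x. a x \<noteq> 0}" "length x \<noteq> k \<Longrightarrow> a x = 0" "0 \<le> a x" "a x < int m" "a x mod int m = a x"
  using assms by (auto simp: fsupp_def)

lemma finite_pullback:
  assumes "finite {x. b x \<noteq> (0::int)}" "inj_on f (zk k)"
  shows "finite {x. length x = k \<and> b (f x) \<noteq> 0}"
proof (rule finite_imageD)
  show "finite (f ` {x. length x = k \<and> b (f x) \<noteq> 0})"
    using assms(1) by (rule finite_subset[rotated]) auto
  show "inj_on f {x. length x = k \<and> b (f x) \<noteq> 0}"
    using assms(2) by (rule inj_on_subset) (auto simp: zk_def)
qed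

lemma finite_shift:
  assumes "finite {x. b x \<noteq> 0}" "length y = k"
  shows "finite {x. length x = k \<and> b (x -\<^sub>l y) \<noteq> (0::int)}" "finite {x. length x = k \<and> b (x +\<^sub>l y) \<noteq> (0::int)}"
proof -
  have "inj_on (\<lambda>x. x -\<^sub>l y) (zk k)" "inj_on (\<lambda>x. x +\<^sub>l y) (zk k)"
    using assms(2) by (auto simp: zk_def intro: inj_on_inverseI[where g = "\<lambda>x. x +\<^sub>l y"]
      inj_on_inverseI[where g = "\<lambda>x. x -\<^sub>l y"])
  thus "finite {x. length x = k \<and> b (x -\<^sub>l y) \<noteq> 0}" "finite {x. length x = k \<and> b (x +\<^sub>l y) \<noteq> 0}"
    using finite_pullback[OF assms(1)] by blast+
qed

lemma fsupp_mult:
  assumes "m > 0" "a \<in> fsupp m k" "b \<in> fsupp m k" "length y = k"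
  shows "reduce m k (\<lambda>x. a x + b (x -\<^sub>l y)) \<in> fsupp m k"
proof (rule fsuppI[OF assms(1)])
  have "{x. length x = k \<and> a x + b (x -\<^sub>l y) \<noteq> 0} \<subseteq> {x. a x \<noteq> 0} \<union> {x. length x = k \<and> b (x -\<^sub>l y) \<noteq> 0}" by auto
  thus "finite {x. length x = k \<and> a x + b (x -\<^sub>l y) \<noteq> 0}"
    by (rule finite_subset) (use fsuppD(1) finite_shift(1) assms in auto)
qed

lemma group_wr:
  assumes m: "m > 0"
  shows "group (wr m k)"
proof (rule groupI)
  let ?G = "wr m k"
  show "x \<otimes>\<^bsub>?G\<^esub> y \<in> carrier ?G" if "x \<in> carrier ?G" "y \<in> carrier ?G" for x y
    using that by (cases x; cases y) (auto simp: wr_carrier_iff wr_mult_eq fsupp_mult m)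
  show "\<one>\<^bsub>?G\<^esub> \<in> carrier ?G" using m by (simp add: wr_one wr_carrier_iff)
  show "x \<otimes>\<^bsub>?G\<^esub> y \<otimes>\<^bsub>?G\<^esub> z = x \<otimes>\<^bsub>?G\<^esub> (y \<otimes>\<^bsub>?G\<^esub> z)"
    if "x \<in> carrier ?G" "y \<in> carrier ?G" "z \<in> carrier ?G" for x y z
    using that by (cases x; cases y; cases z)
      (auto simp: wr_carrier_iff wr_mult_eq fun_eq_iff vec_assoc mod_simps add.assoc)
  show "\<one>\<^bsub>?G\<^esub> \<otimes>\<^bsub>?G\<^esub> x = x" if "x \<in> carrier ?G" for x
    using that by (cases x) (auto simp: wr_carrier_iff wr_mult_eq wr_one fun_eq_iff vec_assoc fsuppD)
  show "\<exists>y\<in>carrier ?G. y \<otimes>\<^bsub>?G\<^esub> x = \<one>\<^bsub>?G\<^esub>" if xc: "x \<in> carrier ?G" for x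
  proof -
    obtain b y where x: "x = (b, y)" "b \<in> fsupp m k" "length y = k" using xc by (cases x) (auto simp: wr_carrier_iff)
    \<comment> \<open>The inverse of \<open>(b, y)\<close> has top component \<open>- y\<close> and
      base component \<open>- b\<close> shifted back by \<open>y\<close>.\<close>
    let ?z = "vzero k -\<^sub>l y"
    let ?c = "reduce m k (\<lambda>x. - b (x +\<^sub>l y))"
    have "?c \<in> fsupp m k"
      using finite_shift(2)[OF fsuppD(1)[OF x(2)] x(3)] by (intro fsuppI m) simp
    moreover have "v -\<^sub>l ?z = v +\<^sub>l y" if "length v = k" for v
      using x that by (intro vec_eqI[of _ k]) auto
    moreover have "?z +\<^sub>l y = vzero k" using x by (intro vec_eqI[of _ k]) auto
    ultimately show ?thesis using x
      by (intro bexI[of _ "(?c, ?z)"]) (auto simp: wr_carrier_iff wr_mult_eq wr_one fun_eq_iff mod_simps)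
  qed
qed

lemma wr_pow:
  assumes m: "m > 0" and a: "a \<in> fsupp m k"
  shows "(a, vzero k) [^]\<^bsub>wr m k\<^esub> (n::nat) = (reduce m k (\<lambda>x. int n * a x), vzero k)"
proof -
  interpret group "wr m k" by (rule group_wr[OF m])
  show ?thesis
    by (induction n) (auto simp: wr_one wr_mult_eq fun_eq_iff vec_assoc mod_simps algebra_simps)
qed

lemma wr_snd_pow:
  assumes m: "m > 0" and g: "g \<in> carrier (wr m k)"
  shows "snd (g [^]\<^bsub>wr m k\<^esub> (n::nat)) = int n *\<^sub>l snd g"
proof -
  interpret group "wr m k" by (rule group_wr[OF m])
  obtain a y where x: "g = (a, y)" "length y = k" using g by (cases g) (auto simp: wr_carrier_iff)
  show ?thesis
  proof (induction n)
    case 0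
    show ?case using x by (auto simp: wr_one intro!: vec_eqI[of _ k])
  next
    case (Suc n)
    have "snd (g [^]\<^bsub>wr m k\<^esub> Suc n) = snd (g [^]\<^bsub>wr m k\<^esub> n) +\<^sub>l y"
      by (cases "g [^]\<^bsub>wr m k\<^esub> n") (simp add: x(1) wr_mult_eq)
    also have "\<dots> = int (Suc n) *\<^sub>l y"
      unfolding Suc by (rule vec_eqI[of _ k]) (use x in \<open>auto simp: algebra_simps\<close>)
    finally show ?case by (simp add: x)
  qed
qed

section \<open>Base and top parts of an automorphism\<close>

locale wreath_automorphism =
  fixes m k :: nat and \<phi> :: "(int list \<Rightarrow> int) \<times> int list \<Rightarrow> (int list \<Rightarrow> int) \<times> int list"
  assumes m: "m > 0" and \<phi>: "\<phi> \<in> iso (wr m k) (wr m k)"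
begin

sublocale group "wr m k" by (rule group_wr[OF m])

abbreviation (input) wr_times (infixl "\<star>" 70) where
  "g \<star> h \<equiv> g \<otimes>\<^bsub>wr m k\<^esub> h"

abbreviation (input) tw where
  "tw \<equiv> twisted_conj (wr m k) \<phi>"

definition base_map :: "(int list \<Rightarrow> int) \<Rightarrow> int list \<Rightarrow> int" where
  "base_map a = fst (\<phi> (a, vzero k))"

text \<open>The map M of the overview, computed at elements with zero base component; by
  \<open>\<phi>_snd\<close> the top component of \<open>\<phi> (a, y)\<close> is the same for every
  \<open>a\<close>.\<close>

definition top_map :: "int list \<Rightarrow> int list" where
  "top_map y = snd (\<phi> ((\<lambda>x. 0), y))"

lemma \<phi>_hom: "\<phi> \<in> hom (wr m k) (wr m k)" and \<phi>_bij: "bij_betw \<phi> (carrier (wr m k)) (carrier (wr m k))"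
  using \<phi> by (auto simp: iso_def)

lemma \<phi>_surj: "h \<in> carrier (wr m k) \<Longrightarrow> \<exists>g\<in>carrier (wr m k). \<phi> g = h"
proof -
  assume "h \<in> carrier (wr m k)"
  hence "h \<in> \<phi> ` carrier (wr m k)" by (simp only: bij_betw_imp_surj_on[OF \<phi>_bij])
  thus ?thesis by (auto simp only: image_iff)
qed

lemma \<phi>_inj: "g \<in> carrier (wr m k) \<Longrightarrow> h \<in> carrier (wr m k) \<Longrightarrow> \<phi> g = \<phi> h \<Longrightarrow> g = h"
  using bij_betw_imp_inj_on[OF \<phi>_bij] unfolding inj_on_def by blast

lemma \<phi>_closed: "g \<in> carrier (wr m k) \<Longrightarrow> \<phi> g \<in> carrier (wr m k)"
  using \<phi>_hom by (auto simp: hom_def)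

lemma \<phi>_mult: "g \<in> carrier (wr m k) \<Longrightarrow> h \<in> carrier (wr m k) \<Longrightarrow>
   \<phi> (g \<star> h) = \<phi> g \<star> \<phi> h"
  using \<phi>_hom by (auto simp: hom_def)

lemma \<phi>_one: "\<phi> \<one>\<^bsub>wr m k\<^esub> = \<one>\<^bsub>wr m k\<^esub>"
  using hom_one[OF \<phi>_hom] is_group by simp

lemma \<phi>_pow: "g \<in> carrier (wr m k) \<Longrightarrow> \<phi> (g [^]\<^bsub>wr m k\<^esub> (n::nat)) = \<phi> g [^]\<^bsub>wr m k\<^esub> n"
  using hom_nat_pow[OF \<phi>_hom] is_group by simp

lemma base_pow_m: "a \<in> fsupp m k \<Longrightarrow> (a, vzero k) [^]\<^bsub>wr m k\<^esub> m = \<one>\<^bsub>wr m k\<^esub>"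
  by (simp add: wr_pow[OF m] wr_one fun_eq_iff)

text \<open>Z^k is torsion free. The base group is thus the set of elements of exponent
  \<open>m\<close>, which makes it invariant under \<open>\<phi>\<close> and its inverse.\<close>

lemma torsion_snd:
  assumes "g \<in> carrier (wr m k)" "g [^]\<^bsub>wr m k\<^esub> m = \<one>\<^bsub>wr m k\<^esub>"
  shows "snd g = vzero k"
proof -
  have l: "length (snd g) = k" using assms(1) by (cases g) (auto simp: wr_carrier_iff)
  have "int m *\<^sub>l snd g = vzero k" using wr_snd_pow[OF m assms(1), of m] assms(2) by (simp add: wr_one)
  hence "\<And>i. i < k \<Longrightarrow> int m * snd g ! i = 0" using l by (metis nth_replicate vec_nth(3))
  thus ?thesis using m l by (intro vec_eqI[of _ k]) auto
qed

lemma \<phi>_base: "a \<in> fsupp m k \<Longrightarrow> \<phi> (a, vzero k) = (base_map a, vzero k)"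
proof -
  assume a: "a \<in> fsupp m k"
  hence c: "(a, vzero k) \<in> carrier (wr m k)" by (simp add: wr_carrier_iff)
  have "snd (\<phi> (a, vzero k)) = vzero k"
    using base_pow_m[OF a] \<phi>_pow[OF c, of m] by (intro torsion_snd \<phi>_closed c) (simp add: \<phi>_one)
  thus ?thesis by (simp add: base_map_def prod_eq_iff)
qed

lemma base_map_zero: "base_map (\<lambda>x. 0) = (\<lambda>x. 0)"
  using \<phi>_one by (simp add: base_map_def wr_one)

lemma base_map_closed: "a \<in> fsupp m k \<Longrightarrow> base_map a \<in> fsupp m k"
  using \<phi>_closed[of "(a, vzero k)"] \<phi>_base[of a] by (simp add: wr_carrier_iff)

lemma top_map_length [simp]: "length y = k \<Longrightarrow> length (top_map y) = k"
  using \<phi>_closed[of "((\<lambda>x. 0), y)"] m by (cases "\<phi> ((\<lambda>x. 0), y)") (auto simp: wr_carrier_iff top_map_def)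

lemma base_map_add:
  assumes a: "a \<in> fsupp m k" and b: "b \<in> fsupp m k"
  shows "base_map (reduce m k (\<lambda>x. a x + b x))
    = reduce m k (\<lambda>x. base_map a x + base_map b x)"
proof -
  have s: "reduce m k (\<lambda>x. a x + b (x -\<^sub>l vzero k))
      = reduce m k (\<lambda>x. a x + b x)" for a b
    by (auto simp: fun_eq_iff vec_assoc)
  have "\<phi> ((a, vzero k) \<star> (b, vzero k)) = \<phi> (a, vzero k) \<star> \<phi> (b, vzero k)"
    using a b by (intro \<phi>_mult) (auto simp: wr_carrier_iff)
  hence "\<phi> (reduce m k (\<lambda>x. a x + b x), vzero k)
     = (reduce m k (\<lambda>x. base_map a x + base_map b x), vzero k)"
    by (simp add: \<phi>_base a b wr_mult_eq s vec_assoc)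
  thus ?thesis by (simp add: base_map_def)
qed

lemma \<phi>_snd:
  assumes "a \<in> fsupp m k" "length y = k"
  shows "snd (\<phi> (a, y)) = top_map y"
proof -
  have e: "(a, y) = (a, vzero k) \<star> ((\<lambda>x. 0), y)"
    using assms by (auto simp: wr_mult_eq fun_eq_iff vec_assoc fsuppD)
  have "\<phi> (a, y) = (base_map a, vzero k) \<star> \<phi> ((\<lambda>x. 0), y)"
    unfolding e by (subst \<phi>_mult) (use assms m in \<open>auto simp: wr_carrier_iff \<phi>_base\<close>)
  moreover obtain d where "\<phi> ((\<lambda>x. 0), y) = (d, top_map y)" by (auto simp: top_map_def prod_eq_iff)
  ultimately show ?thesis using assms by (simp add: wr_mult_eq)
qed

lemma top_map_add:
  assumes "length y = k" "length z = k"
  shows "top_map (y +\<^sub>l z) = top_map y +\<^sub>l top_map z"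
proof -
  have "((\<lambda>x. 0), y +\<^sub>l z) = ((\<lambda>x. 0), y) \<star> ((\<lambda>x. 0), z)"
    by (auto simp: wr_mult_eq fun_eq_iff)
  hence "\<phi> ((\<lambda>x. 0), y +\<^sub>l z) = \<phi> ((\<lambda>x. 0), y) \<star> \<phi> ((\<lambda>x. 0), z)"
    using assms m by (simp only:) (intro \<phi>_mult, auto simp: wr_carrier_iff)
  thus ?thesis unfolding top_map_def
    by (cases "\<phi> ((\<lambda>x. 0), y)"; cases "\<phi> ((\<lambda>x. 0), z)") (simp add: wr_mult_eq)
qed

text \<open>Apply \<open>\<phi>\<close> to the relation saying that the element with zero base and
  top \<open>y\<close> acts on the base by a shift. The unknown base component \<open>d\<close> of
  its image cancels, the base group being abelian.\<close>

lemma base_map_shift: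
  assumes a: "a \<in> fsupp m k" and y: "length y = k" and x: "length x = k"
  shows "base_map (\<lambda>x. if length x = k then a (x -\<^sub>l y) else 0) x = base_map a (x -\<^sub>l top_map y)"
proof -
  let ?s = "\<lambda>x. if length x = k then a (x -\<^sub>l y) else 0"
  have "?s = reduce m k (\<lambda>x. 0 + a (x -\<^sub>l y))"
    using fsuppD(5)[OF a] by (auto simp: fun_eq_iff)
  also have "\<dots> \<in> fsupp m k" using fsupp_mult[OF m fsupp_zero[OF m] a y] by simp
  finally have s: "?s \<in> fsupp m k" .
  have c: "((\<lambda>x. 0), y) \<in> carrier (wr m k)" "(a, vzero k) \<in> carrier (wr m k)" "(?s, vzero k) \<in> carrier (wr m k)"
    using a y s m by (auto simp: wr_carrier_iff)
  have e: "((\<lambda>x. 0), y) \<star> (a, vzero k) = (?s, vzero k) \<star> ((\<lambda>x. 0), y)"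
    using fsuppD(5)[OF a] y by (auto simp: wr_mult_eq fun_eq_iff vec_assoc)
  obtain d where d: "\<phi> ((\<lambda>x. 0), y) = (d, top_map y)" by (auto simp: top_map_def prod_eq_iff)
  have "(d, top_map y) \<star> (base_map a, vzero k) = (base_map ?s, vzero k) \<star> (d, top_map y)"
    using arg_cong[OF e, of \<phi>] by (simp add: \<phi>_mult c d \<phi>_base a s)
  hence "(d x + base_map a (x -\<^sub>l top_map y)) mod int m = (base_map ?s x + d x) mod int m"
    using x by (auto simp: wr_mult_eq vec_assoc dest!: fun_cong[of _ _ x])
  hence "(base_map ?s x) mod int m = base_map a (x -\<^sub>l top_map y) mod int m"
    by (simp add: mod_eq_dvd_iff dvd_diff_commute)
  thus ?thesis using fsuppD(5)[OF base_map_closed] a s by simp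
qed

text \<open>The preimage of a base element has exponent \<open>m\<close> by injectivity of
  \<open>\<phi>\<close>, hence lies in the base.\<close>

lemma base_map_surj:
  assumes b: "b \<in> fsupp m k"
  shows "\<exists>a\<in>fsupp m k. base_map a = b"
proof -
  have bc: "(b, vzero k) \<in> carrier (wr m k)" using b by (simp add: wr_carrier_iff)
  then obtain g where g: "g \<in> carrier (wr m k)" "\<phi> g = (b, vzero k)"
    using \<phi>_surj by blast
  have "\<phi> (g [^]\<^bsub>wr m k\<^esub> m) = \<phi> \<one>\<^bsub>wr m k\<^esub>"
    using g base_pow_m[OF b] by (simp add: \<phi>_pow \<phi>_one)
  hence "g [^]\<^bsub>wr m k\<^esub> m = \<one>\<^bsub>wr m k\<^esub>"
    by (rule \<phi>_inj[OF nat_pow_closed[OF g(1)] one_closed])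
  hence s: "snd g = vzero k" by (rule torsion_snd[OF g(1)])
  obtain a where "g = (a, vzero k)" using s by (cases g) auto
  thus ?thesis using g by (intro bexI[of _ a]) (auto simp: wr_carrier_iff base_map_def)
qed

text \<open>For injectivity: if \<open>top_map\<close> kills a difference, \<open>\<phi>\<close>
  sends the corresponding element into the base group, whose elements already have preimages in the
  base.\<close>

lemma top_map_bij: "bij_betw top_map (zk k) (zk k)"
proof (rule bij_betwI')
  show "top_map y \<in> zk k" if "y \<in> zk k" for y using that by (simp add: zk_def)
  show "\<exists>x\<in>zk k. y = top_map x" if "y \<in> zk k" for y
  proof -
    have "((\<lambda>x. 0), y) \<in> carrier (wr m k)" using that m by (simp add: wr_carrier_iff zk_def)
    then obtain a x where "(a, x) \<in> carrier (wr m k)" "\<phi> (a, x) = ((\<lambda>x. 0), y)"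
      using \<phi>_surj by (metis surj_pair)
    thus ?thesis using \<phi>_snd[of a x] by (intro bexI[of _ x]) (auto simp: wr_carrier_iff zk_def)
  qed
  fix x y assume xy: "x \<in> zk k" "y \<in> zk k"
  show "top_map x = top_map y \<longleftrightarrow> x = y"
  proof
    assume e: "top_map x = top_map y"
    have l: "length x = k" "length y = k" using xy by (auto simp: zk_def)
    have "top_map (x -\<^sub>l y) +\<^sub>l top_map y = top_map y"
      using l e by (subst top_map_add[symmetric]) (auto simp: vec_assoc)
    hence t: "top_map (x -\<^sub>l y) = vzero k"
      using vec_cancel(1)[of "top_map (x -\<^sub>l y)" "top_map y"] l by simp
    obtain b where b: "\<phi> ((\<lambda>x. 0), x -\<^sub>l y) = (b, vzero k)" using t by (auto simp: top_map_def prod_eq_iff)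
    have c: "((\<lambda>x. 0), x -\<^sub>l y) \<in> carrier (wr m k)" using l m by (simp add: wr_carrier_iff)
    have "b \<in> fsupp m k" using \<phi>_closed[OF c] b by (simp add: wr_carrier_iff)
    then obtain a where a: "a \<in> fsupp m k" "base_map a = b" using base_map_surj by blast
    have "\<phi> (a, vzero k) = \<phi> ((\<lambda>x. 0), x -\<^sub>l y)" using a b by (simp add: \<phi>_base)
    moreover have "(a, vzero k) \<in> carrier (wr m k)" using a by (simp add: wr_carrier_iff)
    ultimately have "(a, vzero k) = ((\<lambda>x. 0), x -\<^sub>l y)" using \<phi>_inj[OF _ c, of "(a, vzero k)"] by simp
    hence "x -\<^sub>l y = vzero k" by simp
    hence "(x -\<^sub>l y) +\<^sub>l y = vzero k +\<^sub>l y" by simp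
    thus "x = y" using l by (simp add: vec_assoc)
  qed simp
qed

end

section \<open>Endomorphisms of lattices and units of group rings\<close>

definition additive_on :: "nat \<Rightarrow> (int list \<Rightarrow> int list) \<Rightarrow> bool" where
  "additive_on k A \<longleftrightarrow> (\<forall>x\<in>zk k. A x \<in> zk k) \<and> (\<forall>x\<in>zk k. \<forall>y\<in>zk k. A (x +\<^sub>l y) = A x +\<^sub>l A y)"

lemma additive_onD:
  assumes "additive_on k A"
  shows "length x = k \<Longrightarrow> length (A x) = k"
    "length x = k \<Longrightarrow> length y = k \<Longrightarrow> A (x +\<^sub>l y) = A x +\<^sub>l A y"
  using assms by (auto simp: additive_on_def zk_def)

lemma additive_on_zero:
  assumes A: "additive_on k A"
  shows "A (vzero k) = vzero k"
proof -
  have "A (vzero k) = A (vzero k) +\<^sub>l A (vzero k)"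
    using additive_onD(2)[OF A, of "vzero k" "vzero k"] by simp
  hence "A (vzero k) -\<^sub>l A (vzero k) = (A (vzero k) +\<^sub>l A (vzero k)) -\<^sub>l A (vzero k)" by simp
  thus ?thesis using additive_onD(1)[OF A, of "vzero k"] by simp
qed

lemma additive_on_scale:
  assumes A: "additive_on k A" and x: "length x = k"
  shows "A (c *\<^sub>l x) = c *\<^sub>l A x"
proof -
  note l = additive_onD(1)[OF A]
  have nat: "A (int n *\<^sub>l x) = int n *\<^sub>l A x" for n
  proof (induction n)
    case 0
    have "0 *\<^sub>l y = vzero (length y)" for y by (rule nth_equalityI) auto
    thus ?case using additive_on_zero[OF A] x l[OF x] by simp
  next
    case (Suc n)
    have "int (Suc n) *\<^sub>l y = int n *\<^sub>l y +\<^sub>l y" for y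
      by (rule nth_equalityI) (auto simp: algebra_simps)
    thus ?case using Suc x by (simp add: additive_onD(2)[OF A])
  qed
  show ?thesis
  proof (cases "c \<ge> 0")
    case True
    thus ?thesis using nat[of "nat c"] by simp
  next
    case False
    define n where "n = nat (- c)"
    have c: "c = - int n" using False by (simp add: n_def)
    have "A (c *\<^sub>l x) +\<^sub>l A (int n *\<^sub>l x) = vzero k"
    proof -
      have "c *\<^sub>l x +\<^sub>l int n *\<^sub>l x = vzero k" using x by (auto simp: c intro!: vec_eqI[of _ k])
      thus ?thesis using x additive_on_zero[OF A] by (simp add: additive_onD(2)[OF A, symmetric])
    qed
    hence e: "A (c *\<^sub>l x) +\<^sub>l int n *\<^sub>l A x = vzero k" by (simp add: nat)
    show ?thesis
    proof (rule vec_eqI[of _ k])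
      fix i assume i: "i < k"
      have "(A (c *\<^sub>l x) +\<^sub>l int n *\<^sub>l A x) ! i = vzero k ! i" by (simp only: e)
      thus "A (c *\<^sub>l x) ! i = (c *\<^sub>l A x) ! i" using i x l[OF x] l[of "c *\<^sub>l x"] by (simp add: c)
    qed (use x l in simp_all)
  qed
qed

text \<open>Modulo \<open>q = 1 + N * j\<close> the number \<open>N\<close> is invertible, so
  \<open>A\<close> is onto, hence injective, on the finite set of residue vectors. A kernel vector
  is therefore divisible by arbitrarily large \<open>q\<close>. This takes the place of a
  determinant argument.\<close>

lemma finite_index_imp_injective:
  assumes A: "additive_on k A" and N: "N > 0"
    and img: "\<And>v. length v = k \<Longrightarrow> \<exists>x. length x = k \<and> A x = int N *\<^sub>l v"
    and z: "length z = k" "A z = vzero k"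
  shows "z = vzero k"
proof -
  note l = additive_onD(1)[OF A]
  have dvd: "int (1 + N * j) dvd z ! i" if i: "i < k" for i j
  proof -
    define q where "q = 1 + int N * int j"
    have q: "q > 0" by (simp add: q_def add_pos_nonneg)
    define V where "V = {v :: int list. set v \<subseteq> {0..<q} \<and> length v = k}"
    have finV: "finite V" unfolding V_def by (rule finite_lists_length_eq) simp
    define f where "f = (\<lambda>v. map (\<lambda>t. t mod q) (A v))"
    have f_mod: "f (map (\<lambda>t. t mod q) x) = map (\<lambda>t. t mod q) (A x)" if x: "length x = k" for x
    proof -
      let ?r = "map (\<lambda>t. t mod q) x" and ?d = "map (\<lambda>t. t div q) x"
      have "x = ?r +\<^sub>l q *\<^sub>l ?d" using x by (auto intro!: vec_eqI[of _ k])
      hence "A x = A (?r +\<^sub>l q *\<^sub>l ?d)" by (rule arg_cong)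
      also have "\<dots> = A ?r +\<^sub>l q *\<^sub>l A ?d"
        using x by (simp add: additive_onD(2)[OF A] additive_on_scale[OF A])
      finally have "A x = A ?r +\<^sub>l q *\<^sub>l A ?d" .
      moreover have "length (A ?r) = k" "length (A ?d) = k" using x l by simp_all
      ultimately show ?thesis by (simp add: f_def) (auto intro!: vec_eqI[of _ k])
    qed
    have V_mod: "map (\<lambda>t. t mod q) x \<in> V" if "length x = k" for x
      using that q by (auto simp: V_def)
    have "V \<subseteq> f ` V"
    proof
      fix u assume u: "u \<in> V"
      hence ul: "length u = k" by (simp add: V_def)
      \<comment> \<open>\<open>- j\<close> inverts \<open>N\<close> modulo \<open>q\<close>, since
        \<open>N * (- j) = 1 - q\<close>.\<close>
      obtain x where x: "length x = k" "A x = int N *\<^sub>l (- int j) *\<^sub>l u"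
        using img[of "(- int j) *\<^sub>l u"] ul by auto
      have "map (\<lambda>t. t mod q) (A x) = u"
      proof (rule vec_eqI[of _ k])
        fix i assume i: "i < k"
        hence "u ! i \<in> set u" using ul by simp
        hence ui: "u ! i \<in> {0..<q}" using u by (auto simp: V_def)
        have "int N * (- int j * u ! i) = u ! i + q * (- u ! i)" by (simp add: q_def algebra_simps)
        hence "map (\<lambda>t. t mod q) (A x) ! i = (u ! i + q * (- u ! i)) mod q" using i ul by (simp add: x)
        also have "\<dots> = u ! i" using ui by (simp only: mod_mult_self2) simp
        finally show "map (\<lambda>t. t mod q) (A x) ! i = u ! i" .
      qed (use x ul in auto)
      thus "u \<in> f ` V" using f_mod[OF x(1)] V_mod[OF x(1)] by (metis imageI)
    qed
    hence inj: "inj_on f V" using finV by (metis card_image_le card_mono eq_card_imp_inj_on finite_imageI le_antisym)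
    have z0: "map (\<lambda>t. t mod q) (vzero k) = vzero k" by simp
    have "f (map (\<lambda>t. t mod q) z) = f (map (\<lambda>t. t mod q) (vzero k))"
      by (subst (1 2) f_mod) (use z additive_on_zero[OF A] in auto)
    hence "map (\<lambda>t. t mod q) z = vzero k"
      using inj V_mod[OF z(1)] V_mod[of "vzero k"] z0 by (metis inj_onD length_replicate)
    hence "map (\<lambda>t. t mod q) z ! i = vzero k ! i" by simp
    thus ?thesis using i z by (simp add: q_def mod_eq_0_iff_dvd)
  qed
  show ?thesis
  proof (rule vec_eqI[of _ k])
    fix i assume i: "i < k"
    \<comment> \<open>Taking \<open>j\<close> to be the absolute value of the entry makes the
      modulus exceed it.\<close>
    have "int (1 + N * nat \<bar>z ! i\<bar>) dvd z ! i" by (rule dvd[OF i])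
    moreover have "\<bar>z ! i\<bar> < int (1 + N * nat \<bar>z ! i\<bar>)" using N by (simp add: int_nat_eq) (smt (verit) mult_le_cancel_right1 of_nat_0_less_iff)
    ultimately have "z ! i = 0" using zdvd_not_zless[of "\<bar>z ! i\<bar>"] by (metis abs_dvd_iff dvd_abs_iff zero_less_abs_iff)
    thus "z ! i = vzero k ! i" using i by simp
  qed (use z in auto)
qed

section \<open>A translation-invariant order and units modulo a prime\<close>

lemma vadd_less_mono:
  assumes "length x = length y" "length z = length x" "x < y"
  shows "z +\<^sub>l x < z +\<^sub>l y"
  using assms
proof (induction x y arbitrary: z rule: list_induct2)
  case (Cons a x b y)
  then obtain c w where "z = c # w" "length w = length x" by (cases z) auto
  thus ?case using Cons by (auto simp: vadd_def)
qed auto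

text \<open>Enlarging either summand strictly enlarges the sum, so the extremal sum of two finite
  supports is attained by one pair only.\<close>

lemma vadd_extremal:
  assumes "s \<in> zk k" "q \<in> zk k" "s' \<in> zk k" "q' \<in> zk k" "s \<le> s'" "q \<le> q'" "s +\<^sub>l q = s' +\<^sub>l q'"
  shows "s = s' \<and> q = q'"
proof -
  have l: "length s = k" "length q = k" "length s' = k" "length q' = k" using assms by (auto simp: zk_def)
  have "q = q'"
  proof (rule ccontr)
    assume "q \<noteq> q'"
    hence "s +\<^sub>l q < s +\<^sub>l q'" using assms l by (intro vadd_less_mono) auto
    also have "s +\<^sub>l q' \<le> s' +\<^sub>l q'"
      using vadd_less_mono[of s s' q'] l assms(5) by (cases "s = s'") (auto simp: vadd_commute[of _ q'] less_imp_le)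
    finally show False using assms by simp
  qed
  moreover from this have "s = s'" using assms(7) l by (metis vec_cancel(1))
  ultimately show ?thesis by simp
qed

text \<open>A Laurent polynomial which divides a nonzero constant over a field is a monomial: compare
  the extremal terms with respect to a translation invariant linear order on the exponents.\<close>

lemma prime_unit_is_monomial:
  fixes P a :: "int list \<Rightarrow> int" and M :: "int list \<Rightarrow> int list"
  assumes p: "prime p" and finP: "finite {x \<in> zk k. \<not> p dvd P x}"
    and U: "finite U" "U \<subseteq> zk k" and M: "inj_on M (zk k)" "\<And>u. u \<in> zk k \<Longrightarrow> M u \<in> zk k"
    and unit: "\<And>x. x \<in> zk k \<Longrightarrow> p dvd (\<Sum>u\<in>U. a u * P (x -\<^sub>l M u)) - (if x = vzero k then 1 else 0)"
  obtains x0 where "x0 \<in> zk k" "\<not> p dvd P x0" "\<And>x. x \<in> zk k \<Longrightarrow> x \<noteq> x0 \<Longrightarrow> p dvd P x"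
proof -
  define S where "S = {x \<in> zk k. \<not> p dvd P x}"
  define U' where "U' = {u \<in> U. \<not> p dvd a u}"
  \<comment> \<open>The support modulo \<open>p\<close> of the cofactor, whose exponents are the
    \<open>M u\<close>; injectivity of \<open>M\<close> keeps its terms distinct.\<close>
  define Q where "Q = M ` U'"
  have U'z: "u \<in> zk k" if "u \<in> U" for u using that U(2) by blast
  have Qz: "q \<in> zk k" if "q \<in> Q" for q using that M(2) U(2) by (auto simp: Q_def U'_def)
  have Sz: "s \<in> zk k" if "s \<in> S" for s using that by (simp add: S_def)
  have p1: "\<not> p dvd (1::int)" using p not_prime_unit by blast
  \<comment> \<open>The constant coefficient of the product is 1 modulo \<open>p\<close>, so neither
    support is empty.\<close>
  have *: "\<exists>u\<in>U. \<not> p dvd a u * P (vzero k -\<^sub>l M u)"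
  proof (rule ccontr)
    assume "\<not> (\<exists>u\<in>U. \<not> p dvd a u * P (vzero k -\<^sub>l M u))"
    hence "p dvd (\<Sum>u\<in>U. a u * P (vzero k -\<^sub>l M u))" by (intro dvd_sum) auto
    moreover have "p dvd (\<Sum>u\<in>U. a u * P (vzero k -\<^sub>l M u)) - 1" using unit[of "vzero k"] by (simp add: zk_def)
    ultimately have "p dvd (\<Sum>u\<in>U. a u * P (vzero k -\<^sub>l M u)) - ((\<Sum>u\<in>U. a u * P (vzero k -\<^sub>l M u)) - 1)" by (rule dvd_diff)
    thus False using p1 by simp
  qed
  then obtain u0 where u0: "u0 \<in> U" "\<not> p dvd a u0" "\<not> p dvd P (vzero k -\<^sub>l M u0)"
    by (metis dvd_mult dvd_mult2)
  have "length (M u0) = k" using M(2)[OF U'z[OF u0(1)]] by (simp add: zk_def)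
  hence "vzero k -\<^sub>l M u0 \<in> S" "M u0 \<in> Q" using u0 by (auto simp: S_def Q_def U'_def zk_def)
  hence ne: "S \<noteq> {}" "Q \<noteq> {}" by auto
  have fin: "finite S" "finite Q" using finP U by (auto simp: S_def Q_def U'_def)
  \<comment> \<open>An exponent arising from only one pair of terms has nonzero coefficient modulo
    the prime \<open>p\<close>, so it belongs to the constant term.\<close>
  have extremal: "s +\<^sub>l q = vzero k"
    if s: "s \<in> S" and q: "q \<in> Q" and uniq: "\<And>s' q'. s' \<in> S \<Longrightarrow> q' \<in> Q \<Longrightarrow> s' +\<^sub>l q' = s +\<^sub>l q \<Longrightarrow> q' = q" for s q
  proof (rule ccontr)
    assume nz: "s +\<^sub>l q \<noteq> vzero k"
    obtain u where u: "u \<in> U" "\<not> p dvd a u" "q = M u" using q by (auto simp: Q_def U'_def)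
    let ?x = "s +\<^sub>l q"
    have l: "length s = k" "length q = k" using Sz[OF s] Qz[OF q] by (auto simp: zk_def)
    have other: "p dvd a u' * P (?x -\<^sub>l M u')" if u': "u' \<in> U - {u}" for u'
    proof (rule ccontr)
      assume c: "\<not> p dvd a u' * P (?x -\<^sub>l M u')"
      have l': "length (M u') = k" using M(2) u' U'z by (auto simp: zk_def)
      have "M u' \<in> Q" using c u' by (auto simp: Q_def U'_def)
      moreover have "?x -\<^sub>l M u' \<in> S" using c l l' by (auto simp: S_def zk_def)
      moreover have "(?x -\<^sub>l M u') +\<^sub>l M u' = ?x" using l l' by simp
      ultimately have "M u' = M u" using uniq u(3) by metis
      thus False using M(1) u u' U'z by (auto dest: inj_onD)
    qed
    have "(\<Sum>u\<in>U. a u * P (?x -\<^sub>l M u)) = a u * P (?x -\<^sub>l M u) + (\<Sum>u'\<in>U - {u}. a u' * P (?x -\<^sub>l M u'))"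
      using U(1) u(1) by (rule sum.remove)
    moreover have "p dvd (\<Sum>u'\<in>U - {u}. a u' * P (?x -\<^sub>l M u'))" by (intro dvd_sum other)
    moreover have "p dvd (\<Sum>u\<in>U. a u * P (?x -\<^sub>l M u))" using unit[of ?x] nz l by (simp add: zk_def)
    ultimately have "p dvd a u * P (?x -\<^sub>l M u)" by (simp add: dvd_add_left_iff)
    moreover have "?x -\<^sub>l M u = s" using l u(3) by simp
    ultimately have "p dvd a u \<or> p dvd P s" using p by (simp add: prime_dvd_mult_iff)
    thus False using u s by (auto simp: S_def)
  qed
  have max: "Max S +\<^sub>l Max Q = vzero k"
  proof (rule extremal)
    show mem: "Max S \<in> S" "Max Q \<in> Q" using fin ne by auto
    fix s' q' assume "s' \<in> S" "q' \<in> Q" "s' +\<^sub>l q' = Max S +\<^sub>l Max Q"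
    thus "q' = Max Q" using vadd_extremal[of s' k q' "Max S" "Max Q"] fin mem Sz Qz by simp
  qed
  have min: "Min S +\<^sub>l Min Q = vzero k"
  proof (rule extremal)
    show mem: "Min S \<in> S" "Min Q \<in> Q" using fin ne by auto
    fix s' q' assume "s' \<in> S" "q' \<in> Q" "s' +\<^sub>l q' = Min S +\<^sub>l Min Q"
    thus "q' = Min Q" using vadd_extremal[of "Min S" k "Min Q" s' q'] fin mem Sz Qz by simp
  qed
  \<comment> \<open>The smallest and the largest pair both sum to zero, so they coincide and the
    support is a single point.\<close>
  have eq: "Min S = Max S"
    using vadd_extremal[of "Min S" k "Min Q" "Max S" "Max Q"] max min fin ne Sz Qz Max_in Min_in
    by (metis Min_le)
  have only: "x = Max S" if "x \<in> S" for x
    using fin(1) that eq by (metis Max_ge Min_le antisym)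
  show ?thesis
  proof (rule that)
    show "Max S \<in> zk k" "\<not> p dvd P (Max S)" using Max_in[OF fin(1) ne(1)] by (auto simp: S_def)
    show "p dvd P x" if "x \<in> zk k" "x \<noteq> Max S" for x using only that by (auto simp: S_def)
  qed
qed

section \<open>Twisted coboundaries modulo a prime, and dilations\<close>

definition vdelta :: "int list \<Rightarrow> int list \<Rightarrow> int" where
  "vdelta x u = (if u = x then 1 else 0)"

text \<open>The image modulo \<open>p\<close> of 1 - L, where L sends \<open>vdelta x\<close> to
  \<open>c\<close> times \<open>vdelta (T x)\<close>. Evaluation at \<open>T u\<close> avoids the
  inverse of \<open>T\<close>.\<close>

definition coboundaries :: "nat \<Rightarrow> int \<Rightarrow> int \<Rightarrow> (int list \<Rightarrow> int list) \<Rightarrow> (int list \<Rightarrow> int) set" where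
  "coboundaries k p c T = {a. \<exists>b. finite {u \<in> zk k. b u \<noteq> 0} \<and> (\<forall>u\<in>zk k. p dvd a (T u) - b (T u) + c * b u)}"

lemma additive_on_diff:
  assumes A: "additive_on k A" and x: "length x = k" "length y = k"
  shows "A (x -\<^sub>l y) = A x -\<^sub>l A y"
proof -
  have e: "u -\<^sub>l v = u +\<^sub>l (-1) *\<^sub>l v" for u v by (rule nth_equalityI) auto
  show ?thesis unfolding e using x by (simp add: additive_onD(2)[OF A] additive_on_scale[OF A])
qed

text \<open>The dilation with centre w/N and factor 1 + jN, written so that only integers occur
  although the centre may be non-integral.\<close>

definition dilation :: "nat \<Rightarrow> int list \<Rightarrow> nat \<Rightarrow> int list \<Rightarrow> int list" where
  "dilation N w j x = x +\<^sub>l int j *\<^sub>l (int N *\<^sub>l x -\<^sub>l w)"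

lemma dilation_length [simp]: "length w = k \<Longrightarrow> length x = k \<Longrightarrow> length (dilation N w j x) = k"
  by (simp add: dilation_def)

lemma dilation_nth:
  "length w = k \<Longrightarrow> length x = k \<Longrightarrow> i < k \<Longrightarrow> dilation N w j x ! i = x ! i + int j * (int N * x ! i - w ! i)"
  by (simp add: dilation_def)

lemma dilation_scaled_nth:
  assumes "length w = k" "length x = k" "i < k"
  shows "int N * dilation N w j x ! i - w ! i = (1 + int j * int N) * (int N * x ! i - w ! i)"
  using assms by (simp add: dilation_nth algebra_simps)

lemma dilation_inj:
  assumes "length w = k"
  shows "inj_on (dilation N w j) (zk k)"
proof (rule inj_onI)
  fix x y assume xy: "x \<in> zk k" "y \<in> zk k" "dilation N w j x = dilation N w j y"
  hence l: "length x = k" "length y = k" by (auto simp: zk_def)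
  show "x = y"
  proof (rule vec_eqI[OF l])
    fix i assume i: "i < k"
    have "dilation N w j x ! i = dilation N w j y ! i" using xy by simp
    hence "(1 + int j * int N) * (x ! i - y ! i) = 0"
      using i l assms by (simp add: dilation_nth algebra_simps)
    moreover have "1 + int j * int N > 0" by (simp add: add_pos_nonneg)
    ultimately show "x ! i = y ! i" by simp
  qed
qed

text \<open>The premise on \<open>w\<close> says that w/N is a fixed point of the affine map, and
  linear maps commute with scalars.\<close>

lemma dilation_commute:
  assumes M: "additive_on k M" and l: "length v = k" "length w = k" "length x = k"
    and w: "w -\<^sub>l M w = int N *\<^sub>l v"
  shows "M (dilation N w j x) +\<^sub>l v = dilation N w j (M x +\<^sub>l v)"
proof (rule vec_eqI[of _ k])
  note Ml = additive_onD(1)[OF M]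
  fix i assume i: "i < k"
  have "(w -\<^sub>l M w) ! i = (int N *\<^sub>l v) ! i" by (simp only: w)
  hence wi: "w ! i = M w ! i + int N * v ! i" using i l Ml by simp
  have "M (dilation N w j x) = M x +\<^sub>l int j *\<^sub>l (int N *\<^sub>l M x -\<^sub>l M w)"
    unfolding dilation_def using l
    by (simp add: additive_onD(2)[OF M] additive_on_scale[OF M] additive_on_diff[OF M])
  thus "(M (dilation N w j x) +\<^sub>l v) ! i = dilation N w j (M x +\<^sub>l v) ! i"
    using i l Ml wi by (simp add: dilation_def algebra_simps)
qed (use l additive_onD(1)[OF M] in simp_all)

lemma coboundaries_cong:
  assumes "\<And>u. u \<in> zk k \<Longrightarrow> T u \<in> zk k" "\<And>u. u \<in> zk k \<Longrightarrow> a u = a' u" "a \<in> coboundaries k p c T"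
  shows "a' \<in> coboundaries k p c T"
proof -
  obtain b where b: "finite {u \<in> zk k. b u \<noteq> 0}" "\<forall>u\<in>zk k. p dvd a (T u) - b (T u) + c * b u"
    using assms(3) by (auto simp: coboundaries_def)
  have "\<forall>u\<in>zk k. p dvd a' (T u) - b (T u) + c * b u" using b(2) assms(1,2) by simp
  with b(1) show ?thesis unfolding coboundaries_def by blast
qed

text \<open>The witness \<open>b\<close> is pulled back along with \<open>a\<close>; its support
  stays finite because the dilation is injective.\<close>

lemma coboundaries_dilation:
  assumes w: "length w = k"
    and comm: "\<And>u. u \<in> zk k \<Longrightarrow> T (dilation N w j u) = dilation N w j (T u)"
    and a: "a \<in> coboundaries k p c T"
  shows "(\<lambda>u. a (dilation N w j u)) \<in> coboundaries k p c T"
proof -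
  let ?H = "dilation N w j"
  have Hz: "?H u \<in> zk k" if "u \<in> zk k" for u using that w by (simp add: zk_def)
  obtain b where b: "finite {u \<in> zk k. b u \<noteq> 0}" "\<forall>u\<in>zk k. p dvd a (T u) - b (T u) + c * b u"
    using a by (auto simp: coboundaries_def)
  have "inj_on ?H {u \<in> zk k. b (?H u) \<noteq> 0}" using dilation_inj[OF w] by (rule inj_on_subset) auto
  moreover have "?H ` {u \<in> zk k. b (?H u) \<noteq> 0} \<subseteq> {u \<in> zk k. b u \<noteq> 0}" using Hz by auto
  ultimately have "finite {u \<in> zk k. b (?H u) \<noteq> 0}" using b(1) by (meson finite_imageD finite_subset)
  moreover have "\<forall>u\<in>zk k. p dvd a (?H (T u)) - b (?H (T u)) + c * b (?H u)"
    using b(2) Hz by (auto simp flip: comm)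
  ultimately show ?thesis unfolding coboundaries_def by (intro CollectI exI[of _ "\<lambda>u. b (?H u)"]) simp
qed

text \<open>Finite index forces two of the points \<open>dilation N w j x\<close> to give the same class.  As the
  dilations commute with the affine map \<open>T\<close>, pulling back along one of them isolates the class of
  \<open>x\<close> itself.  The only exception is the fixed point of \<open>T\<close>, and there the augmentation decides.\<close>

lemma affine_coboundaries_full:
  fixes p c :: int
  assumes p: "prime p" and k: "k \<ge> 1" and M: "additive_on k M" and l: "length v = k" "length w = k"
    and N: "N > 0" and w: "w -\<^sub>l M w = int N *\<^sub>l v"
    and T: "T = (\<lambda>u. M u +\<^sub>l v)" and bij: "bij_betw T (zk k) (zk k)"
    and pig: "\<And>X :: nat \<Rightarrow> int list. (\<And>j. X j \<in> zk k) \<Longrightarrow>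
      \<exists>J. infinite J \<and> (\<forall>i\<in>J. \<forall>j\<in>J. (\<lambda>u. vdelta (X i) u - vdelta (X j) u) \<in> coboundaries k p c T)"
    and x: "x \<in> zk k"
  shows "vdelta x \<in> coboundaries k p c T"
proof -
  let ?I = "coboundaries k p c T"
  have Ml: "length u = k \<Longrightarrow> length (M u) = k" for u using additive_onD(1)[OF M] .
  have Tz: "T u \<in> zk k" if "u \<in> zk k" for u using that bij by (auto simp: bij_betw_def)
  have Tinj: "T u = T u' \<longleftrightarrow> u = u'" if "u \<in> zk k" "u' \<in> zk k" for u u'
    using that bij by (auto simp: bij_betw_def inj_on_def)
  have comm: "T (dilation N w j u) = dilation N w j (T u)" if "u \<in> zk k" for j u
    using that dilation_commute[OF M l _ w] by (simp add: T zk_def)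
  \<comment> \<open>Points other than the centre w/N move under the dilations, in a coordinate
    \<open>i\<^sub>0\<close> where the scaled distance \<open>D\<close> is nonzero.\<close>
  have generic: "vdelta x \<in> ?I" if x: "x \<in> zk k" and ne: "int N *\<^sub>l x \<noteq> w" for x
  proof -
    have xl: "length x = k" using x by (simp add: zk_def)
    obtain i\<^sub>0 where i0: "i\<^sub>0 < k" "int N * x ! i\<^sub>0 \<noteq> w ! i\<^sub>0"
      using ne vec_eqI[of "int N *\<^sub>l x" k w] xl l by auto
    define D where "D = int N * x ! i\<^sub>0 - w ! i\<^sub>0"
    have D: "D \<noteq> 0" using i0 by (simp add: D_def)
    define X where "X = (\<lambda>j. dilation N w j x)"
    have Xz: "X j \<in> zk k" for j using xl l by (simp add: X_def zk_def)
    obtain J where J: "infinite J" "\<And>i j. i \<in> J \<Longrightarrow> j \<in> J \<Longrightarrow> (\<lambda>u. vdelta (X i) u - vdelta (X j) u) \<in> ?I"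
      using pig[of X] Xz by blast
    have "J \<noteq> {}" using J(1) by auto
    then obtain i where i: "i \<in> J" by blast
    \<comment> \<open>So large a \<open>j\<close> prevents 1 + jN from dividing
      \<open>(1 + int i * int N) * D\<close>. Hence \<open>X i\<close> is not in the image of
      \<open>?H\<close>, whereas \<open>X j\<close> is the image of \<open>x\<close> alone.\<close>
    obtain j where j: "j \<in> J" "j > nat \<bar>(1 + int i * int N) * D\<bar>"
      using J(1) by (meson infinite_nat_iff_unbounded)
    let ?H = "dilation N w j"
    have "(\<lambda>u. vdelta (X j) (?H u) - vdelta (X i) (?H u)) \<in> ?I"
      by (rule coboundaries_dilation[OF l(2) comm J(2)[OF j(1) i]])
    thus ?thesis
    proof (rule coboundaries_cong[OF Tz, rotated 2])
      fix u assume u: "u \<in> zk k"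
      hence ul: "length u = k" by (simp add: zk_def)
      have "?H u = X j \<longleftrightarrow> u = x" using dilation_inj[OF l(2)] u x by (auto simp: X_def inj_on_def)
      moreover have "?H u \<noteq> X i"
      proof
        assume "?H u = X i"
        hence "int N * ?H u ! i\<^sub>0 - w ! i\<^sub>0 = int N * X i ! i\<^sub>0 - w ! i\<^sub>0" by simp
        hence e: "(1 + int j * int N) * (int N * u ! i\<^sub>0 - w ! i\<^sub>0) = (1 + int i * int N) * D"
          unfolding X_def using i0 ul xl l by (simp only: dilation_scaled_nth D_def)
        have "1 + int i * int N > 0" by (simp add: add_pos_nonneg)
        hence nz: "(1 + int i * int N) * D \<noteq> 0" using D by simp
        have "(1 + int j * int N) dvd (1 + int i * int N) * D" unfolding e[symmetric] by simp
        hence "\<bar>1 + int j * int N\<bar> \<le> \<bar>(1 + int i * int N) * D\<bar>" using nz by (rule dvd_imp_le_int[rotated])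
        moreover have "\<bar>(1 + int i * int N) * D\<bar> < int j" using j(2) by linarith
        moreover have "int j * 1 \<le> int j * int N" using N by (intro mult_left_mono) auto
        ultimately show False by linarith
      qed
      ultimately show "vdelta (X j) (?H u) - vdelta (X i) (?H u) = vdelta x u" by (auto simp: vdelta_def)
    qed
  qed
  show ?thesis
  proof (cases "int N *\<^sub>l x = w")
    case False
    thus ?thesis using generic x by blast
  next
    case True
    have xl: "length x = k" using x by (simp add: zk_def)
    have Tx: "T x = x"
    proof (rule vec_eqI[of _ k])
      fix i assume i: "i < k"
      have "(w -\<^sub>l M w) ! i = (int N *\<^sub>l v) ! i" by (simp only: w)
      moreover have "M w = int N *\<^sub>l M x" using xl by (simp add: True[symmetric] additive_on_scale[OF M])
      moreover have "w ! i = int N * x ! i" using xl i by (simp add: True[symmetric])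
      ultimately have "int N * (M x ! i + v ! i) = int N * x ! i" using i l Ml[OF xl] by (simp add: algebra_simps)
      thus "T x ! i = x ! i" using N i l Ml[OF xl] by (simp add: T)
    qed (use xl l Ml in \<open>auto simp: T\<close>)
    show ?thesis
    proof (cases "p dvd 1 - c")
      case False
      hence "coprime p (1 - c)" using p by (simp add: prime_imp_coprime)
      \<comment> \<open>\<open>t\<close> inverts \<open>1 - c\<close> modulo \<open>p\<close>; as
        \<open>T\<close> fixes \<open>x\<close>, the function \<open>t * vdelta x u\<close> of
        \<open>u\<close> is a witness.\<close>
      then obtain s t where st: "s * p + t * (1 - c) = 1" using bezout_int[of p "1 - c"] by auto
      have "p dvd vdelta x (T u) - t * vdelta x (T u) + c * (t * vdelta x u)" if u: "u \<in> zk k" for u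
      proof -
        have "vdelta x (T u) = vdelta x u" using Tinj[OF u x] Tx by (simp add: vdelta_def)
        hence "vdelta x (T u) - t * vdelta x (T u) + c * (t * vdelta x u) = vdelta x u * (1 - t * (1 - c))"
          by (simp add: algebra_simps)
        also have "1 - t * (1 - c) = p * s" using st by (simp add: algebra_simps)
        finally show ?thesis by simp
      qed
      moreover have "finite {u \<in> zk k. t * vdelta x u \<noteq> 0}"
        by (rule finite_subset[of _ "{x}"]) (auto simp: vdelta_def)
      ultimately show ?thesis unfolding coboundaries_def by (intro CollectI exI[of _ "\<lambda>u. t * vdelta x u"]) simp
    next
      case pc: True
      \<comment> \<open>When \<open>p\<close> divides \<open>1 - c\<close>, a finitely supported
        coboundary has coefficient sum divisible by \<open>p\<close>. The neighbour
        \<open>x'\<close> is not the centre, so its delta function, of sum 1, would be a coboundary: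
        the case is contradictory.\<close>
      define x' where "x' = x[0 := x ! 0 + 1]"
      have x': "x' \<in> zk k" using xl by (simp add: x'_def zk_def)
      have "(int N *\<^sub>l x') ! 0 \<noteq> (int N *\<^sub>l x) ! 0" using k xl N by (simp add: x'_def)
      hence "int N *\<^sub>l x' \<noteq> w" using True by auto
      from generic[OF x' this] obtain b where b: "finite {u \<in> zk k. b u \<noteq> 0}"
        and bd: "\<And>u. u \<in> zk k \<Longrightarrow> p dvd vdelta x' (T u) - b (T u) + c * b u"
        by (auto simp: coboundaries_def)
      \<comment> \<open>\<open>E\<close> contains the supports of \<open>b\<close> and of
        \<open>vdelta x'\<close>. Summing over its union with its preimage \<open>E'\<close> allows
        the terms in \<open>T u\<close> to be reindexed.\<close>
      define E where "E = {u \<in> zk k. b u \<noteq> 0} \<union> {x'}"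
      define E' where "E' = {u \<in> zk k. T u \<in> E}"
      have E: "finite E" "E \<subseteq> zk k" using b x' by (auto simp: E_def)
      have TE': "bij_betw T E' E"
        using bij E(2) by (auto simp: bij_betw_def E'_def inj_on_def)
      have E': "finite E'" using bij_betw_finite[OF TE'] E by simp
      have "p dvd (\<Sum>u\<in>E' \<union> E. vdelta x' (T u) - b (T u) + c * b u)"
        using bd E(2) by (intro dvd_sum) (auto simp: E'_def)
      also have "(\<Sum>u\<in>E' \<union> E. vdelta x' (T u) - b (T u) + c * b u)
         = (\<Sum>u\<in>E' \<union> E. vdelta x' (T u) - b (T u)) + c * (\<Sum>u\<in>E' \<union> E. b u)"
        by (simp add: sum.distrib sum_distrib_left)
      also have "(\<Sum>u\<in>E' \<union> E. vdelta x' (T u) - b (T u)) = (\<Sum>u\<in>E'. vdelta x' (T u) - b (T u))"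
        using E E' Tz by (intro sum.mono_neutral_right) (auto simp: E'_def E_def vdelta_def)
      also have "\<dots> = (\<Sum>u\<in>E. vdelta x' u - b u)"
        by (rule sum.reindex_bij_betw[OF TE'])
      also have "\<dots> = 1 - (\<Sum>u\<in>E. b u)"
        using E by (simp add: sum_subtractf vdelta_def) (simp add: E_def)
      also have "(\<Sum>u\<in>E' \<union> E. b u) = (\<Sum>u\<in>E. b u)"
        using E E' by (intro sum.mono_neutral_right) (auto simp: E'_def E_def)
      also have "1 - (\<Sum>u\<in>E. b u) + c * (\<Sum>u\<in>E. b u) = 1 - (1 - c) * (\<Sum>u\<in>E. b u)"
        by (simp add: algebra_simps)
      finally have "p dvd 1 - (1 - c) * (\<Sum>u\<in>E. b u)" .
      moreover have "p dvd (1 - c) * (\<Sum>u\<in>E. b u)" using pc by simp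
      ultimately have "p dvd (1 - (1 - c) * (\<Sum>u\<in>E. b u)) + (1 - c) * (\<Sum>u\<in>E. b u)" by (rule dvd_add)
      hence "p dvd 1" by simp
      thus ?thesis using p not_prime_unit by blast
    qed
  qed
qed

text \<open>Witnesses add up, so it is enough to treat delta functions.\<close>

lemma coboundaries_sum:
  assumes fin: "finite S" and "\<And>x. x \<in> S \<Longrightarrow> vdelta x \<in> coboundaries k p c T"
  shows "(\<lambda>u. \<Sum>x\<in>S. d x * vdelta x u) \<in> coboundaries k p c T"
proof -
  have "\<forall>x\<in>S. \<exists>b. finite {u \<in> zk k. b u \<noteq> 0} \<and> (\<forall>u\<in>zk k. p dvd vdelta x (T u) - b (T u) + c * b u)"
    using assms(2) unfolding coboundaries_def by simp
  from bchoice[OF this] obtain b where bS: "\<forall>x\<in>S. finite {u \<in> zk k. b x u \<noteq> 0} \<and>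
    (\<forall>u\<in>zk k. p dvd vdelta x (T u) - b x (T u) + c * b x u)" by (rule exE)
  note b = conjunct1[OF bspec[OF bS]] bspec[OF conjunct2[OF bspec[OF bS]]]
  have "{u \<in> zk k. (\<Sum>x\<in>S. d x * b x u) \<noteq> 0} \<subseteq> (\<Union>x\<in>S. {u \<in> zk k. b x u \<noteq> 0})"
    by (auto dest: sum.not_neutral_contains_not_neutral)
  hence "finite {u \<in> zk k. (\<Sum>x\<in>S. d x * b x u) \<noteq> 0}" using fin b(1) by (auto intro: finite_subset)
  moreover have "p dvd (\<Sum>x\<in>S. d x * vdelta x (T u)) - (\<Sum>x\<in>S. d x * b x (T u)) + c * (\<Sum>x\<in>S. d x * b x u)"
    if u: "u \<in> zk k" for u
  proof -
    have "(\<Sum>x\<in>S. d x * vdelta x (T u)) - (\<Sum>x\<in>S. d x * b x (T u)) + c * (\<Sum>x\<in>S. d x * b x u)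
      = (\<Sum>x\<in>S. d x * (vdelta x (T u) - b x (T u) + c * b x u))"
      by (simp add: sum_subtractf sum.distrib sum_distrib_left algebra_simps)
    also have "p dvd \<dots>" using b(2) u by (intro dvd_sum dvd_mult) auto
    finally show ?thesis .
  qed
  ultimately show ?thesis unfolding coboundaries_def
    by (intro CollectI exI[of _ "\<lambda>u. \<Sum>x\<in>S. d x * b x u"]) simp
qed

section \<open>Reidemeister classes of the wreath product\<close>

context wreath_automorphism
begin

lemma additive_top_map: "additive_on k top_map"
  by (auto simp: additive_on_def zk_def top_map_add)

lemma vdelta_fsupp: "m > 1 \<Longrightarrow> length v = k \<Longrightarrow> vdelta v \<in> fsupp m k"
  by (auto simp: fsupp_def vdelta_def)

text \<open>By \<open>base_map_add\<close> and \<open>base_map_shift\<close>,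
  \<open>base_map\<close> is semilinear over the group ring, so it is convolution with the image of
  \<open>vdelta (vzero k)\<close> after moving exponents by \<open>top_map\<close>. The induction
  removes one support point at a time.\<close>

lemma base_map_coefficient:
  assumes U: "finite U" "U \<subseteq> zk k" and m1: "m > 1"
    and a: "a \<in> fsupp m k" "\<And>x. a x \<noteq> 0 \<Longrightarrow> x \<in> U" and x: "x \<in> zk k"
  shows "int m dvd base_map a x - (\<Sum>u\<in>U. a u * base_map (vdelta (vzero k)) (x -\<^sub>l top_map u))"
  using U a
proof (induction U arbitrary: a rule: finite_induct)
  case empty
  have "a = (\<lambda>x. 0)" using empty by auto
  thus ?case by (simp add: base_map_zero)
next
  case (insert u U)
  let ?P = "base_map (vdelta (vzero k))"
  have xl: "length x = k" using x by (simp add: zk_def)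
  have u: "length u = k" using insert.prems by (simp add: zk_def)
  define b where "b = a(u := 0)"
  have b: "b \<in> fsupp m k"
  proof -
    have "{x. b x \<noteq> 0} \<subseteq> {x. a x \<noteq> 0}" by (auto simp: b_def)
    thus ?thesis using insert.prems(2) by (auto simp: fsupp_def b_def finite_subset)
  qed
  note d0 = vdelta_fsupp[OF m1]
  have shift: "base_map (vdelta u) x = ?P (x -\<^sub>l top_map u)"
  proof -
    have "vdelta u = (\<lambda>x. if length x = k then vdelta (vzero k) (x -\<^sub>l u) else 0)"
    proof
      fix z
      have "z -\<^sub>l u = vzero k \<longleftrightarrow> z = u" if "length z = k"
        using that u by (metis vec_cancel(2) vzero_simps(1,4))
      thus "vdelta u z = (if length z = k then vdelta (vzero k) (z -\<^sub>l u) else 0)"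
        using u by (auto simp: vdelta_def)
    qed
    thus ?thesis using base_map_shift[OF d0 u xl, of "vzero k"] by simp
  qed
  \<comment> \<open>The coefficient at \<open>u\<close> is built by repeated addition;
    \<open>n < m\<close> keeps each multiple a canonical residue.\<close>
  have multiple: "(\<lambda>z. int n * vdelta u z) \<in> fsupp m k \<and>
      int m dvd base_map (\<lambda>z. int n * vdelta u z) x - int n * base_map (vdelta u) x" if "n < m" for n
    using that
  proof (induction n)
    case 0
    show ?case using m by (simp add: base_map_zero)
  next
    case (Suc n)
    hence IH: "(\<lambda>z. int n * vdelta u z) \<in> fsupp m k"
      "int m dvd base_map (\<lambda>z. int n * vdelta u z) x - int n * base_map (vdelta u) x" by auto
    have e: "(\<lambda>z. int (Suc n) * vdelta u z) = reduce m k (\<lambda>z. int n * vdelta u z + vdelta u z)"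
      using Suc.prems u by (auto simp: vdelta_def fun_eq_iff)
    have "reduce m k (\<lambda>z. int n * vdelta u z + vdelta u z) \<in> fsupp m k"
    proof (rule fsuppI[OF m])
      show "finite {z. length z = k \<and> int n * vdelta u z + vdelta u z \<noteq> 0}"
        by (rule finite_subset[of _ "{u}"]) (auto simp: vdelta_def)
    qed
    moreover have "base_map (\<lambda>z. int (Suc n) * vdelta u z) x = (base_map (\<lambda>z. int n * vdelta u z) x + base_map (vdelta u) x) mod int m"
      unfolding e using base_map_add[OF IH(1) d0[OF u]] xl by (simp add: fun_eq_iff)
    moreover have "int m dvd (y + z) mod int m - int (Suc n) * z" if "int m dvd y - int n * z" for y z
      using that by (simp add: mod_eq_dvd_iff[symmetric] algebra_simps mod_simps) (metis add.commute mod_add_right_eq)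
    ultimately show ?case using IH(2) e by simp
  qed
  define n where "n = nat (a u)"
  have n: "int n = a u" "n < m" using fsuppD(3,4)[OF insert.prems(2), of u] by (auto simp: n_def)
  have ae: "a = reduce m k (\<lambda>z. b z + int n * vdelta u z)"
    using fsuppD(2,5)[OF insert.prems(2)] by (auto simp: b_def vdelta_def n fun_eq_iff)
  have "base_map a x = (base_map b x + base_map (\<lambda>z. int n * vdelta u z) x) mod int m"
    using multiple[OF n(2)] xl by (subst ae) (simp add: base_map_add[OF b])
  hence 1: "int m dvd base_map a x - (base_map b x + base_map (\<lambda>z. int n * vdelta u z) x)"
    by (simp add: mod_eq_dvd_iff[symmetric])
  have 2: "int m dvd base_map (\<lambda>z. int n * vdelta u z) x - a u * ?P (x -\<^sub>l top_map u)"
    using multiple[OF n(2)] by (simp add: n shift)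
  have 3: "int m dvd base_map b x - (\<Sum>v\<in>U. b v * ?P (x -\<^sub>l top_map v))"
  proof (rule insert.IH[OF _ b])
    show "U \<subseteq> zk k" using insert.prems(1) by simp
    show "x \<in> U" if "b x \<noteq> 0" for x using that insert.prems(3)[of x] by (auto simp: b_def split: if_splits)
  qed
  have "(\<Sum>v\<in>U. b v * ?P (x -\<^sub>l top_map v)) = (\<Sum>v\<in>U. a v * ?P (x -\<^sub>l top_map v))"
    using insert.hyps by (intro sum.cong) (auto simp: b_def)
  hence "base_map a x - (\<Sum>v\<in>insert u U. a v * ?P (x -\<^sub>l top_map v))
     = (base_map a x - (base_map b x + base_map (\<lambda>z. int n * vdelta u z) x))
       + (base_map (\<lambda>z. int n * vdelta u z) x - a u * ?P (x -\<^sub>l top_map u))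
       + (base_map b x - (\<Sum>v\<in>U. b v * ?P (x -\<^sub>l top_map v)))"
    using insert.hyps by simp
  with dvd_add[OF dvd_add[OF 1 2] 3] show ?case by (simp only:)
qed

text \<open>Some \<open>a\<close> maps to \<open>vdelta (vzero k)\<close>, and the convolution
  formula then exhibits the image of \<open>vdelta (vzero k)\<close> as a unit modulo
  \<open>p\<close>, hence as a monomial of exponent \<open>x0\<close> and coefficient
  \<open>c\<close>. At \<open>top_map u +\<^sub>l x0\<close> only the term of \<open>u\<close>
  survives.\<close>

lemma base_map_monomial:
  assumes p: "prime p" "p dvd m"
  obtains c x0 where "x0 \<in> zk k"
    "\<And>b u. b \<in> fsupp m k \<Longrightarrow> u \<in> zk k \<Longrightarrow> int p dvd base_map b (top_map u +\<^sub>l x0) - c * b u"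
proof -
  have m1: "m > 1" using p m prime_gt_1_nat[of p] dvd_imp_le[of p m] by auto
  have pm: "int p dvd int m" using p by simp
  have pp: "prime (int p)" using p by simp
  let ?P = "base_map (vdelta (vzero k))"
  have d: "vdelta (vzero k) \<in> fsupp m k" by (rule vdelta_fsupp[OF m1]) simp
  have Minj: "inj_on top_map (zk k)" using top_map_bij by (simp add: bij_betw_def)
  obtain a where a: "a \<in> fsupp m k" "base_map a = vdelta (vzero k)" using base_map_surj[OF d] by blast
  define U where "U = {u. a u \<noteq> 0}"
  have U: "finite U" "U \<subseteq> zk k" using a(1) by (auto simp: U_def fsupp_def zk_def)
  obtain x0 where x0: "x0 \<in> zk k" "\<not> int p dvd ?P x0" "\<And>x. x \<in> zk k \<Longrightarrow> x \<noteq> x0 \<Longrightarrow> int p dvd ?P x"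
  proof (rule prime_unit_is_monomial[OF pp _ U Minj])
    show "finite {x \<in> zk k. \<not> int p dvd ?P x}"
      by (rule finite_subset[OF _ fsuppD(1)[OF base_map_closed[OF d]]]) auto
    show "top_map u \<in> zk k" if "u \<in> zk k" for u using that by (simp add: zk_def)
    fix x assume x: "x \<in> zk k"
    have "int m dvd base_map a x - (\<Sum>u\<in>U. a u * ?P (x -\<^sub>l top_map u))"
      by (rule base_map_coefficient[OF U m1 a(1) _ x]) (simp add: U_def)
    hence "int p dvd base_map a x - (\<Sum>u\<in>U. a u * ?P (x -\<^sub>l top_map u))" using pm by (rule dvd_trans[rotated])
    thus "int p dvd (\<Sum>u\<in>U. a u * ?P (x -\<^sub>l top_map u)) - (if x = vzero k then 1 else 0)"
      by (simp add: a(2) vdelta_def dvd_diff_commute)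
  qed blast
  have x0l: "length x0 = k" using x0(1) by (simp add: zk_def)
  show ?thesis
  proof (rule that[OF x0(1), of "?P x0"])
    fix b u assume b: "b \<in> fsupp m k" and u: "u \<in> zk k"
    let ?x = "top_map u +\<^sub>l x0"
    have ul: "length u = k" using u by (simp add: zk_def)
    define V where "V = insert u {x. b x \<noteq> 0}"
    have V: "finite V" "V \<subseteq> zk k" using b u by (auto simp: V_def fsupp_def zk_def)
    have "int m dvd base_map b ?x - (\<Sum>v\<in>V. b v * ?P (?x -\<^sub>l top_map v))"
      by (rule base_map_coefficient[OF V m1 b]) (use ul x0l in \<open>auto simp: V_def zk_def\<close>)
    hence 1: "int p dvd base_map b ?x - (\<Sum>v\<in>V. b v * ?P (?x -\<^sub>l top_map v))" using pm by (rule dvd_trans[rotated])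
    have "(\<Sum>v\<in>V. b v * ?P (?x -\<^sub>l top_map v)) = b u * ?P (?x -\<^sub>l top_map u) + (\<Sum>v\<in>V - {u}. b v * ?P (?x -\<^sub>l top_map v))"
      using V(1) by (intro sum.remove) (auto simp: V_def)
    moreover have "?x -\<^sub>l top_map u = x0" using ul x0l by simp
    moreover have "int p dvd (\<Sum>v\<in>V - {u}. b v * ?P (?x -\<^sub>l top_map v))"
    proof (rule dvd_sum, rule dvd_mult, rule x0(3))
      fix v assume v: "v \<in> V - {u}"
      have vl: "length v = k" using v V(2) by (auto simp: zk_def)
      show "?x -\<^sub>l top_map v \<in> zk k" using ul vl x0l by (simp add: zk_def)
      show "?x -\<^sub>l top_map v \<noteq> x0"
      proof
        assume "?x -\<^sub>l top_map v = x0"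
        hence "x0 +\<^sub>l top_map v = x0 +\<^sub>l top_map u"
          using vec_cancel(2)[of ?x "top_map v"] ul vl x0l by (simp add: vadd_commute)
        hence "top_map v = top_map u" using vec_cancel(3)[of x0] ul vl x0l by (metis top_map_length)
        thus False using Minj v u V(2) by (auto dest: inj_onD)
      qed
    qed
    ultimately have "int p dvd (\<Sum>v\<in>V. b v * ?P (?x -\<^sub>l top_map v)) - ?P x0 * b u"
      by (simp add: mult.commute)
    from dvd_add[OF 1 this] show "int p dvd base_map b ?x - ?P x0 * b u" by simp
  qed
qed

end

section \<open>Consequences of finitely many Reidemeister classes\<close>

locale finite_reidemeister = wreath_automorphism +
  assumes finite_classes: "finite (reidemeister_classes (wr m k) \<phi>)" and k: "k \<ge> 1"
begin

lemmas tw_iff = twisted_conj_iff[OF \<phi>_hom]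
lemmas tw_equiv = equiv_twisted_conj[OF \<phi>_hom]

lemma class_finite: "finite ((\<lambda>g. tw `` {g}) ` carrier (wr m k))"
  using finite_classes by (auto simp: reidemeister_classes_def quotient_def intro: finite_subset[rotated])

text \<open>An infinite \<open>J\<close>, rather than one pair, lets the dilation argument choose a
  partner of arbitrarily large index.\<close>

lemma twisted_pigeonhole:
  fixes g :: "nat \<Rightarrow> _"
  assumes g: "\<And>j. g j \<in> carrier (wr m k)"
  obtains J where "infinite J" "\<And>i j. i \<in> J \<Longrightarrow> j \<in> J \<Longrightarrow> (g i, g j) \<in> tw"
proof -
  let ?f = "\<lambda>j. tw `` {g j}"
  have "finite (range ?f)" using class_finite by (rule finite_subset[rotated]) (use g in auto)
  then obtain a where a: "infinite {j. ?f j = ?f a}"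
    using pigeonhole_infinite[of UNIV ?f] by auto
  show ?thesis
  proof (rule that[OF a])
    fix i j assume "i \<in> {j. ?f j = ?f a}" "j \<in> {j. ?f j = ?f a}"
    thus "(g i, g j) \<in> tw"
      using eq_equiv_class[OF _ tw_equiv g, of "g i" j] by simp
  qed
qed

lemma twisted_top:
  assumes "((a, y), (a', y')) \<in> tw"
  obtains b z where "b \<in> fsupp m k" "length z = k" "y' +\<^sub>l top_map z = z +\<^sub>l y"
    "(a', y') \<star> \<phi> (b, z) = (b, z) \<star> (a, y)"
proof -
  obtain h where h: "h \<in> carrier (wr m k)" "(a', y') \<star> \<phi> h = h \<star> (a, y)"
    using assms tw_iff by blast
  obtain b z where bz: "h = (b, z)" "b \<in> fsupp m k" "length z = k" using h(1) by (cases h) (auto simp: wr_carrier_iff)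
  obtain d where d: "\<phi> (b, z) = (d, top_map z)" using \<phi>_snd[OF bz(2,3)] by (cases "\<phi> (b, z)") auto
  have "y' +\<^sub>l top_map z = z +\<^sub>l y" using h(2) by (simp add: bz d wr_mult_eq)
  thus ?thesis using that h(2) bz by blast
qed

text \<open>With \<open>n\<close> classes, two of the \<open>n + 1\<close> elements with zero base
  and tops \<open>0\<close>, v, ..., n v are conjugate, so (1 - M)Z^k contains a positive multiple
  of \<open>v\<close> by a number at most \<open>n\<close>. All such numbers divide
  \<open>fact n\<close>, which serves every \<open>v\<close> at once.\<close>

lemma finite_index:
  obtains N where "N > 0" "\<And>v. length v = k \<Longrightarrow> \<exists>z. length z = k \<and> z -\<^sub>l top_map z = int N *\<^sub>l v"
proof -
  define n where "n = card (reidemeister_classes (wr m k) \<phi>)"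
  have "\<exists>z. length z = k \<and> z -\<^sub>l top_map z = int (fact n) *\<^sub>l v" if v: "length v = k" for v
  proof -
    define g where "g = (\<lambda>i. ((\<lambda>x. 0) :: int list \<Rightarrow> int, int i *\<^sub>l v))"
    let ?f = "\<lambda>j. tw `` {g j}"
    have g: "g j \<in> carrier (wr m k)" for j using v m by (simp add: g_def wr_carrier_iff)
    have "?f ` {0..n} \<subseteq> reidemeister_classes (wr m k) \<phi>"
      using g by (auto simp: reidemeister_classes_def intro: quotientI)
    hence "card (?f ` {0..n}) \<le> n" unfolding n_def by (intro card_mono finite_classes)
    hence "\<not> inj_on ?f {0..n}" using card_image[of ?f "{0..n}"] by auto
    then obtain i' j' where ij': "i' \<in> {0..n}" "j' \<in> {0..n}" "i' \<noteq> j'" "?f i' = ?f j'" by (auto simp: inj_on_def)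
    define i j where "i = min i' j'" and "j = max i' j'"
    have ij: "i < j" "j \<le> n" "?f i = ?f j" using ij' by (auto simp: i_def j_def min_def max_def)
    have "(g i, g j) \<in> tw" by (rule eq_equiv_class[OF ij(3) tw_equiv g])
    then obtain b z where z: "length z = k" "int j *\<^sub>l v +\<^sub>l top_map z = z +\<^sub>l int i *\<^sub>l v"
      unfolding g_def by (rule twisted_top)
    have zv: "z ! l - top_map z ! l = int (j - i) * v ! l" if l: "l < k" for l
    proof -
      have "(int j *\<^sub>l v +\<^sub>l top_map z) ! l = (z +\<^sub>l int i *\<^sub>l v) ! l" by (simp only: z(2))
      thus ?thesis using l v z(1) ij(1) by (simp add: of_nat_diff algebra_simps)
    qed
    have "j - i dvd fact n" using ij by (intro dvd_fact) auto
    then obtain e where e: "fact n = (j - i) * e" by (auto elim: dvdE)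
    have "int e *\<^sub>l z -\<^sub>l top_map (int e *\<^sub>l z) = int (fact n) *\<^sub>l v"
    proof (rule vec_eqI[of _ k])
      fix l assume l: "l < k"
      have "(int e *\<^sub>l z -\<^sub>l top_map (int e *\<^sub>l z)) ! l = int e * (z ! l - top_map z ! l)"
        using l z(1) by (simp add: additive_on_scale[OF additive_top_map] algebra_simps)
      also have "\<dots> = int (fact n) * v ! l" by (simp only: e zv[OF l]) simp
      finally show "(int e *\<^sub>l z -\<^sub>l top_map (int e *\<^sub>l z)) ! l = (int (fact n) *\<^sub>l v) ! l" using l v by simp
    qed (use z v in simp_all)
    thus ?thesis using z by (intro exI[of _ "int e *\<^sub>l z"]) simp
  qed
  thus ?thesis using that[of "fact n"] by simp
qed

text \<open>1 - M has image of finite index, hence no kernel. This confines conjugators between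
  elements of equal top component to the base group.\<close>

lemma top_map_fixed:
  assumes z: "length z = k" "top_map z = z"
  shows "z = vzero k"
proof -
  obtain N where N: "N > 0" "\<And>v. length v = k \<Longrightarrow> \<exists>z. length z = k \<and> z -\<^sub>l top_map z = int N *\<^sub>l v"
    by (rule finite_index) blast
  have "additive_on k (\<lambda>z. z -\<^sub>l top_map z)"
    by (auto simp: additive_on_def zk_def top_map_add intro!: vec_eqI[of _ k])
  thus ?thesis by (rule finite_index_imp_injective[OF _ N z(1)]) (use z in auto)
qed

text \<open>The top component of the conjugator is fixed by \<open>top_map\<close>, hence zero, and
  what remains is linear: a' - a lies in the image of 1 - \<alpha>(y)\<phi>.\<close>

lemma twisted_same_top:
  assumes "((a, y), (a', y)) \<in> tw"
  obtains b where "b \<in> fsupp m k" "\<And>x. x \<in> zk k \<Longrightarrow> int m dvd (a' x - a x) - (b x - base_map b (x -\<^sub>l y))"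
proof -
  have yl: "length y = k" using assms tw_iff by (auto simp: wr_carrier_iff)
  obtain b z where bz: "b \<in> fsupp m k" "length z = k" "y +\<^sub>l top_map z = z +\<^sub>l y"
    "(a', y) \<star> \<phi> (b, z) = (b, z) \<star> (a, y)"
    by (rule twisted_top[OF assms])
  have "top_map z = z" using bz(3) vec_cancel(3)[of y "top_map z"] vec_cancel(3)[of y z] yl bz(2)
    by (simp add: vadd_commute[of z y])
  hence z: "z = vzero k" by (rule top_map_fixed[OF bz(2)])
  show ?thesis
  proof (rule that[OF bz(1)])
    fix x assume "x \<in> zk k"
    hence x: "length x = k" by (simp add: zk_def)
    have "(a' x + base_map b (x -\<^sub>l y)) mod int m = (b x + a x) mod int m"
      using fun_cong[OF arg_cong[OF bz(4), of fst], of x] x by (simp add: z \<phi>_base[OF bz(1)] wr_mult_eq)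
    thus "int m dvd (a' x - a x) - (b x - base_map b (x -\<^sub>l y))"
      by (simp add: mod_eq_dvd_iff algebra_simps)
  qed
qed

text \<open>Modulo \<open>p\<close>, \<open>base_map\<close> followed by the shift by
  \<open>y\<close> is the operator behind \<open>coboundaries\<close> for T u = M u + x0 + y.
  Conjugate pairs among the \<open>(vdelta (X j), y)\<close> supply the pigeonhole premise of
  \<open>affine_coboundaries_full\<close>.\<close>

lemma surjective_mod_prime:
  assumes p: "prime p" "p dvd m" and y: "length y = k" and a: "a \<in> fsupp m k"
  obtains b where "b \<in> fsupp m k" "\<And>x. x \<in> zk k \<Longrightarrow> int p dvd a x - (b x - base_map b (x -\<^sub>l y))"
proof -
  have m1: "m > 1" using p m prime_gt_1_nat[of p] dvd_imp_le[of p m] by auto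
  have pm: "int p dvd int m" using p by simp
  obtain c x0 where x0: "x0 \<in> zk k"
    and mono: "\<And>b u. b \<in> fsupp m k \<Longrightarrow> u \<in> zk k \<Longrightarrow> int p dvd base_map b (top_map u +\<^sub>l x0) - c * b u"
    by (rule base_map_monomial[OF p]) blast
  have x0l: "length x0 = k" using x0 by (simp add: zk_def)
  define v where "v = x0 +\<^sub>l y"
  have v: "length v = k" using x0l y by (simp add: v_def)
  define T where "T = (\<lambda>u. top_map u +\<^sub>l v)"
  have Tz: "T u \<in> zk k" if "u \<in> zk k" for u using that v by (simp add: T_def zk_def)
  have bij: "bij_betw T (zk k) (zk k)"
  proof -
    have "bij_betw (\<lambda>x. x +\<^sub>l v) (zk k) (zk k)"
      by (rule bij_betw_byWitness[of _ "\<lambda>x. x -\<^sub>l v"]) (use v in \<open>auto simp: zk_def\<close>)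
    from bij_betw_trans[OF top_map_bij this] show ?thesis by (simp add: T_def o_def)
  qed
  obtain N where N: "N > 0" "\<And>v. length v = k \<Longrightarrow> \<exists>z. length z = k \<and> z -\<^sub>l top_map z = int N *\<^sub>l v"
    by (rule finite_index) blast
  obtain w where w: "length w = k" "w -\<^sub>l top_map w = int N *\<^sub>l v" using N(2)[OF v] by blast
  have T_sub: "T u -\<^sub>l y = top_map u +\<^sub>l x0" if "u \<in> zk k" for u
    using that x0l y by (auto simp: T_def v_def vec_assoc zk_def)
  have cob: "int p dvd base_map b (T u -\<^sub>l y) - c * b u" if "b \<in> fsupp m k" "u \<in> zk k" for b u
    using mono[OF that] T_sub[OF that(2)] by simp
  have full: "vdelta x \<in> coboundaries k (int p) c T" if x: "x \<in> zk k" for x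
  proof (rule affine_coboundaries_full[OF _ k additive_top_map v w(1) N(1) w(2) T_def bij _ x])
    show "prime (int p)" using p by simp
    fix X :: "nat \<Rightarrow> int list" assume X: "\<And>j. X j \<in> zk k"
    have g: "(vdelta (X j), y) \<in> carrier (wr m k)" for j
      using y X[of j] vdelta_fsupp[OF m1] by (simp add: wr_carrier_iff zk_def)
    obtain J where J: "infinite J"
      "\<And>i j. i \<in> J \<Longrightarrow> j \<in> J \<Longrightarrow> ((vdelta (X i), y), (vdelta (X j), y)) \<in> tw"
      using twisted_pigeonhole[of "\<lambda>j. (vdelta (X j), y)"] g by blast
    have "(\<lambda>u. vdelta (X i) u - vdelta (X j) u) \<in> coboundaries k (int p) c T" if ij: "i \<in> J" "j \<in> J" for i j
    proof -
      obtain b where b: "b \<in> fsupp m k"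
        "\<And>x. x \<in> zk k \<Longrightarrow> int m dvd (vdelta (X i) x - vdelta (X j) x) - (b x - base_map b (x -\<^sub>l y))"
        by (rule twisted_same_top[OF J(2)[OF ij(2,1)]]) blast
      have "int p dvd (vdelta (X i) (T u) - vdelta (X j) (T u)) - b (T u) + c * b u" if u: "u \<in> zk k" for u
      proof -
        have "int p dvd (vdelta (X i) (T u) - vdelta (X j) (T u)) - (b (T u) - base_map b (T u -\<^sub>l y))"
          using b(2)[OF Tz[OF u]] pm by (rule dvd_trans[rotated])
        from dvd_diff[OF this cob[OF b(1) u]] show ?thesis by (simp add: algebra_simps)
      qed
      moreover have "finite {u \<in> zk k. b u \<noteq> 0}" using fsuppD(1)[OF b(1)] by (rule finite_subset[rotated]) auto
      ultimately show ?thesis unfolding coboundaries_def by (intro CollectI exI[of _ b]) simp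
    qed
    thus "\<exists>J. infinite J \<and> (\<forall>i\<in>J. \<forall>j\<in>J. (\<lambda>u. vdelta (X i) u - vdelta (X j) u) \<in> coboundaries k (int p) c T)"
      using J(1) by blast
  qed
  define S where "S = {x. a x \<noteq> 0}"
  have S: "finite S" "S \<subseteq> zk k" using a by (auto simp: S_def fsupp_def zk_def)
  have "(\<lambda>u. \<Sum>x\<in>S. a x * vdelta x u) \<in> coboundaries k (int p) c T"
    using S full by (intro coboundaries_sum) auto
  moreover have "(\<lambda>u. \<Sum>x\<in>S. a x * vdelta x u) = a"
  proof
    fix u
    have "(\<Sum>x\<in>S. a x * vdelta x u) = (\<Sum>x\<in>S. if x = u then a u else 0)"
      by (intro sum.cong) (auto simp: vdelta_def)
    thus "(\<Sum>x\<in>S. a x * vdelta x u) = a u" using S by (auto simp: S_def)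
  qed
  ultimately obtain b where b: "finite {u \<in> zk k. b u \<noteq> 0}"
    "\<And>u. u \<in> zk k \<Longrightarrow> int p dvd a (T u) - b (T u) + c * b u" by (auto simp: coboundaries_def)
  \<comment> \<open>The witness has arbitrary integer values; reducing them modulo \<open>m\<close>
    preserves them modulo \<open>p\<close>, as \<open>p\<close> divides \<open>m\<close>.\<close>
  define b' where "b' = reduce m k b"
  have b': "b' \<in> fsupp m k" unfolding b'_def using b(1) by (intro fsuppI m) (simp add: zk_def)
  have b'b: "int p dvd b' x - b x" if "x \<in> zk k" for x
  proof -
    have "int m dvd b' x - b x" using that by (simp add: b'_def zk_def mod_eq_dvd_iff[symmetric])
    thus ?thesis using pm by (rule dvd_trans[rotated])
  qed
  show ?thesis
  proof (rule that[OF b'])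
    fix x assume x: "x \<in> zk k"
    then obtain u where u: "u \<in> zk k" "x = T u" using bij by (auto simp: bij_betw_def)
    have "a x - (b' x - base_map b' (x -\<^sub>l y)) = (a (T u) - b (T u) + c * b u) - (b' (T u) - b (T u))
        + (base_map b' (T u -\<^sub>l y) - c * b' u) + c * (b' u - b u)"
      by (simp add: u algebra_simps)
    with dvd_add[OF dvd_add[OF dvd_diff[OF b(2)[OF u(1)] b'b[OF Tz[OF u(1)]]] cob[OF b' u(1)]]
        dvd_mult[OF b'b[OF u(1)], of c]]
    show "int p dvd a x - (b' x - base_map b' (x -\<^sub>l y))" by (simp only:)
  qed
qed

lemma base_map_linear:
  assumes b: "b \<in> fsupp m k" and b': "b' \<in> fsupp m k" and x: "length x = k"
  shows "reduce m k (\<lambda>x. b x + int n * b' x) \<in> fsupp m k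
    \<and> int m dvd base_map (reduce m k (\<lambda>x. b x + int n * b' x)) x
        - (base_map b x + int n * base_map b' x)"
proof (induction n)
  case 0
  have "reduce m k (\<lambda>x. b x + int 0 * b' x) = b"
    using fsuppD(2,5)[OF b] by (auto simp: fun_eq_iff)
  thus ?case using b by simp
next
  case (Suc n)
  let ?b = "\<lambda>n x. if length x = k then (b x + int n * b' x) mod int m else 0"
  have e: "?b (Suc n) = reduce m k (\<lambda>x. ?b n x + b' x)"
    by (auto simp: fun_eq_iff mod_simps algebra_simps)
  have "reduce m k (\<lambda>x. ?b n x + b' (x -\<^sub>l vzero k)) \<in> fsupp m k"
    using Suc b' by (intro fsupp_mult m) auto
  moreover have "reduce m k (\<lambda>x. ?b n x + b' (x -\<^sub>l vzero k)) = ?b (Suc n)"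
    unfolding e by (auto simp: fun_eq_iff)
  moreover have "base_map (?b (Suc n)) x = (base_map (?b n) x + base_map b' x) mod int m"
    unfolding e using base_map_add[of "?b n" b'] Suc b' x by (simp add: fun_eq_iff)
  moreover have "int m dvd (y + z) mod int m - (t + int (Suc n) * z)" if "int m dvd y - (t + int n * z)" for y z t
  proof -
    have "int m dvd (y + z) mod int m - (y + z)" by (simp add: mod_eq_dvd_iff[symmetric])
    from dvd_add[OF this that] show ?thesis by (simp add: algebra_simps)
  qed
  ultimately show ?case using Suc by simp
qed

text \<open>Lifting through the prime factors of \<open>n\<close>: solving for the error
  \<open>e\<close> modulo \<open>p\<close> improves an error divisible by \<open>n\<close> to one
  divisible by \<open>p * n\<close>. For \<open>n = m\<close> this is surjectivity on the whole base
  group.\<close>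

lemma surjective_mod_divisor:
  assumes y: "length y = k" and a: "a \<in> fsupp m k"
  shows "n dvd m \<Longrightarrow> \<exists>b\<in>fsupp m k. \<exists>e\<in>fsupp m k. \<forall>x\<in>zk k.
    int m dvd a x - (b x - base_map b (x -\<^sub>l y)) - int n * e x"
proof (induction n rule: prime_divisors_induct)
  case zero
  thus ?case using m by simp
next
  case (unit n)
  thus ?case using a m base_map_zero by (intro bexI[of _ "\<lambda>x. 0"] bexI[of _ a]) auto
next
  case (factor p n)
  hence pn: "p dvd m" "n dvd m" by (auto elim: dvd_mult_left dvd_mult_right)
  obtain b e where b: "b \<in> fsupp m k" and e: "e \<in> fsupp m k"
    and be: "\<And>x. x \<in> zk k \<Longrightarrow> int m dvd a x - (b x - base_map b (x -\<^sub>l y)) - int n * e x"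
    using factor.IH[OF pn(2)] by blast
  obtain b' where b': "b' \<in> fsupp m k" "\<And>x. x \<in> zk k \<Longrightarrow> int p dvd e x - (b' x - base_map b' (x -\<^sub>l y))"
    by (rule surjective_mod_prime[OF factor.hyps(1) pn(1) y e]) blast
  \<comment> \<open>The exact quotient by \<open>p\<close> of what is left of \<open>e\<close>; its
    values need not be canonical residues, hence \<open>e'\<close>.\<close>
  define f where "f = (\<lambda>x. (e x - (b' x - base_map b' (x -\<^sub>l y))) div int p)"
  have f: "e x = b' x - base_map b' (x -\<^sub>l y) + int p * f x" if "x \<in> zk k" for x
    using b'(2)[OF that] by (simp add: f_def)
  define e' where "e' = reduce m k f"
  have e': "e' \<in> fsupp m k" unfolding e'_def
  proof (rule fsuppI[OF m])
    have "{x. length x = k \<and> f x \<noteq> 0} \<subseteq> {x. e x \<noteq> 0} \<union> {x. b' x \<noteq> 0} \<union> {x. length x = k \<and> base_map b' (x -\<^sub>l y) \<noteq> 0}"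
      by (auto simp: f_def)
    thus "finite {x. length x = k \<and> f x \<noteq> 0}"
      using fsuppD(1)[OF e] fsuppD(1)[OF b'(1)] finite_shift(1)[OF fsuppD(1)[OF base_map_closed[OF b'(1)]] y]
      by (auto intro: finite_subset)
  qed
  define B where "B = reduce m k (\<lambda>x. b x + int n * b' x)"
  have B: "B \<in> fsupp m k" using base_map_linear[OF b b'(1), of "vzero k" n] by (simp add: B_def)
  show ?case
  proof (rule bexI[OF _ B], rule bexI[OF _ e'], rule ballI)
    fix x assume x: "x \<in> zk k"
    hence xl: "length x = k" by (simp add: zk_def)
    have 1: "int m dvd B x - (b x + int n * b' x)" using xl by (simp add: B_def mod_eq_dvd_iff[symmetric])
    have 2: "int m dvd base_map B (x -\<^sub>l y) - (base_map b (x -\<^sub>l y) + int n * base_map b' (x -\<^sub>l y))"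
      using base_map_linear[OF b b'(1), of "x -\<^sub>l y" n] xl y by (simp add: B_def)
    have 3: "int m dvd e' x - f x" using xl by (simp add: e'_def mod_eq_dvd_iff[symmetric])
    have "a x - (B x - base_map B (x -\<^sub>l y)) - int (p * n) * e' x
      = (a x - (b x - base_map b (x -\<^sub>l y)) - int n * e x) - (B x - (b x + int n * b' x))
        + (base_map B (x -\<^sub>l y) - (base_map b (x -\<^sub>l y) + int n * base_map b' (x -\<^sub>l y)))
        - int (p * n) * (e' x - f x)"
      by (simp add: f[OF x] algebra_simps)
    with dvd_diff[OF dvd_add[OF dvd_diff[OF be[OF x] 1] 2] dvd_mult[OF 3, of "int (p * n)"]]
    show "int m dvd a x - (B x - base_map B (x -\<^sub>l y)) - int (p * n) * e' x" by (simp only:)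
  qed
qed

text \<open>The condition says that the top components differ by an element of (1 - M)Z^k.
  Conjugating by \<open>z\<close> alone then aligns them, and surjectivity of 1 - \<alpha>(y)\<phi>
  absorbs the difference left in the base.\<close>

lemma twisted_conj_char:
  assumes g: "g \<in> carrier (wr m k)" and g': "g' \<in> carrier (wr m k)"
  shows "(g, g') \<in> tw \<longleftrightarrow> (\<exists>z. length z = k \<and> snd g' +\<^sub>l top_map z = z +\<^sub>l snd g)"
proof
  assume "(g, g') \<in> tw"
  thus "\<exists>z. length z = k \<and> snd g' +\<^sub>l top_map z = z +\<^sub>l snd g"
    by (cases g; cases g') (auto elim: twisted_top)
next
  assume "\<exists>z. length z = k \<and> snd g' +\<^sub>l top_map z = z +\<^sub>l snd g"
  then obtain z where z: "length z = k" "snd g' +\<^sub>l top_map z = z +\<^sub>l snd g" by blast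
  define h where "h = ((\<lambda>x. 0) :: int list \<Rightarrow> int, z)"
  have h: "h \<in> carrier (wr m k)" using z m by (simp add: h_def wr_carrier_iff)
  define g'' where "g'' = h \<star> g \<star> \<phi> (inv\<^bsub>wr m k\<^esub> h)"
  have g'': "g'' \<in> carrier (wr m k)" using g h by (simp add: g''_def \<phi>_closed)
  have 1: "(g, g'') \<in> tw" using g g'' h unfolding twisted_conj_def g''_def by blast
  have "g'' \<star> \<phi> h = h \<star> g"
    using g h \<phi>_closed by (simp add: g''_def m_assoc \<phi>_mult[symmetric] \<phi>_one)
  hence "snd (g'' \<star> \<phi> h) = snd (h \<star> g)" by simp
  moreover have "snd (\<phi> h) = top_map z" by (simp add: h_def top_map_def)
  ultimately have s: "snd g'' +\<^sub>l top_map z = z +\<^sub>l snd g"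
    by (cases g; cases g''; cases "\<phi> h") (simp add: wr_mult_eq h_def)
  have l: "length (snd g'') = k" "length (snd g') = k" using g' g'' by (cases g', cases g'', auto simp: wr_carrier_iff)+
  have "snd g'' = snd g'"
    using s z vec_cancel(1)[of "snd g''" "top_map z"] vec_cancel(1)[of "snd g'" "top_map z"] l by simp
  then obtain a'' a' y where ga: "g'' = (a'', y)" "g' = (a', y)" by (cases g', cases g'') auto
  have a: "a'' \<in> fsupp m k" "a' \<in> fsupp m k" "length y = k" using g' g'' by (auto simp: ga wr_carrier_iff)
  have fd: "finite {x. length x = k \<and> a' x - a'' x \<noteq> 0}"
    by (rule finite_subset[of _ "{x. a' x \<noteq> 0} \<union> {x. a'' x \<noteq> 0}"]) (use fsuppD(1) a in auto)
  define d where "d = reduce m k (\<lambda>x. a' x - a'' x)"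
  have d: "d \<in> fsupp m k" unfolding d_def by (rule fsuppI[OF m fd])
  \<comment> \<open>With \<open>m\<close> itself as the divisor, the term in \<open>e\<close>
    vanishes modulo \<open>m\<close>.\<close>
  obtain b e where b: "b \<in> fsupp m k" and be: "\<And>x. x \<in> zk k \<Longrightarrow> int m dvd d x - (b x - base_map b (x -\<^sub>l y)) - int m * e x"
    using surjective_mod_divisor[OF a(3) d, of m] by auto
  have "(a' x + base_map b (x -\<^sub>l y)) mod int m = (b x + a'' x) mod int m" if x: "length x = k" for x
  proof -
    have 1: "int m dvd d x - (a' x - a'' x)" using x by (simp add: d_def mod_eq_dvd_iff[symmetric])
    have 2: "int m dvd d x - (b x - base_map b (x -\<^sub>l y)) - int m * e x" using be x by (simp add: zk_def)
    have "a' x + base_map b (x -\<^sub>l y) - (b x + a'' x)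
      = (d x - (b x - base_map b (x -\<^sub>l y)) - int m * e x) + int m * e x - (d x - (a' x - a'' x))" by simp
    with dvd_diff[OF dvd_add[OF 2 dvd_triv_left[of "int m" "e x"]] 1]
    have "int m dvd a' x + base_map b (x -\<^sub>l y) - (b x + a'' x)" by (simp only:)
    thus ?thesis by (simp add: mod_eq_dvd_iff)
  qed
  hence "g' \<star> \<phi> (b, vzero k) = (b, vzero k) \<star> g''"
    using a by (auto simp: ga wr_mult_eq \<phi>_base[OF b] fun_eq_iff)
  hence 2: "(g'', g') \<in> tw"
    using g' g'' b tw_iff by (auto simp: wr_carrier_iff)
  show "(g, g') \<in> tw" using tw_equiv 1 2 by (meson equiv_def transD)
qed

text \<open>Whether a product with \<open>h\<close> on the right lies in \<open>C\<close> depends on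
  \<open>h\<close> only through \<open>snd h\<close> modulo (1 - M)Z^k. As this lattice contains N
  Z^k, residue vectors modulo \<open>N\<close> account for all translates.\<close>

lemma finite_translates:
  assumes C: "C \<in> reidemeister_classes (wr m k) \<phi>"
  shows "finite ((\<lambda>h. translate h C) ` carrier (wr m k))"
proof -
  obtain g0 where g0: "g0 \<in> carrier (wr m k)" "C = tw `` {g0}"
    using C by (auto simp: reidemeister_classes_def elim: quotientE)
  obtain N where N: "N > 0" "\<And>v. length v = k \<Longrightarrow> \<exists>z. length z = k \<and> z -\<^sub>l top_map z = int N *\<^sub>l v"
    by (rule finite_index) blast
  have len: "length (snd g) = k" if "g \<in> carrier (wr m k)" for g using that by (cases g) (auto simp: wr_carrier_iff)
  have memC: "g \<in> C \<longleftrightarrow> (\<exists>z. length z = k \<and> snd g +\<^sub>l top_map z = z +\<^sub>l snd g0)" if "g \<in> carrier (wr m k)" for g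
    using twisted_conj_char[OF g0(1) that] by (simp add: g0(2))
  have snd_mult: "snd (g \<star> h) = snd g +\<^sub>l snd h" for g h
    by (cases g; cases h) (simp add: wr_mult_eq)
  \<comment> \<open>One inclusion suffices: passing to the negative of \<open>t\<close> exchanges
    \<open>h\<close> and \<open>h'\<close>.\<close>
  have sub: "translate h C \<subseteq> translate h' C"
    if h: "h \<in> carrier (wr m k)" "h' \<in> carrier (wr m k)" and t: "length t = k" "snd h' = snd h +\<^sub>l int N *\<^sub>l t" for h h' t
  proof
    fix g assume "g \<in> translate h C"
    hence g: "g \<in> carrier (wr m k)" "g \<star> h \<in> C" by (auto simp: translate_def)
    then obtain z where z: "length z = k" "snd g +\<^sub>l snd h +\<^sub>l top_map z = z +\<^sub>l snd g0"
      using memC[of "g \<star> h"] h by (auto simp: snd_mult)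
    obtain z' where z': "length z' = k" "z' -\<^sub>l top_map z' = int N *\<^sub>l t" using N(2)[OF t(1)] by blast
    have "snd g +\<^sub>l snd h' +\<^sub>l top_map (z +\<^sub>l z') = z +\<^sub>l z' +\<^sub>l snd g0"
    proof (rule vec_eqI[of _ k])
      fix i assume i: "i < k"
      have "(snd g +\<^sub>l snd h +\<^sub>l top_map z) ! i = (z +\<^sub>l snd g0) ! i" by (simp only: z(2))
      moreover have "(z' -\<^sub>l top_map z') ! i = (int N *\<^sub>l t) ! i" by (simp only: z'(2))
      ultimately show "(snd g +\<^sub>l snd h' +\<^sub>l top_map (z +\<^sub>l z')) ! i = (z +\<^sub>l z' +\<^sub>l snd g0) ! i"
        using i z(1) z'(1) t len[OF g(1)] len[OF h(1)] len[OF g0(1)] by (simp add: top_map_add)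
    qed (use z(1) z'(1) t len[OF g(1)] len[OF h(1)] len[OF g0(1)] in simp_all)
    hence "\<exists>z. length z = k \<and> snd (g \<star> h') +\<^sub>l top_map z = z +\<^sub>l snd g0"
      using z(1) z'(1) by (intro exI[of _ "z +\<^sub>l z'"]) (simp add: snd_mult)
    thus "g \<in> translate h' C" using g h memC by (simp add: translate_def)
  qed
  define V where "V = {v :: int list. set v \<subseteq> {0..<int N} \<and> length v = k}"
  have finV: "finite V" unfolding V_def by (rule finite_lists_length_eq) simp
  have "(\<lambda>h. translate h C) ` carrier (wr m k) \<subseteq> (\<lambda>v. translate ((\<lambda>x. 0), v) C) ` V"
  proof (rule image_subsetI)
    fix h assume h: "h \<in> carrier (wr m k)"
    define v where "v = map (\<lambda>t. t mod int N) (snd h)"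
    define t where "t = map (\<lambda>t. t div int N) (snd h)"
    have lt: "length t = k" "length v = k" using len[OF h] by (auto simp: t_def v_def)
    have v: "v \<in> V" using len[OF h] N(1) by (auto simp: V_def v_def)
    have vc: "((\<lambda>x. 0), v) \<in> carrier (wr m k)" using lt m by (simp add: wr_carrier_iff)
    have "snd h = v +\<^sub>l int N *\<^sub>l t" using len[OF h] by (auto simp: v_def t_def intro!: vec_eqI[of _ k])
    moreover have "v = snd h +\<^sub>l int N *\<^sub>l ((-1) *\<^sub>l t)"
      using len[OF h] by (auto simp: v_def t_def algebra_simps minus_div_mult_eq_mod[symmetric] intro!: vec_eqI[of _ k])
    ultimately have "translate h C = translate ((\<lambda>x. 0), v) C"
      using sub[OF h vc, of "(-1) *\<^sub>l t"] sub[OF vc h lt(1)] lt by (intro equalityI) auto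
    thus "translate h C \<in> (\<lambda>v. translate ((\<lambda>x. 0), v) C) ` V" using v by blast
  qed
  thus ?thesis using finV finite_surj by blast
qed

end

theorem theorem5p1:
  fixes m k :: nat
  assumes "(k = 1 \<and> m > 0 \<and> coprime m 6)
        \<or> (prime m \<and> m > 3 \<and> k \<ge> 1)
        \<or> (m = 3 \<and> (\<exists>d::nat. d \<ge> 1 \<and> k = 2 * d))"
  shows "\<forall>\<phi>. \<phi> \<in> iso (wreath_Zm_Zk m k) (wreath_Zm_Zk m k)
            \<and> finite (reidemeister_classes (wreath_Zm_Zk m k) \<phi>)
         \<longrightarrow> finite (fixed_dual_classes (wreath_Zm_Zk m k) \<phi>)
           \<and> card (fixed_dual_classes (wreath_Zm_Zk m k) \<phi>)
             = card (reidemeister_classes (wreath_Zm_Zk m k) \<phi>)"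
proof (intro allI impI)
  fix \<phi> assume \<phi>: "\<phi> \<in> iso (wreath_Zm_Zk m k) (wreath_Zm_Zk m k)
            \<and> finite (reidemeister_classes (wreath_Zm_Zk m k) \<phi>)"
  have mk: "m > 0" "k \<ge> 1" using assms by auto
  interpret finite_reidemeister m k \<phi>
    by unfold_locales (use mk \<phi> in auto)
  show "finite (fixed_dual_classes (wreath_Zm_Zk m k) \<phi>)
           \<and> card (fixed_dual_classes (wreath_Zm_Zk m k) \<phi>)
             = card (reidemeister_classes (wreath_Zm_Zk m k) \<phi>)"
    by (rule twisted_burnside_frobenius) (use \<phi> finite_classes finite_translates in auto)
qed

end
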